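(* Let $\mathbb{D}$ be a derivator and let $M$ be a small category. Then the prederivator $\mathbb{D}^M\colon\mathsf{Cat}^{op}\to\mathsf{CAT}$, $K\mapsto\mathbb{D}(M\times K)$, is a derivator.
   Context: $\mathsf{Cat}$ is the 2-category of small categories, $\mathsf{CAT}$ that of not necessarily small categories, $e$ the terminal category. A prederivator is a strict 2-functor $\mathbb{D}\colon\mathsf{Cat}^{op}\to\mathsf{CAT}$ (contravariant on functors, covariant on natural transformations). Write $u^\ast=\mathbb{D}(u)\colon\mathbb{D}(K)\to\mathbb{D}(J)$ for $u\colon J\to K$, and $\alpha^\ast=\mathbb{D}(\alpha)$. For $k\in K$, viewed as $k\colon e\to K$, write $X_k=k^\ast X\in\mathbb{D}(e)$, $f_k=k^\ast f$. $\mathbb{D}$ is a derivator if: (Der1) for all $J_1,J_2$ the functor $\mathbb{D}(J_1\sqcup J_2)\to\mathbb{D}(J_1)\times\mathbb{D}(J_2)$ induced by the inclusions is an equivalence, and $\mathbb{D}(\emptyset)$ is not the empty category; (Der2) a morphism $f$ in $\mathbb{D}(J)$ is an isomorphism iff $f_j$ is an isomorphism in $\mathbb{D}(e)$ for all $j\in J$; (Der3) every $u^\ast$ has a left adjoint $u_!$ and a right adjoint $u_\ast$ (homotopy left/right Kan extension); (Der4) for $u\colon J\to K$ and $k\in K$ let $J_{/k}$ be the category of pairs $(j,f\colon u(j)\to k)$ and $J_{k/}$ that of pairs $(j,f\colon k\to u(j))$, with projections $\mathrm{pr}$ to $J$ and $p$ to $e$, and let $\alpha\colon u\circ\mathrm{pr}\to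 k\circ p$, resp. $\alpha\colon k\circ p\to u\circ\mathrm{pr}$, be the transformation with components $f$. Then the maps $p_!\mathrm{pr}^\ast\xrightarrow{\eta}p_!\mathrm{pr}^\ast u^\ast u_!\xrightarrow{\alpha^\ast}p_!p^\ast k^\ast u_!\xrightarrow{\epsilon}k^\ast u_!$ and $k^\ast u_\ast\xrightarrow{\eta}p_\ast p^\ast k^\ast u_\ast\xrightarrow{\alpha^\ast}p_\ast\mathrm{pr}^\ast u^\ast u_\ast\xrightarrow{\epsilon}p_\ast\mathrm{pr}^\ast$ are isomorphisms. On functors $u\colon J\to K$, $\mathbb{D}^M(u)=(\mathrm{id}_M\times u)^\ast\colon\mathbb{D}(M\times K)\to\mathbb{D}(M\times J)$, and similarly for natural transformations. *)

theory Defs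
  imports Main "HOL-Library.FuncSet"
begin

section \<open>Categories, functors, natural transformations\<close>

text \<open>
  All data are required to be \<^const>\<open>undefined\<close> off their carriers, so that equality in HOL is
  strict equality of categories, functors and natural transformations.  The \<open>mk_\<close> functions
  build records normalised in this way.
\<close>

record ('o, 'a) cat =
  Obj :: "'o set"
  Arr :: "'a set"
  Dom :: "'a \<Rightarrow> 'o"
  Cod :: "'a \<Rightarrow> 'o"
  Id :: "'o \<Rightarrow> 'a"
  Comp :: "'a \<Rightarrow> 'a \<Rightarrow> 'a" \<comment> \<open>\<open>Comp C g f\<close> is \<open>f\<close> followed by \<open>g\<close>\<close>

definition hom :: "('o, 'a) cat \<Rightarrow> 'o \<Rightarrow> 'o \<Rightarrow> 'a set" where
  "hom C x y = {f \<in> Arr C. Dom C f = x \<and> Cod C f = y}"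

locale category =
  fixes C :: "('o, 'a) cat"
  assumes Dom_closed: "Dom C \<in> Arr C \<rightarrow>\<^sub>E Obj C"
    and Cod_closed: "Cod C \<in> Arr C \<rightarrow>\<^sub>E Obj C"
    and Id_ext: "Id C \<in> extensional (Obj C)"
    and Id_hom: "x \<in> Obj C \<Longrightarrow> Id C x \<in> hom C x x"
    and Comp_ext: "\<not> (f \<in> Arr C \<and> g \<in> Arr C \<and> Dom C g = Cod C f) \<Longrightarrow> Comp C g f = undefined"
    and Comp_hom: "f \<in> hom C x y \<Longrightarrow> g \<in> hom C y z \<Longrightarrow> Comp C g f \<in> hom C x z"
    and Comp_Id_left: "f \<in> hom C x y \<Longrightarrow> Comp C (Id C y) f = f"
    and Comp_Id_right: "f \<in> hom C x y \<Longrightarrow> Comp C f (Id C x) = f"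
    and Comp_assoc: "f \<in> hom C w x \<Longrightarrow> g \<in> hom C x y \<Longrightarrow> h \<in> hom C y z \<Longrightarrow>
      Comp C h (Comp C g f) = Comp C (Comp C h g) f"

definition mk_cat ::
  "'o set \<Rightarrow> 'a set \<Rightarrow> ('a \<Rightarrow> 'o) \<Rightarrow> ('a \<Rightarrow> 'o) \<Rightarrow> ('o \<Rightarrow> 'a) \<Rightarrow> ('a \<Rightarrow> 'a \<Rightarrow> 'a) \<Rightarrow> ('o, 'a) cat" where
  "mk_cat Ob Ar d c i m = \<lparr>Obj = Ob, Arr = Ar, Dom = restrict d Ar, Cod = restrict c Ar,
     Id = restrict i Ob,
     Comp = (\<lambda>g f. if f \<in> Ar \<and> g \<in> Ar \<and> d g = c f then m g f else undefined)\<rparr>"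

definition iso :: "('o, 'a) cat \<Rightarrow> 'a \<Rightarrow> bool" where
  "iso C f \<longleftrightarrow> f \<in> Arr C \<and> (\<exists>g \<in> hom C (Cod C f) (Dom C f).
     Comp C g f = Id C (Dom C f) \<and> Comp C f g = Id C (Cod C f))"

record ('o, 'a, 'p, 'b) ftor =
  Src :: "('o, 'a) cat"
  Tgt :: "('p, 'b) cat"
  FObj :: "'o \<Rightarrow> 'p"
  FArr :: "'a \<Rightarrow> 'b"

definition functors :: "('o, 'a) cat \<Rightarrow> ('p, 'b) cat \<Rightarrow> ('o, 'a, 'p, 'b) ftor set" where
  "functors C D = {F. Src F = C \<and> Tgt F = D \<and> category C \<and> category D \<and>
     FObj F \<in> Obj C \<rightarrow>\<^sub>E Obj D \<and> FArr F \<in> extensional (Arr C) \<and>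
     (\<forall>f \<in> Arr C. FArr F f \<in> hom D (FObj F (Dom C f)) (FObj F (Cod C f))) \<and>
     (\<forall>x \<in> Obj C. FArr F (Id C x) = Id D (FObj F x)) \<and>
     (\<forall>f \<in> Arr C. \<forall>g \<in> Arr C. Dom C g = Cod C f \<longrightarrow>
        FArr F (Comp C g f) = Comp D (FArr F g) (FArr F f))}"

definition mk_ftor ::
  "('o, 'a) cat \<Rightarrow> ('p, 'b) cat \<Rightarrow> ('o \<Rightarrow> 'p) \<Rightarrow> ('a \<Rightarrow> 'b) \<Rightarrow> ('o, 'a, 'p, 'b) ftor" where
  "mk_ftor C D fo fa =
     \<lparr>Src = C, Tgt = D, FObj = restrict fo (Obj C), FArr = restrict fa (Arr C)\<rparr>"

definition id_ftor :: "('o, 'a) cat \<Rightarrow> ('o, 'a, 'o, 'a) ftor" where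
  "id_ftor C = mk_ftor C C (\<lambda>x. x) (\<lambda>f. f)"

definition comp_ftor ::
  "('p, 'b, 'q, 'c) ftor \<Rightarrow> ('o, 'a, 'p, 'b) ftor \<Rightarrow> ('o, 'a, 'q, 'c) ftor" (infixr "\<circ>\<^sub>F" 75) where
  "G \<circ>\<^sub>F F = mk_ftor (Src F) (Tgt G) (\<lambda>x. FObj G (FObj F x)) (\<lambda>f. FArr G (FArr F f))"

record ('o, 'a, 'p, 'b) ntrans =
  NSrc :: "('o, 'a, 'p, 'b) ftor"
  NTgt :: "('o, 'a, 'p, 'b) ftor"
  Cmp :: "'o \<Rightarrow> 'b"

definition nats ::
  "('o, 'a, 'p, 'b) ftor \<Rightarrow> ('o, 'a, 'p, 'b) ftor \<Rightarrow> ('o, 'a, 'p, 'b) ntrans set" where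
  "nats F G = {\<tau>. NSrc \<tau> = F \<and> NTgt \<tau> = G \<and>
     F \<in> functors (Src F) (Tgt F) \<and> G \<in> functors (Src F) (Tgt F) \<and>
     Cmp \<tau> \<in> extensional (Obj (Src F)) \<and>
     (\<forall>x \<in> Obj (Src F). Cmp \<tau> x \<in> hom (Tgt F) (FObj F x) (FObj G x)) \<and>
     (\<forall>f \<in> Arr (Src F).
        Comp (Tgt F) (FArr G f) (Cmp \<tau> (Dom (Src F) f)) =
        Comp (Tgt F) (Cmp \<tau> (Cod (Src F) f)) (FArr F f))}"

definition mk_nat ::
  "('o, 'a, 'p, 'b) ftor \<Rightarrow> ('o, 'a, 'p, 'b) ftor \<Rightarrow> ('o \<Rightarrow> 'b) \<Rightarrow> ('o, 'a, 'p, 'b) ntrans" where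
  "mk_nat F G c = \<lparr>NSrc = F, NTgt = G, Cmp = restrict c (Obj (Src F))\<rparr>"

definition nat_iso :: "('o, 'a, 'p, 'b) ntrans \<Rightarrow> bool" where
  "nat_iso \<tau> \<longleftrightarrow> \<tau> \<in> nats (NSrc \<tau>) (NTgt \<tau>) \<and>
     (\<forall>x \<in> Obj (Src (NSrc \<tau>)). iso (Tgt (NSrc \<tau>)) (Cmp \<tau> x))"

definition id_nat :: "('o, 'a, 'p, 'b) ftor \<Rightarrow> ('o, 'a, 'p, 'b) ntrans" where
  "id_nat F = mk_nat F F (\<lambda>x. Id (Tgt F) (FObj F x))"

definition vcomp ::
  "('o, 'a, 'p, 'b) ntrans \<Rightarrow> ('o, 'a, 'p, 'b) ntrans \<Rightarrow> ('o, 'a, 'p, 'b) ntrans" (infixr "\<bullet>" 70) where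
  "\<tau> \<bullet> \<sigma> = mk_nat (NSrc \<sigma>) (NTgt \<tau>) (\<lambda>x. Comp (Tgt (NSrc \<sigma>)) (Cmp \<tau> x) (Cmp \<sigma> x))"

definition hcomp ::
  "('p, 'b, 'q, 'c) ntrans \<Rightarrow> ('o, 'a, 'p, 'b) ntrans \<Rightarrow> ('o, 'a, 'q, 'c) ntrans" (infixr "\<star>" 75) where
  "\<tau> \<star> \<sigma> = mk_nat (NSrc \<tau> \<circ>\<^sub>F NSrc \<sigma>) (NTgt \<tau> \<circ>\<^sub>F NTgt \<sigma>)
     (\<lambda>x. Comp (Tgt (NSrc \<tau>)) (FArr (NTgt \<tau>) (Cmp \<sigma> x)) (Cmp \<tau> (FObj (NSrc \<sigma>) x)))"

definition whisker_left ::
  "('p, 'b, 'q, 'c) ftor \<Rightarrow> ('o, 'a, 'p, 'b) ntrans \<Rightarrow> ('o, 'a, 'q, 'c) ntrans" (infixr "\<triangleright>" 75) where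
  "G \<triangleright> \<sigma> = mk_nat (G \<circ>\<^sub>F NSrc \<sigma>) (G \<circ>\<^sub>F NTgt \<sigma>) (\<lambda>x. FArr G (Cmp \<sigma> x))"

definition whisker_right ::
  "('p, 'b, 'q, 'c) ntrans \<Rightarrow> ('o, 'a, 'p, 'b) ftor \<Rightarrow> ('o, 'a, 'q, 'c) ntrans" (infixl "\<triangleleft>" 76) where
  "\<tau> \<triangleleft> F = mk_nat (NSrc \<tau> \<circ>\<^sub>F F) (NTgt \<tau> \<circ>\<^sub>F F) (\<lambda>x. Cmp \<tau> (FObj F x))"

definition equivalence :: "('o, 'a, 'p, 'b) ftor \<Rightarrow> bool" where
  "equivalence F \<longleftrightarrow> F \<in> functors (Src F) (Tgt F) \<and>
     (\<exists>G \<in> functors (Tgt F) (Src F).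
        (\<exists>\<eta> \<in> nats (id_ftor (Src F)) (G \<circ>\<^sub>F F). nat_iso \<eta>) \<and>
        (\<exists>\<epsilon> \<in> nats (F \<circ>\<^sub>F G) (id_ftor (Tgt F)). nat_iso \<epsilon>))"

text \<open>\<open>adjunction L R \<eta> \<epsilon>\<close>: \<open>L\<close> is left adjoint to \<open>R\<close> with unit \<open>\<eta>\<close> and counit \<open>\<epsilon>\<close>.\<close>

definition adjunction ::
  "('o, 'a, 'p, 'b) ftor \<Rightarrow> ('p, 'b, 'o, 'a) ftor \<Rightarrow>
   ('o, 'a, 'o, 'a) ntrans \<Rightarrow> ('p, 'b, 'p, 'b) ntrans \<Rightarrow> bool" where
  "adjunction L R \<eta> \<epsilon> \<longleftrightarrow>
     L \<in> functors (Src L) (Tgt L) \<and> R \<in> functors (Tgt L) (Src L) \<and>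
     \<eta> \<in> nats (id_ftor (Src L)) (R \<circ>\<^sub>F L) \<and> \<epsilon> \<in> nats (L \<circ>\<^sub>F R) (id_ftor (Tgt L)) \<and>
     (\<epsilon> \<triangleleft> L) \<bullet> (L \<triangleright> \<eta>) = id_nat L \<and> (R \<triangleright> \<epsilon>) \<bullet> (\<eta> \<triangleleft> R) = id_nat R"

definition prod_cat ::
  "('o, 'a) cat \<Rightarrow> ('p, 'b) cat \<Rightarrow> ('o \<times> 'p, 'a \<times> 'b) cat" where
  "prod_cat C D = mk_cat (Obj C \<times> Obj D) (Arr C \<times> Arr D)
     (\<lambda>(f, g). (Dom C f, Dom D g)) (\<lambda>(f, g). (Cod C f, Cod D g))
     (\<lambda>(x, y). (Id C x, Id D y)) (\<lambda>(f', g') (f, g). (Comp C f' f, Comp D g' g))"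

definition pair_ftor ::
  "('o, 'a, 'p, 'b) ftor \<Rightarrow> ('o, 'a, 'q, 'c) ftor \<Rightarrow> ('o, 'a, 'p \<times> 'q, 'b \<times> 'c) ftor" where
  "pair_ftor F G = mk_ftor (Src F) (prod_cat (Tgt F) (Tgt G))
     (\<lambda>x. (FObj F x, FObj G x)) (\<lambda>f. (FArr F f, FArr G f))"


section \<open>Small categories\<close>

text \<open>
  A notion of smallness for subsets of a type, together with codes for ordered pairs and two tags,
  so that products, coproducts and comma categories of categories living on the type live on it
  again.  The type of the elements of a Grothendieck universe, a subset being small if it is an
  element, is an instance; power sets are not needed here, so closure under them is not assumed.
\<close>

class universe =
  fixes small :: "'a set \<Rightarrow> bool"
    and pair :: "'a \<Rightarrow> 'a \<Rightarrow> 'a"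
    and pfst :: "'a \<Rightarrow> 'a"
    and psnd :: "'a \<Rightarrow> 'a"
    and tagL :: 'a
    and tagR :: 'a
  assumes small_finite: "finite A \<Longrightarrow> small A"
    and small_subset: "small B \<Longrightarrow> A \<subseteq> B \<Longrightarrow> small A"
    and small_image: "small A \<Longrightarrow> small (f ` A)"
    and small_UN: "small A \<Longrightarrow> (\<And>x. x \<in> A \<Longrightarrow> small (F x)) \<Longrightarrow> small (\<Union>x\<in>A. F x)"
    and pfst_pair [simp]: "pfst (pair x y) = x"
    and psnd_pair [simp]: "psnd (pair x y) = y"
    and tagL_neq_tagR [simp]: "tagL \<noteq> tagR"

type_synonym 'u scat = "('u, 'u) cat"
type_synonym 'u sftor = "('u, 'u, 'u, 'u) ftor"
type_synonym 'u sntrans = "('u, 'u, 'u, 'u) ntrans"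

definition small_cat :: "'u::universe scat \<Rightarrow> bool" where
  "small_cat C \<longleftrightarrow> category C \<and> small (Obj C) \<and> small (Arr C)"

definition empty_cat :: "'u::universe scat" where
  "empty_cat = mk_cat {} {} (\<lambda>f. f) (\<lambda>f. f) (\<lambda>x. x) (\<lambda>g f. f)"

definition one_cat :: "'u::universe scat" where
  "one_cat = mk_cat {tagL} {tagL} (\<lambda>f. f) (\<lambda>f. f) (\<lambda>x. x) (\<lambda>g f. f)"

definition to_one :: "'u::universe scat \<Rightarrow> 'u sftor" where
  "to_one J = mk_ftor J one_cat (\<lambda>_. tagL) (\<lambda>_. tagL)"

definition point :: "'u::universe scat \<Rightarrow> 'u \<Rightarrow> 'u sftor" where
  "point K k = mk_ftor one_cat K (\<lambda>_. k) (\<lambda>_. Id K k)"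

definition sum_cat :: "'u::universe scat \<Rightarrow> 'u scat \<Rightarrow> 'u scat" where
  "sum_cat J K =
    (let
      by_tag = (\<lambda>l r x. pair (pfst x) (if pfst x = tagL then l (psnd x) else r (psnd x)))
     in mk_cat
      (pair tagL ` Obj J \<union> pair tagR ` Obj K)
      (pair tagL ` Arr J \<union> pair tagR ` Arr K)
      (by_tag (Dom J) (Dom K)) (by_tag (Cod J) (Cod K)) (by_tag (Id J) (Id K))
      (\<lambda>g. by_tag (Comp J (psnd g)) (Comp K (psnd g))))"

definition in_left :: "'u::universe scat \<Rightarrow> 'u scat \<Rightarrow> 'u sftor" where
  "in_left J K = mk_ftor J (sum_cat J K) (pair tagL) (pair tagL)"

definition in_right :: "'u::universe scat \<Rightarrow> 'u scat \<Rightarrow> 'u sftor" where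
  "in_right J K = mk_ftor K (sum_cat J K) (pair tagR) (pair tagR)"

definition sprod :: "'u::universe scat \<Rightarrow> 'u scat \<Rightarrow> 'u scat" where
  "sprod M K = mk_cat
     {pair m k | m k. m \<in> Obj M \<and> k \<in> Obj K}
     {pair f g | f g. f \<in> Arr M \<and> g \<in> Arr K}
     (\<lambda>a. pair (Dom M (pfst a)) (Dom K (psnd a)))
     (\<lambda>a. pair (Cod M (pfst a)) (Cod K (psnd a)))
     (\<lambda>x. pair (Id M (pfst x)) (Id K (psnd x)))
     (\<lambda>b a. pair (Comp M (pfst b) (pfst a)) (Comp K (psnd b) (psnd a)))"

text \<open>The functor \<open>id\<^sub>M \<times> u\<close> and the transformation \<open>id\<^sub>M \<times> \<alpha>\<close>.\<close>

definition sprod_ftor :: "'u::universe scat \<Rightarrow> 'u sftor \<Rightarrow> 'u sftor" where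
  "sprod_ftor M u = mk_ftor (sprod M (Src u)) (sprod M (Tgt u))
     (\<lambda>x. pair (pfst x) (FObj u (psnd x))) (\<lambda>f. pair (pfst f) (FArr u (psnd f)))"

definition sprod_nat :: "'u::universe scat \<Rightarrow> 'u sntrans \<Rightarrow> 'u sntrans" where
  "sprod_nat M \<alpha> = mk_nat (sprod_ftor M (NSrc \<alpha>)) (sprod_ftor M (NTgt \<alpha>))
     (\<lambda>x. pair (Id M (pfst x)) (Cmp \<alpha> (psnd x)))"

text \<open>
  For \<open>u : J \<rightarrow> K\<close>, a morphism \<open>(j, f) \<rightarrow> (j', f')\<close> of \<open>J\<^bsub>/k\<^esub>\<close> is some \<open>h : j \<rightarrow> j'\<close> with
  \<open>f' \<circ> u h = f\<close>.  It is coded as the pair \<open>(h, f')\<close>, which determines \<open>(j, f)\<close> and \<open>(j', f')\<close>.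
  Dually, a morphism of \<open>J\<^bsub>k/\<^esub>\<close> is coded as the pair of \<open>h\<close> and the structure map of its domain.
\<close>

definition over_cat :: "'u::universe sftor \<Rightarrow> 'u \<Rightarrow> 'u scat" where
  "over_cat u k = (let J = Src u; K = Tgt u in mk_cat
     {pair j f | j f. j \<in> Obj J \<and> f \<in> hom K (FObj u j) k}
     {pair h f' | h f'. h \<in> Arr J \<and> f' \<in> hom K (FObj u (Cod J h)) k}
     (\<lambda>a. pair (Dom J (pfst a)) (Comp K (psnd a) (FArr u (pfst a))))
     (\<lambda>a. pair (Cod J (pfst a)) (psnd a))
     (\<lambda>x. pair (Id J (pfst x)) (psnd x))
     (\<lambda>b a. pair (Comp J (pfst b) (pfst a)) (psnd b)))"

definition under_cat :: "'u::universe sftor \<Rightarrow> 'u \<Rightarrow> 'u scat" where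
  "under_cat u k = (let J = Src u; K = Tgt u in mk_cat
     {pair j f | j f. j \<in> Obj J \<and> f \<in> hom K k (FObj u j)}
     {pair h f | h f. h \<in> Arr J \<and> f \<in> hom K k (FObj u (Dom J h))}
     (\<lambda>a. pair (Dom J (pfst a)) (psnd a))
     (\<lambda>a. pair (Cod J (pfst a)) (Comp K (FArr u (pfst a)) (psnd a)))
     (\<lambda>x. pair (Id J (pfst x)) (psnd x))
     (\<lambda>b a. pair (Comp J (pfst b) (pfst a)) (psnd a)))"

definition over_proj :: "'u::universe sftor \<Rightarrow> 'u \<Rightarrow> 'u sftor" where
  "over_proj u k = mk_ftor (over_cat u k) (Src u) pfst pfst"

definition under_proj :: "'u::universe sftor \<Rightarrow> 'u \<Rightarrow> 'u sftor" where
  "under_proj u k = mk_ftor (under_cat u k) (Src u) pfst pfst"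

definition over_nat :: "'u::universe sftor \<Rightarrow> 'u \<Rightarrow> 'u sntrans" where
  "over_nat u k =
     mk_nat (u \<circ>\<^sub>F over_proj u k) (point (Tgt u) k \<circ>\<^sub>F to_one (over_cat u k)) psnd"

definition under_nat :: "'u::universe sftor \<Rightarrow> 'u \<Rightarrow> 'u sntrans" where
  "under_nat u k =
     mk_nat (point (Tgt u) k \<circ>\<^sub>F to_one (under_cat u k)) (u \<circ>\<^sub>F under_proj u k) psnd"


section \<open>Derivators\<close>

text \<open>
  The types \<open>'o\<close> and \<open>'a\<close> carrying the objects and arrows of the values are unrelated to the
  type \<open>'u\<close> of the small categories, and no smallness is imposed on the values.
\<close>

record ('u, 'o, 'a) diagram_functor =
  on_cat :: "'u scat \<Rightarrow> ('o, 'a) cat"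
  on_ftor :: "'u sftor \<Rightarrow> ('o, 'a, 'o, 'a) ftor"
  on_nat :: "'u sntrans \<Rightarrow> ('o, 'a, 'o, 'a) ntrans"

locale prederivator =
  fixes D :: "('u::universe, 'o, 'a) diagram_functor"
  assumes on_cat: "small_cat J \<Longrightarrow> category (on_cat D J)"
    and on_ftor: "\<lbrakk>small_cat J; small_cat K; u \<in> functors J K\<rbrakk> \<Longrightarrow>
      on_ftor D u \<in> functors (on_cat D K) (on_cat D J)"
    and on_nat: "\<lbrakk>small_cat J; small_cat K; u \<in> functors J K; v \<in> functors J K; \<alpha> \<in> nats u v\<rbrakk> \<Longrightarrow>
      on_nat D \<alpha> \<in> nats (on_ftor D u) (on_ftor D v)"
    and on_id_ftor: "small_cat J \<Longrightarrow> on_ftor D (id_ftor J) = id_ftor (on_cat D J)"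
    and on_comp_ftor:
      "\<lbrakk>small_cat J; small_cat K; small_cat L; u \<in> functors J K; v \<in> functors K L\<rbrakk> \<Longrightarrow>
      on_ftor D (v \<circ>\<^sub>F u) = on_ftor D u \<circ>\<^sub>F on_ftor D v"
    and on_id_nat: "\<lbrakk>small_cat J; small_cat K; u \<in> functors J K\<rbrakk> \<Longrightarrow>
      on_nat D (id_nat u) = id_nat (on_ftor D u)"
    and on_vcomp:
      "\<lbrakk>small_cat J; small_cat K; u \<in> functors J K; v \<in> functors J K; w \<in> functors J K;
        \<alpha> \<in> nats u v; \<beta> \<in> nats v w\<rbrakk> \<Longrightarrow>
      on_nat D (\<beta> \<bullet> \<alpha>) = on_nat D \<beta> \<bullet> on_nat D \<alpha>"
    and on_hcomp:
      "\<lbrakk>small_cat J; small_cat K; small_cat L;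
        u \<in> functors J K; u' \<in> functors J K; v \<in> functors K L; v' \<in> functors K L;
        \<alpha> \<in> nats u u'; \<beta> \<in> nats v v'\<rbrakk> \<Longrightarrow>
      on_nat D (\<beta> \<star> \<alpha>) = on_nat D \<alpha> \<star> on_nat D \<beta>"

text \<open>
  The maps \<open>p\<^sub>! pr\<^sup>* \<rightarrow> k\<^sup>* u\<^sub>!\<close> and \<open>k\<^sup>* u\<^sub>* \<rightarrow> p\<^sub>* pr\<^sup>*\<close> for given left (right) adjoints \<open>U\<close> of \<open>u\<^sup>*\<close> and
  \<open>P\<close> of \<open>p\<^sup>*\<close>; \<open>\<eta>\<close> and \<open>\<epsilon>\<close> are the unit and counit which occur in them.
\<close>

definition left_kan_map ::
  "('u::universe, 'o, 'a) diagram_functor \<Rightarrow> 'u sftor \<Rightarrow> 'u \<Rightarrow>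
   ('o, 'a, 'o, 'a) ftor \<Rightarrow> ('o, 'a, 'o, 'a) ntrans \<Rightarrow>
   ('o, 'a, 'o, 'a) ftor \<Rightarrow> ('o, 'a, 'o, 'a) ntrans \<Rightarrow> ('o, 'a, 'o, 'a) ntrans" where
  "left_kan_map D u k U \<eta> P \<epsilon> =
     (\<epsilon> \<triangleleft> (on_ftor D (point (Tgt u) k) \<circ>\<^sub>F U)) \<bullet>
     (P \<triangleright> (on_nat D (over_nat u k) \<triangleleft> U)) \<bullet>
     ((P \<circ>\<^sub>F on_ftor D (over_proj u k)) \<triangleright> \<eta>)"

definition right_kan_map ::
  "('u::universe, 'o, 'a) diagram_functor \<Rightarrow> 'u sftor \<Rightarrow> 'u \<Rightarrow>
   ('o, 'a, 'o, 'a) ftor \<Rightarrow> ('o, 'a, 'o, 'a) ntrans \<Rightarrow>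
   ('o, 'a, 'o, 'a) ftor \<Rightarrow> ('o, 'a, 'o, 'a) ntrans \<Rightarrow> ('o, 'a, 'o, 'a) ntrans" where
  "right_kan_map D u k U \<epsilon> P \<eta> =
     ((P \<circ>\<^sub>F on_ftor D (under_proj u k)) \<triangleright> \<epsilon>) \<bullet>
     (P \<triangleright> (on_nat D (under_nat u k) \<triangleleft> U)) \<bullet>
     (\<eta> \<triangleleft> (on_ftor D (point (Tgt u) k) \<circ>\<^sub>F U))"

text \<open>
  Adjoints are unique up to unique isomorphism, so (Der4) does not depend on the choice of the
  adjoints provided by (Der3); it is required for all choices.
\<close>

locale derivator = prederivator +
  assumes Der1_sum: "\<lbrakk>small_cat J\<^sub>1; small_cat J\<^sub>2\<rbrakk> \<Longrightarrow>
      equivalence (pair_ftor (on_ftor D (in_left J\<^sub>1 J\<^sub>2)) (on_ftor D (in_right J\<^sub>1 J\<^sub>2)))"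
    and Der1_empty: "Obj (on_cat D empty_cat) \<noteq> {}"
    and Der2: "\<lbrakk>small_cat J; f \<in> Arr (on_cat D J)\<rbrakk> \<Longrightarrow>
      iso (on_cat D J) f \<longleftrightarrow>
      (\<forall>j \<in> Obj J. iso (on_cat D one_cat) (FArr (on_ftor D (point J j)) f))"
    and Der3_left: "\<lbrakk>small_cat J; small_cat K; u \<in> functors J K\<rbrakk> \<Longrightarrow>
      \<exists>U \<eta> \<epsilon>. adjunction U (on_ftor D u) \<eta> \<epsilon>"
    and Der3_right: "\<lbrakk>small_cat J; small_cat K; u \<in> functors J K\<rbrakk> \<Longrightarrow>
      \<exists>U \<eta> \<epsilon>. adjunction (on_ftor D u) U \<eta> \<epsilon>"
    and Der4_left:
      "\<lbrakk>small_cat J; small_cat K; u \<in> functors J K; k \<in> Obj K;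
        adjunction U (on_ftor D u) \<eta> \<epsilon>;
        adjunction P (on_ftor D (to_one (over_cat u k))) \<eta>' \<epsilon>'\<rbrakk> \<Longrightarrow>
      nat_iso (left_kan_map D u k U \<eta> P \<epsilon>')"
    and Der4_right:
      "\<lbrakk>small_cat J; small_cat K; u \<in> functors J K; k \<in> Obj K;
        adjunction (on_ftor D u) U \<eta> \<epsilon>;
        adjunction (on_ftor D (to_one (under_cat u k))) P \<eta>' \<epsilon>'\<rbrakk> \<Longrightarrow>
      nat_iso (right_kan_map D u k U \<epsilon> P \<eta>')"

definition shift ::
  "('u::universe, 'o, 'a) diagram_functor \<Rightarrow> 'u scat \<Rightarrow> ('u, 'o, 'a) diagram_functor" where
  "shift D M = \<lparr>on_cat = (\<lambda>K. on_cat D (sprod M K)),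
     on_ftor = (\<lambda>u. on_ftor D (sprod_ftor M u)),
     on_nat = (\<lambda>\<alpha>. on_nat D (sprod_nat M \<alpha>))\<rparr>"

end

theory Submission
  imports Defs
begin

text \<open>
  The shift by \<open>M\<close> sends \<open>K\<close> to \<open>D(M \<times> K)\<close>. Since \<open>M \<times> _\<close> is a strict 2-functor on small
  categories, it is a prederivator, and most of the axioms are those of \<open>D\<close> read at other
  categories: (Der3) for \<open>u\<close> is (Der3) for \<open>id\<^sub>M \<times> u\<close>, (Der2) holds because the points of
  \<open>M \<times> K\<close> are the points \<open>(m, *)\<close> of \<open>M \<times> e\<close> followed by \<open>id\<^sub>M \<times> k\<close>, and (Der1) holds because
  \<open>M \<times> (J \<squnion> K)\<close> is isomorphic to \<open>(M \<times> J) \<squnion> (M \<times> K)\<close>.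

  The content is (Der4). Let \<open>u : J \<rightarrow> K\<close>, let \<open>p : J\<^bsub>/k\<^esub> \<rightarrow> e\<close> be the projection, and put
  \<open>q = id\<^sub>M \<times> p\<close>. The map \<open>\<beta>\<close> to be inverted is the mate of the product of \<open>M\<close> with the comma
  square of \<open>u\<close> and \<open>k\<close>, and that square is in general not a comma square. It becomes one
  after pasting. By (Der2) it suffices that \<open>\<beta>\<close> is invertible at each point \<open>(m, *)\<close> of
  \<open>M \<times> e\<close>. Paste the comma square of \<open>q\<close> and \<open>(m, *)\<close>, whose mate \<open>\<gamma>\<close> is invertible by (Der4)
  for \<open>D\<close>. The mate of the pasted square is \<open>\<beta>\<close> at \<open>(m, *)\<close> after \<open>\<gamma>\<close> (lemma \<open>mate_paste\<close>). On
  the other hand, the objects of the comma category of \<open>q\<close> and \<open>(m, *)\<close> consist of \<open>m'\<close>, \<open>j\<close>,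
  \<open>u(j) \<rightarrow> k\<close> and \<open>m' \<rightarrow> m\<close>, just as those of the comma category of \<open>id\<^sub>M \<times> u\<close> and \<open>(m, k)\<close>.
  Along the resulting isomorphism (\<open>over_shuffle\<close>) the pasted square is the comma square of
  \<open>id\<^sub>M \<times> u\<close> and \<open>(m, k)\<close>, so its mate is invertible by (Der4) for \<open>D\<close> as well; hence so is \<open>\<beta>\<close>
  at \<open>(m, *)\<close>.

  The argument for left Kan extensions uses only (Der2) and the left halves of (Der3) and
  (Der4). These also hold for the opposite \<open>J \<mapsto> D(J\<^sup>o\<^sup>p)\<^sup>o\<^sup>p\<close>, whose left Kan extensions are the
  right Kan extensions of \<open>D\<close>; this gives the other half of (Der4).
\<close>

section \<open>Functors and natural transformations\<close>

lemma (in category) Arr_simps [simp]: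
  shows "f \<in> Arr C \<Longrightarrow> Dom C f \<in> Obj C"
    and "f \<in> Arr C \<Longrightarrow> Cod C f \<in> Obj C"
    and "x \<in> Obj C \<Longrightarrow> Id C x \<in> Arr C"
    and "x \<in> Obj C \<Longrightarrow> Dom C (Id C x) = x"
    and "x \<in> Obj C \<Longrightarrow> Cod C (Id C x) = x"
    and "\<lbrakk>f \<in> Arr C; g \<in> Arr C; Dom C g = Cod C f\<rbrakk> \<Longrightarrow> Comp C g f \<in> Arr C"
    and "\<lbrakk>f \<in> Arr C; g \<in> Arr C; Dom C g = Cod C f\<rbrakk> \<Longrightarrow> Dom C (Comp C g f) = Dom C f"
    and "\<lbrakk>f \<in> Arr C; g \<in> Arr C; Dom C g = Cod C f\<rbrakk> \<Longrightarrow> Cod C (Comp C g f) = Cod C g"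
    and "\<lbrakk>f \<in> Arr C; Cod C f = y\<rbrakk> \<Longrightarrow> Comp C (Id C y) f = f"
    and "\<lbrakk>f \<in> Arr C; Dom C f = x\<rbrakk> \<Longrightarrow> Comp C f (Id C x) = f"
    and "\<lbrakk>f \<in> Arr C; g \<in> Arr C; h \<in> Arr C; Dom C g = Cod C f; Dom C h = Cod C g\<rbrakk> \<Longrightarrow>
      Comp C (Comp C h g) f = Comp C h (Comp C g f)"
  using Dom_closed Cod_closed Id_hom Comp_hom Comp_Id_left Comp_Id_right Comp_assoc
  by (auto simp: hom_def)

lemmas category_simps = category.Arr_simps

lemma categoryI:
  assumes "\<And>f. f \<in> Arr C \<Longrightarrow> Dom C f \<in> Obj C \<and> Cod C f \<in> Obj C"
    and "Dom C \<in> extensional (Arr C)" "Cod C \<in> extensional (Arr C)" "Id C \<in> extensional (Obj C)"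
    and "\<And>x. x \<in> Obj C \<Longrightarrow> Id C x \<in> Arr C \<and> Dom C (Id C x) = x \<and> Cod C (Id C x) = x"
    and "\<And>f g. \<not> (f \<in> Arr C \<and> g \<in> Arr C \<and> Dom C g = Cod C f) \<Longrightarrow> Comp C g f = undefined"
    and "\<And>f g. \<lbrakk>f \<in> Arr C; g \<in> Arr C; Dom C g = Cod C f\<rbrakk> \<Longrightarrow>
      Comp C g f \<in> Arr C \<and> Dom C (Comp C g f) = Dom C f \<and> Cod C (Comp C g f) = Cod C g"
    and "\<And>f. f \<in> Arr C \<Longrightarrow> Comp C (Id C (Cod C f)) f = f \<and> Comp C f (Id C (Dom C f)) = f"
    and "\<And>f g h. \<lbrakk>f \<in> Arr C; g \<in> Arr C; h \<in> Arr C; Dom C g = Cod C f; Dom C h = Cod C g\<rbrakk> \<Longrightarrow>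
      Comp C h (Comp C g f) = Comp C (Comp C h g) f"
  shows "category C"
  using assms by unfold_locales (auto simp: hom_def PiE_iff)

lemma functorsI:
  assumes "Src F = C" "Tgt F = D" "category C" "category D"
    and "FObj F \<in> extensional (Obj C)" "FArr F \<in> extensional (Arr C)"
    and "\<And>x. x \<in> Obj C \<Longrightarrow> FObj F x \<in> Obj D"
    and "\<And>f. f \<in> Arr C \<Longrightarrow> FArr F f \<in> Arr D \<and> Dom D (FArr F f) = FObj F (Dom C f) \<and>
      Cod D (FArr F f) = FObj F (Cod C f)"
    and "\<And>x. x \<in> Obj C \<Longrightarrow> FArr F (Id C x) = Id D (FObj F x)"
    and "\<And>f g. \<lbrakk>f \<in> Arr C; g \<in> Arr C; Dom C g = Cod C f\<rbrakk> \<Longrightarrow>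
        FArr F (Comp C g f) = Comp D (FArr F g) (FArr F f)"
  shows "F \<in> functors C D"
  using assms by (auto simp: functors_def hom_def PiE_iff)

lemma functor_simps:
  assumes "F \<in> functors C D"
  shows "Src F = C" "Tgt F = D" "category C" "category D"
    and "x \<in> Obj C \<Longrightarrow> FObj F x \<in> Obj D"
    and "f \<in> Arr C \<Longrightarrow> FArr F f \<in> Arr D"
    and "f \<in> Arr C \<Longrightarrow> Dom D (FArr F f) = FObj F (Dom C f)"
    and "f \<in> Arr C \<Longrightarrow> Cod D (FArr F f) = FObj F (Cod C f)"
    and "x \<in> Obj C \<Longrightarrow> FArr F (Id C x) = Id D (FObj F x)"
    and "\<lbrakk>f \<in> Arr C; g \<in> Arr C; Dom C g = Cod C f\<rbrakk> \<Longrightarrow>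
        FArr F (Comp C g f) = Comp D (FArr F g) (FArr F f)"
  using assms by (auto simp: functors_def hom_def)

lemma ftor_eqI:
  assumes "F \<in> functors C D" "G \<in> functors C D"
    and "\<And>x. x \<in> Obj C \<Longrightarrow> FObj F x = FObj G x" "\<And>f. f \<in> Arr C \<Longrightarrow> FArr F f = FArr G f"
  shows "F = G"
proof -
  have "FObj F = FObj G" "FArr F = FArr G"
    using assms by (auto simp: functors_def PiE_iff intro: extensionalityI)
  then show ?thesis using assms(1,2) by (simp add: functors_def)
qed

lemma mk_ftor_sel [simp]:
  "Src (mk_ftor C D fo fa) = C" "Tgt (mk_ftor C D fo fa) = D"
  "x \<in> Obj C \<Longrightarrow> FObj (mk_ftor C D fo fa) x = fo x"
  "f \<in> Arr C \<Longrightarrow> FArr (mk_ftor C D fo fa) f = fa f"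
  by (simp_all add: mk_ftor_def)

lemma mk_ftor_functors:
  assumes "category C" "category D"
    and "\<And>x. x \<in> Obj C \<Longrightarrow> fo x \<in> Obj D"
    and "\<And>f. f \<in> Arr C \<Longrightarrow> fa f \<in> Arr D \<and> Dom D (fa f) = fo (Dom C f) \<and>
      Cod D (fa f) = fo (Cod C f)"
    and "\<And>x. x \<in> Obj C \<Longrightarrow> fa (Id C x) = Id D (fo x)"
    and "\<And>f g. \<lbrakk>f \<in> Arr C; g \<in> Arr C; Dom C g = Cod C f\<rbrakk> \<Longrightarrow>
        fa (Comp C g f) = Comp D (fa g) (fa f)"
  shows "mk_ftor C D fo fa \<in> functors C D"
  using assms category_simps[OF assms(1)]
  by (intro functorsI) (auto simp: mk_ftor_def)

lemma id_ftor_sel [simp]: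
  "Src (id_ftor C) = C" "Tgt (id_ftor C) = C"
  "x \<in> Obj C \<Longrightarrow> FObj (id_ftor C) x = x"
  "f \<in> Arr C \<Longrightarrow> FArr (id_ftor C) f = f"
  by (simp_all add: id_ftor_def)

lemma id_ftor_functors: "category C \<Longrightarrow> id_ftor C \<in> functors C C"
  unfolding id_ftor_def by (rule mk_ftor_functors) auto

lemma comp_ftor_sel [simp]:
  "Src (G \<circ>\<^sub>F F) = Src F" "Tgt (G \<circ>\<^sub>F F) = Tgt G"
  "x \<in> Obj (Src F) \<Longrightarrow> FObj (G \<circ>\<^sub>F F) x = FObj G (FObj F x)"
  "f \<in> Arr (Src F) \<Longrightarrow> FArr (G \<circ>\<^sub>F F) f = FArr G (FArr F f)"
  by (simp_all add: comp_ftor_def)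

lemma comp_ftor_functors:
  assumes "F \<in> functors C D" "G \<in> functors D E"
  shows "G \<circ>\<^sub>F F \<in> functors C E"
  using functor_simps[OF assms(1)] functor_simps[OF assms(2)]
  unfolding comp_ftor_def by (auto intro!: mk_ftor_functors)

lemma comp_ftor_assoc:
  assumes "F \<in> functors C D" "G \<in> functors D E" "H \<in> functors E E'"
  shows "(H \<circ>\<^sub>F G) \<circ>\<^sub>F F = H \<circ>\<^sub>F (G \<circ>\<^sub>F F)"
  using assms functor_simps[OF assms(1)] functor_simps[OF assms(2)]
  by (intro ftor_eqI[of _ C E']) (auto intro!: comp_ftor_functors)

lemma comp_id_ftor:
  assumes "F \<in> functors C D"
  shows "F \<circ>\<^sub>F id_ftor C = F" "id_ftor D \<circ>\<^sub>F F = F"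
  using assms functor_simps[OF assms(1)]
  by (auto intro!: ftor_eqI[of _ C D] intro: comp_ftor_functors id_ftor_functors)

lemma natsI:
  assumes "NSrc \<tau> = F" "NTgt \<tau> = G" "F \<in> functors C D" "G \<in> functors C D"
    and "Cmp \<tau> \<in> extensional (Obj C)"
    and "\<And>x. x \<in> Obj C \<Longrightarrow> Cmp \<tau> x \<in> Arr D \<and> Dom D (Cmp \<tau> x) = FObj F x \<and>
      Cod D (Cmp \<tau> x) = FObj G x"
    and "\<And>f. f \<in> Arr C \<Longrightarrow>
      Comp D (FArr G f) (Cmp \<tau> (Dom C f)) = Comp D (Cmp \<tau> (Cod C f)) (FArr F f)"
  shows "\<tau> \<in> nats F G"
  using assms functor_simps(1,2)[OF assms(3)] by (auto simp: nats_def hom_def)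

lemma nats_sel:
  assumes "\<tau> \<in> nats F G"
  shows "NSrc \<tau> = F" "NTgt \<tau> = G"
    "F \<in> functors (Src F) (Tgt F)" "G \<in> functors (Src F) (Tgt F)"
  using assms by (auto simp: nats_def)

lemma nat_simps:
  assumes "\<tau> \<in> nats F G" "F \<in> functors C D"
  shows "NSrc \<tau> = F" "NTgt \<tau> = G" "G \<in> functors C D"
    and "x \<in> Obj C \<Longrightarrow> Cmp \<tau> x \<in> Arr D"
    and "x \<in> Obj C \<Longrightarrow> Dom D (Cmp \<tau> x) = FObj F x"
    and "x \<in> Obj C \<Longrightarrow> Cod D (Cmp \<tau> x) = FObj G x"
  using assms functor_simps(1,2)[OF assms(2)] by (auto simp: nats_def hom_def)

lemma naturality:
  assumes "\<tau> \<in> nats F G" "F \<in> functors C D" "f \<in> Arr C"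
  shows "Comp D (FArr G f) (Cmp \<tau> (Dom C f)) = Comp D (Cmp \<tau> (Cod C f)) (FArr F f)"
  using assms functor_simps(1,2)[OF assms(2)] by (auto simp: nats_def hom_def)

lemma nat_eqI:
  assumes "\<tau> \<in> nats F G" "\<sigma> \<in> nats F G"
    and "\<And>x. x \<in> Obj (Src F) \<Longrightarrow> Cmp \<tau> x = Cmp \<sigma> x"
  shows "\<tau> = \<sigma>"
proof -
  have "Cmp \<tau> = Cmp \<sigma>"
    using assms by (auto simp: nats_def intro: extensionalityI)
  then show ?thesis using assms(1,2) by (simp add: nats_def)
qed

lemma mk_nat_sel [simp]:
  "NSrc (mk_nat F G c) = F" "NTgt (mk_nat F G c) = G"
  "x \<in> Obj (Src F) \<Longrightarrow> Cmp (mk_nat F G c) x = c x"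
  by (simp_all add: mk_nat_def)

lemma mk_nat_nats:
  assumes "F \<in> functors C D" "G \<in> functors C D"
    and "\<And>x. x \<in> Obj C \<Longrightarrow> c x \<in> Arr D \<and> Dom D (c x) = FObj F x \<and> Cod D (c x) = FObj G x"
    and "\<And>f. f \<in> Arr C \<Longrightarrow> Comp D (FArr G f) (c (Dom C f)) = Comp D (c (Cod C f)) (FArr F f)"
  shows "mk_nat F G c \<in> nats F G"
  using assms category_simps[OF functor_simps(3)[OF assms(1)]] functor_simps(1)[OF assms(1)]
  by (intro natsI[of _ F G C D]) (auto simp: mk_nat_def)

lemma id_nat_sel [simp]:
  "NSrc (id_nat F) = F" "NTgt (id_nat F) = F"
  "x \<in> Obj (Src F) \<Longrightarrow> Cmp (id_nat F) x = Id (Tgt F) (FObj F x)"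
  by (simp_all add: id_nat_def)

lemma id_nat_nats:
  assumes "F \<in> functors C D" shows "id_nat F \<in> nats F F"
  using assms functor_simps[OF assms] category_simps[OF functor_simps(4)[OF assms]]
    category_simps[OF functor_simps(3)[OF assms]]
  unfolding id_nat_def by (intro mk_nat_nats[of _ C D]) auto

lemma vcomp_sel [simp]:
  "NSrc (\<tau> \<bullet> \<sigma>) = NSrc \<sigma>" "NTgt (\<tau> \<bullet> \<sigma>) = NTgt \<tau>"
  "x \<in> Obj (Src (NSrc \<sigma>)) \<Longrightarrow>
     Cmp (\<tau> \<bullet> \<sigma>) x = Comp (Tgt (NSrc \<sigma>)) (Cmp \<tau> x) (Cmp \<sigma> x)"
  by (simp_all add: vcomp_def)

lemma vcomp_nats:
  assumes "\<sigma> \<in> nats F G" "\<tau> \<in> nats G H"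
  shows "\<tau> \<bullet> \<sigma> \<in> nats F H"
proof -
  define C D where "C = Src F" and "D = Tgt F"
  have F: "F \<in> functors C D" using nats_sel[OF assms(1)] by (simp add: C_def D_def)
  have G: "G \<in> functors C D" using nat_simps[OF assms(1) F] by simp
  have H: "H \<in> functors C D" using nat_simps[OF assms(2) G] by simp
  note s = functor_simps[OF F] functor_simps[OF G] functor_simps[OF H]
    nat_simps[OF assms(1) F] nat_simps[OF assms(2) G]
  note c = category_simps[OF s(3)] category_simps[OF s(4)]
  show ?thesis unfolding vcomp_def nat_simps(1)[OF assms(1) F] nat_simps(2)[OF assms(2) G] s(2)
  proof (rule mk_nat_nats[OF F H])
    fix f assume f: "f \<in> Arr C"
    have "Comp D (FArr H f) (Comp D (Cmp \<tau> (Dom C f)) (Cmp \<sigma> (Dom C f))) =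
      Comp D (Comp D (FArr H f) (Cmp \<tau> (Dom C f))) (Cmp \<sigma> (Dom C f))"
      using f c s by simp
    also have "\<dots> = Comp D (Comp D (Cmp \<tau> (Cod C f)) (FArr G f)) (Cmp \<sigma> (Dom C f))"
      using naturality[OF assms(2) G f] by simp
    also have "\<dots> = Comp D (Cmp \<tau> (Cod C f)) (Comp D (FArr G f) (Cmp \<sigma> (Dom C f)))"
      using f c s by simp
    also have "\<dots> = Comp D (Comp D (Cmp \<tau> (Cod C f)) (Cmp \<sigma> (Cod C f))) (FArr F f)"
      using naturality[OF assms(1) F f] f c s by simp
    finally show "Comp D (FArr H f) (Comp D (Cmp \<tau> (Dom C f)) (Cmp \<sigma> (Dom C f))) =
      Comp D (Comp D (Cmp \<tau> (Cod C f)) (Cmp \<sigma> (Cod C f))) (FArr F f)" .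
  qed (use c s in auto)
qed

lemma vcomp_assoc:
  assumes "\<sigma> \<in> nats F G" "\<tau> \<in> nats G H" "\<upsilon> \<in> nats H I"
  shows "(\<upsilon> \<bullet> \<tau>) \<bullet> \<sigma> = \<upsilon> \<bullet> (\<tau> \<bullet> \<sigma>)"
proof (rule nat_eqI)
  define C D where "C = Src F" and "D = Tgt F"
  have F: "F \<in> functors C D" using nats_sel[OF assms(1)] by (simp add: C_def D_def)
  note G = nat_simps(3)[OF assms(1) F]
  note H = nat_simps(3)[OF assms(2) G]
  show "(\<upsilon> \<bullet> \<tau>) \<bullet> \<sigma> \<in> nats F I" "\<upsilon> \<bullet> (\<tau> \<bullet> \<sigma>) \<in> nats F I"
    using assms by (auto intro: vcomp_nats)
  show "Cmp ((\<upsilon> \<bullet> \<tau>) \<bullet> \<sigma>) x = Cmp (\<upsilon> \<bullet> (\<tau> \<bullet> \<sigma>)) x" if "x \<in> Obj (Src F)" for x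
    using that by (simp add: functor_simps[OF F] functor_simps[OF G] nat_simps[OF assms(1) F]
        nat_simps[OF assms(2) G] nat_simps[OF assms(3) H] category_simps[OF functor_simps(4)[OF F]])
qed

lemma whisker_left_sel [simp]:
  "NSrc (G \<triangleright> \<sigma>) = G \<circ>\<^sub>F NSrc \<sigma>" "NTgt (G \<triangleright> \<sigma>) = G \<circ>\<^sub>F NTgt \<sigma>"
  "x \<in> Obj (Src (NSrc \<sigma>)) \<Longrightarrow> Cmp (G \<triangleright> \<sigma>) x = FArr G (Cmp \<sigma> x)"
  by (simp_all add: whisker_left_def)

lemma whisker_left_nats:
  assumes "\<sigma> \<in> nats F F'" "F \<in> functors C D" "G \<in> functors D E"
  shows "G \<triangleright> \<sigma> \<in> nats (G \<circ>\<^sub>F F) (G \<circ>\<^sub>F F')"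
proof -
  note F' = nat_simps(3)[OF assms(1,2)]
  note s = functor_simps[OF assms(2)] functor_simps[OF assms(3)] functor_simps[OF F']
    nat_simps[OF assms(1,2)]
  note c = category_simps[OF s(3)] category_simps[OF s(4)] category_simps[OF s(14)]
  show ?thesis unfolding whisker_left_def nat_simps[OF assms(1,2)]
  proof (rule mk_nat_nats)
    fix f assume f: "f \<in> Arr C"
    show "Comp E (FArr (G \<circ>\<^sub>F F') f) (FArr G (Cmp \<sigma> (Dom C f))) =
      Comp E (FArr G (Cmp \<sigma> (Cod C f))) (FArr (G \<circ>\<^sub>F F) f)"
      using arg_cong[OF naturality[OF assms(1,2) f], of "FArr G"] f s c by simp
  qed (use assms F' comp_ftor_functors s c in auto)
qed

lemma whisker_right_sel [simp]:
  "NSrc (\<tau> \<triangleleft> F) = NSrc \<tau> \<circ>\<^sub>F F" "NTgt (\<tau> \<triangleleft> F) = NTgt \<tau> \<circ>\<^sub>F F"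
  "x \<in> Obj (Src F) \<Longrightarrow> Cmp (\<tau> \<triangleleft> F) x = Cmp \<tau> (FObj F x)"
  by (simp_all add: whisker_right_def)

lemma whisker_right_nats:
  assumes "\<tau> \<in> nats G G'" "F \<in> functors C D" "G \<in> functors D E"
  shows "\<tau> \<triangleleft> F \<in> nats (G \<circ>\<^sub>F F) (G' \<circ>\<^sub>F F)"
proof -
  note G' = nat_simps(3)[OF assms(1,3)]
  note s = functor_simps[OF assms(2)] functor_simps[OF assms(3)] functor_simps[OF G']
    nat_simps[OF assms(1,3)]
  note c = category_simps[OF s(3)] category_simps[OF s(4)] category_simps[OF s(14)]
  show ?thesis unfolding whisker_right_def nat_simps[OF assms(1,3)]
  proof (rule mk_nat_nats)
    fix f assume f: "f \<in> Arr C"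
    show "Comp E (FArr (G' \<circ>\<^sub>F F) f) (Cmp \<tau> (FObj F (Dom C f))) =
        Comp E (Cmp \<tau> (FObj F (Cod C f))) (FArr (G \<circ>\<^sub>F F) f)"
      using naturality[OF assms(1,3), of "FArr F f"] f s c by simp
  qed (use assms G' comp_ftor_functors s c in auto)
qed

lemma hcomp_sel [simp]:
  "NSrc (\<tau> \<star> \<sigma>) = NSrc \<tau> \<circ>\<^sub>F NSrc \<sigma>" "NTgt (\<tau> \<star> \<sigma>) = NTgt \<tau> \<circ>\<^sub>F NTgt \<sigma>"
  "x \<in> Obj (Src (NSrc \<sigma>)) \<Longrightarrow> Cmp (\<tau> \<star> \<sigma>) x =
     Comp (Tgt (NSrc \<tau>)) (FArr (NTgt \<tau>) (Cmp \<sigma> x)) (Cmp \<tau> (FObj (NSrc \<sigma>) x))"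
  by (simp_all add: hcomp_def)

lemma hcomp_eq_whiskers:
  assumes "\<sigma> \<in> nats F F'" "F \<in> functors C D" "\<tau> \<in> nats G G'" "G \<in> functors D E"
  shows "\<tau> \<star> \<sigma> = (G' \<triangleright> \<sigma>) \<bullet> (\<tau> \<triangleleft> F)"
proof -
  note s = functor_simps[OF assms(2)] functor_simps[OF assms(4)] nat_simps[OF assms(1,2)]
    nat_simps[OF assms(3,4)]
  show ?thesis using s by (auto simp: hcomp_def vcomp_def mk_nat_def restrict_def fun_eq_iff)
qed

lemma hcomp_nats:
  assumes "\<sigma> \<in> nats F F'" "F \<in> functors C D" "\<tau> \<in> nats G G'" "G \<in> functors D E"
  shows "\<tau> \<star> \<sigma> \<in> nats (G \<circ>\<^sub>F F) (G' \<circ>\<^sub>F F')"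
  unfolding hcomp_eq_whiskers[OF assms]
  by (rule vcomp_nats whisker_left_nats whisker_right_nats assms nat_simps(3)[OF assms(3,4)])+

lemma whisker_left_eq_hcomp:
  assumes "\<sigma> \<in> nats F F'" "F \<in> functors C D" "G \<in> functors D E"
  shows "id_nat G \<star> \<sigma> = G \<triangleright> \<sigma>"
proof -
  note s = functor_simps[OF assms(2)] functor_simps[OF assms(3)] nat_simps[OF assms(1,2)]
  show ?thesis using s category_simps[OF s(14)]
    by (auto simp: hcomp_def whisker_left_def mk_nat_def restrict_def fun_eq_iff)
qed

lemma whisker_right_eq_hcomp:
  assumes "\<tau> \<in> nats G G'" "F \<in> functors C D" "G \<in> functors D E"
  shows "\<tau> \<star> id_nat F = \<tau> \<triangleleft> F"
proof -
  note s = functor_simps[OF assms(2)] functor_simps[OF assms(3)] nat_simps[OF assms(1,3)]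
   functor_simps[OF nat_simps(3)[OF assms(1,3)]]
  show ?thesis using s category_simps[OF s(14)]
    by (auto simp: hcomp_def whisker_right_def mk_nat_def restrict_def fun_eq_iff)
qed

section \<open>Isomorphisms, equivalences and adjunctions\<close>

lemma isoI:
  assumes "f \<in> Arr C" "g \<in> Arr C" "Dom C g = Cod C f" "Cod C g = Dom C f"
    and "Comp C g f = Id C (Dom C f)" "Comp C f g = Id C (Cod C f)"
  shows "iso C f"
  using assms by (auto simp: iso_def hom_def)

lemma isoE:
  assumes "iso C f"
  obtains g where "f \<in> Arr C" "g \<in> Arr C" "Dom C g = Cod C f" "Cod C g = Dom C f"
    "Comp C g f = Id C (Dom C f)" "Comp C f g = Id C (Cod C f)"
  using assms by (auto simp: iso_def hom_def)

lemma iso_cancel_right: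
  assumes C: "category C"
    and g: "g \<in> Arr C" "Dom C g = Cod C f"
    and "iso C f" "iso C (Comp C g f)"
  shows "iso C g"
proof -
  note c = category_simps[OF C]
  obtain f' where f: "f \<in> Arr C" "f' \<in> Arr C" "Dom C f' = Cod C f" "Cod C f' = Dom C f"
    "Comp C f' f = Id C (Dom C f)" "Comp C f f' = Id C (Cod C f)"
    using assms(4) by (rule isoE)
  obtain h where h: "h \<in> Arr C" "Dom C h = Cod C g" "Cod C h = Dom C f"
    "Comp C h (Comp C g f) = Id C (Dom C f)" "Comp C (Comp C g f) h = Id C (Cod C g)"
    using assms(5) by (rule isoE) (use c f g in auto)
  have "Comp C h g = Comp C h (Comp C g (Comp C f f'))" using f g c by simp
  also have "\<dots> = Comp C (Comp C h (Comp C g f)) f'" using f(1-4) g h(1-3) c by simp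
  also have "\<dots> = f'" using f h(4) c by simp
  finally have hg: "Comp C h g = f'" .
  show ?thesis
  proof (rule isoI)
    show "Comp C (Comp C f h) g = Id C (Dom C g)"
      using hg f g h(1-3) c by simp
    show "Comp C g (Comp C f h) = Id C (Cod C g)" using h f(1-4) g c by simp
  qed (use f g h c in auto)
qed

lemma iso_FArr:
  assumes F: "F \<in> functors C D" and "iso C f"
  shows "iso D (FArr F f)"
proof -
  note s = functor_simps[OF F]
  obtain f' where f: "f \<in> Arr C" "f' \<in> Arr C" "Dom C f' = Cod C f" "Cod C f' = Dom C f"
    "Comp C f' f = Id C (Dom C f)" "Comp C f f' = Id C (Cod C f)"
    using assms(2) by (rule isoE)
  have "Comp D (FArr F f') (FArr F f) = FArr F (Comp C f' f)"
    "Comp D (FArr F f) (FArr F f') = FArr F (Comp C f f')"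
    using f(1-4) s by simp_all
  then show ?thesis using f s category_simps[OF s(3)]
    by (intro isoI[of _ _ "FArr F f'"]) simp_all
qed

lemma nat_isoI:
  assumes "\<tau> \<in> nats F G" "F \<in> functors C D" "\<And>x. x \<in> Obj C \<Longrightarrow> iso D (Cmp \<tau> x)"
  shows "nat_iso \<tau>"
  using assms nat_simps[OF assms(1,2)] functor_simps[OF assms(2)] by (simp add: nat_iso_def)

lemma nat_isoD:
  assumes "nat_iso \<tau>" "\<tau> \<in> nats F G" "F \<in> functors C D" "x \<in> Obj C"
  shows "iso D (Cmp \<tau> x)"
  using assms nat_simps[OF assms(2,3)] functor_simps[OF assms(3)] by (simp add: nat_iso_def)

definition inverse_ftors ::
  "('o, 'a) cat \<Rightarrow> ('p, 'b) cat \<Rightarrow> ('o, 'a, 'p, 'b) ftor \<Rightarrow> ('p, 'b, 'o, 'a) ftor \<Rightarrow> bool" where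
  "inverse_ftors C D F G \<longleftrightarrow> F \<in> functors C D \<and> G \<in> functors D C \<and>
     G \<circ>\<^sub>F F = id_ftor C \<and> F \<circ>\<^sub>F G = id_ftor D"

lemma inverse_ftors_simps:
  assumes "inverse_ftors C D F G"
  shows "F \<in> functors C D" "G \<in> functors D C" "G \<circ>\<^sub>F F = id_ftor C" "F \<circ>\<^sub>F G = id_ftor D"
    and "y \<in> Obj D \<Longrightarrow> FObj F (FObj G y) = y" "g \<in> Arr D \<Longrightarrow> FArr F (FArr G g) = g"
proof -
  show F: "F \<in> functors C D" and G: "G \<in> functors D C"
    and GF: "G \<circ>\<^sub>F F = id_ftor C" and FG: "F \<circ>\<^sub>F G = id_ftor D"
    using assms by (simp_all add: inverse_ftors_def)
  note s = functor_simps[OF F] functor_simps[OF G]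
  show "FObj F (FObj G y) = y" if "y \<in> Obj D"
    using that arg_cong[OF FG, of "\<lambda>H. FObj H y"] s by simp
  show "FArr F (FArr G g) = g" if "g \<in> Arr D"
    using that arg_cong[OF FG, of "\<lambda>H. FArr H g"] s by simp
qed

lemma bij_functor_has_inverse:
  assumes F: "F \<in> functors C D"
    and bo: "bij_betw (FObj F) (Obj C) (Obj D)" and ba: "bij_betw (FArr F) (Arr C) (Arr D)"
  shows "\<exists>G. inverse_ftors C D F G"
proof -
  note s = functor_simps[OF F]
  note c = category_simps[OF s(3)] category_simps[OF s(4)]
  define go where "go = the_inv_into (Obj C) (FObj F)"
  define ga where "ga = the_inv_into (Arr C) (FArr F)"
  have go: "y \<in> Obj D \<Longrightarrow> go y \<in> Obj C" "y \<in> Obj D \<Longrightarrow> FObj F (go y) = y"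
    "x \<in> Obj C \<Longrightarrow> go (FObj F x) = x" for x y
    using bo the_inv_into_into[of "FObj F" "Obj C" y "Obj C"]
      f_the_inv_into_f[of "FObj F" "Obj C" y] the_inv_into_f_f[of "FObj F" "Obj C" x]
    unfolding go_def bij_betw_def by auto
  have ga: "y \<in> Arr D \<Longrightarrow> ga y \<in> Arr C" "y \<in> Arr D \<Longrightarrow> FArr F (ga y) = y"
    "x \<in> Arr C \<Longrightarrow> ga (FArr F x) = x" for x y
    using ba the_inv_into_into[of "FArr F" "Arr C" y "Arr C"]
      f_the_inv_into_f[of "FArr F" "Arr C" y] the_inv_into_f_f[of "FArr F" "Arr C" x]
    unfolding ga_def bij_betw_def by auto
  have dom: "Dom C (ga g) = go (Dom D g)" "Cod C (ga g) = go (Cod D g)" if "g \<in> Arr D" for g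
    using ga(1,2)[OF that] go(3)[of "Dom C (ga g)"] go(3)[of "Cod C (ga g)"] s(7,8)[of "ga g"] c by auto
  define G where "G = mk_ftor D C go ga"
  have G: "G \<in> functors D C" unfolding G_def
  proof (rule mk_ftor_functors)
    show "ga (Id D y) = Id C (go y)" if "y \<in> Obj D" for y
      using ga(3)[of "Id C (go y)"] go(1,2)[OF that] s c by simp
    show "ga (Comp D h g) = Comp C (ga h) (ga g)"
      if "g \<in> Arr D" "h \<in> Arr D" "Dom D h = Cod D g" for g h
      using ga(3)[of "Comp C (ga h) (ga g)"] ga that dom s c by simp
  qed (use ga go dom s in auto)
  have "G \<circ>\<^sub>F F = id_ftor C"
    by (rule ftor_eqI[of _ C C]) (use F G s go ga in \<open>auto simp: G_def intro: comp_ftor_functors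
        id_ftor_functors\<close>)
  moreover have "F \<circ>\<^sub>F G = id_ftor D"
    by (rule ftor_eqI[of _ D D]) (use F G s go ga in \<open>auto simp: G_def intro: comp_ftor_functors
        id_ftor_functors\<close>)
  ultimately show ?thesis using F G by (auto simp: inverse_ftors_def)
qed

text \<open>
  Composition being strictly associative, the unit of \<open>E\<close> conjugated by \<open>H\<close> is a unit for
  \<open>E \<circ> H\<close>, and the counit of \<open>E\<close> is literally a counit.
\<close>

lemma equivalence_comp_inverse_ftors:
  assumes E: "equivalence E" "Src E = D" and inv: "inverse_ftors C D H H'"
  shows "equivalence (E \<circ>\<^sub>F H)"
proof -
  define X where "X = Tgt E"
  obtain G \<eta> \<epsilon> where EF: "E \<in> functors D X" and G: "G \<in> functors X D"
    and \<eta>: "\<eta> \<in> nats (id_ftor D) (G \<circ>\<^sub>F E)" "nat_iso \<eta>"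
    and \<epsilon>: "\<epsilon> \<in> nats (E \<circ>\<^sub>F G) (id_ftor X)" "nat_iso \<epsilon>"
    using E by (auto simp: equivalence_def X_def)
  note H = inverse_ftors_simps[OF inv]
  note idD = id_ftor_functors[OF functor_simps(3)[OF EF]]
  have EH: "E \<circ>\<^sub>F H \<in> functors C X" and H'G: "H' \<circ>\<^sub>F G \<in> functors X C"
    using H EF G by (auto intro: comp_ftor_functors)
  have 1: "(E \<circ>\<^sub>F H) \<circ>\<^sub>F (H' \<circ>\<^sub>F G) = E \<circ>\<^sub>F G"
    using comp_ftor_assoc[OF H'G H(1) EF] comp_ftor_assoc[OF G H(2,1)] comp_id_ftor[OF G] H(4)
    by simp
  have 2: "H' \<circ>\<^sub>F (id_ftor D \<circ>\<^sub>F H) = id_ftor C"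
    using comp_id_ftor[OF H(1)] H by simp
  have 3: "H' \<circ>\<^sub>F ((G \<circ>\<^sub>F E) \<circ>\<^sub>F H) = (H' \<circ>\<^sub>F G) \<circ>\<^sub>F (E \<circ>\<^sub>F H)"
    using comp_ftor_assoc[OF H(1) EF G] comp_ftor_assoc[OF EH G H(2)] by simp
  have idH: "id_ftor D \<circ>\<^sub>F H \<in> functors C D" using H idD by (auto intro: comp_ftor_functors)
  have "\<eta> \<triangleleft> H \<in> nats (id_ftor D \<circ>\<^sub>F H) ((G \<circ>\<^sub>F E) \<circ>\<^sub>F H)"
    by (rule whisker_right_nats[OF \<eta>(1) H(1) idD])
  from whisker_left_nats[OF this idH H(2)]
  have "H' \<triangleright> (\<eta> \<triangleleft> H) \<in> nats (id_ftor C) ((H' \<circ>\<^sub>F G) \<circ>\<^sub>F (E \<circ>\<^sub>F H))"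
    by (simp add: 2 3)
  moreover from this have "nat_iso (H' \<triangleright> (\<eta> \<triangleleft> H))"
    using iso_FArr[OF H(2)] nat_isoD[OF \<eta>(2,1) idD] functor_simps[OF H(1)] nat_simps[OF \<eta>(1) idD]
    by (intro nat_isoI[OF _ id_ftor_functors]) auto
  ultimately show ?thesis unfolding equivalence_def
    using EH H'G \<epsilon> 1 functor_simps[OF EH]
    by (intro conjI bexI[of _ "H' \<circ>\<^sub>F G"] bexI[of _ "H' \<triangleright> (\<eta> \<triangleleft> H)"] bexI[of _ \<epsilon>]) auto
qed

lemma adjunction_triangles:
  assumes "adjunction L R \<eta> \<epsilon>" and L: "L \<in> functors C D"
  shows "R \<in> functors D C" "\<eta> \<in> nats (id_ftor C) (R \<circ>\<^sub>F L)" "\<epsilon> \<in> nats (L \<circ>\<^sub>F R) (id_ftor D)"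
    and "x \<in> Obj C \<Longrightarrow> Comp D (Cmp \<epsilon> (FObj L x)) (FArr L (Cmp \<eta> x)) = Id D (FObj L x)"
    and "y \<in> Obj D \<Longrightarrow> Comp C (FArr R (Cmp \<epsilon> y)) (Cmp \<eta> (FObj R y)) = Id C (FObj R y)"
proof -
  note s = functor_simps[OF L]
  show R: "R \<in> functors D C" and \<eta>: "\<eta> \<in> nats (id_ftor C) (R \<circ>\<^sub>F L)"
    and \<epsilon>: "\<epsilon> \<in> nats (L \<circ>\<^sub>F R) (id_ftor D)"
    using assms s by (auto simp: adjunction_def)
  have t: "(\<epsilon> \<triangleleft> L) \<bullet> (L \<triangleright> \<eta>) = id_nat L" "(R \<triangleright> \<epsilon>) \<bullet> (\<eta> \<triangleleft> R) = id_nat R"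
    using assms by (auto simp: adjunction_def)
  note s = s functor_simps[OF R]
    nats_sel[OF \<eta>] nats_sel[OF \<epsilon>]
  show "Comp D (Cmp \<epsilon> (FObj L x)) (FArr L (Cmp \<eta> x)) = Id D (FObj L x)" if "x \<in> Obj C"
    using that s arg_cong[OF t(1), of "\<lambda>\<tau>. Cmp \<tau> x"] by simp
  show "Comp C (FArr R (Cmp \<epsilon> y)) (Cmp \<eta> (FObj R y)) = Id C (FObj R y)" if "y \<in> Obj D"
    using that s arg_cong[OF t(2), of "\<lambda>\<tau>. Cmp \<tau> y"] by simp
qed

lemma adjunctionI:
  assumes L: "L \<in> functors C D" and R: "R \<in> functors D C"
    and \<eta>: "\<eta> \<in> nats (id_ftor C) (R \<circ>\<^sub>F L)" and \<epsilon>: "\<epsilon> \<in> nats (L \<circ>\<^sub>F R) (id_ftor D)"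
    and t1: "\<And>x. x \<in> Obj C \<Longrightarrow> Comp D (Cmp \<epsilon> (FObj L x)) (FArr L (Cmp \<eta> x)) = Id D (FObj L x)"
    and t2: "\<And>y. y \<in> Obj D \<Longrightarrow> Comp C (FArr R (Cmp \<epsilon> y)) (Cmp \<eta> (FObj R y)) = Id C (FObj R y)"
  shows "adjunction L R \<eta> \<epsilon>"
proof -
  note s = functor_simps[OF L] functor_simps[OF R] nats_sel[OF \<eta>] nats_sel[OF \<epsilon>]
  have "(\<epsilon> \<triangleleft> L) \<bullet> (L \<triangleright> \<eta>) = id_nat L"
    using t1 s comp_id_ftor[OF L]
    by (auto simp: vcomp_def id_nat_def mk_nat_def restrict_def fun_eq_iff)
  moreover have "(R \<triangleright> \<epsilon>) \<bullet> (\<eta> \<triangleleft> R) = id_nat R"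
    using t2 s comp_id_ftor[OF R]
    by (auto simp: vcomp_def id_nat_def mk_nat_def restrict_def fun_eq_iff)
  ultimately show ?thesis using L R \<eta> \<epsilon> s by (auto simp: adjunction_def)
qed

text \<open>
  The new adjunction has the same counit. A mate formed with \<open>L \<circ> E\<close> is therefore the mate
  formed with \<open>L\<close> after reindexing its data along \<open>E\<close>, and this is how comma squares over
  isomorphic categories are compared.
\<close>

lemma adjunction_comp_inverse_ftors:
  assumes adj: "adjunction L R \<eta> \<epsilon>" and L: "L \<in> functors C D" and inv: "inverse_ftors B C E E'"
  shows "adjunction (L \<circ>\<^sub>F E) (E' \<circ>\<^sub>F R) (E' \<triangleright> (\<eta> \<triangleleft> E)) \<epsilon>"
proof -
  note a = adjunction_triangles[OF adj L]
  note H = inverse_ftors_simps[OF inv]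
  note idC = id_ftor_functors[OF functor_simps(3)[OF L]]
  have LE: "L \<circ>\<^sub>F E \<in> functors B D" and E'R: "E' \<circ>\<^sub>F R \<in> functors D B"
    using H L a by (auto intro: comp_ftor_functors)
  have 1: "(L \<circ>\<^sub>F E) \<circ>\<^sub>F (E' \<circ>\<^sub>F R) = L \<circ>\<^sub>F R"
    using comp_ftor_assoc[OF E'R H(1) L] comp_ftor_assoc[OF a(1) H(2,1)] comp_id_ftor[OF a(1)] H(4)
    by simp
  have 2: "E' \<circ>\<^sub>F (id_ftor C \<circ>\<^sub>F E) = id_ftor B"
    using comp_id_ftor[OF H(1)] H by simp
  have 3: "E' \<circ>\<^sub>F ((R \<circ>\<^sub>F L) \<circ>\<^sub>F E) = (E' \<circ>\<^sub>F R) \<circ>\<^sub>F (L \<circ>\<^sub>F E)"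
    using comp_ftor_assoc[OF H(1) L a(1)] comp_ftor_assoc[OF LE a(1) H(2)] by simp
  have idE: "id_ftor C \<circ>\<^sub>F E \<in> functors B C" using H idC by (auto intro: comp_ftor_functors)
  have "\<eta> \<triangleleft> E \<in> nats (id_ftor C \<circ>\<^sub>F E) ((R \<circ>\<^sub>F L) \<circ>\<^sub>F E)"
    by (rule whisker_right_nats[OF a(2) H(1) idC])
  from whisker_left_nats[OF this idE H(2)]
  have unit: "E' \<triangleright> (\<eta> \<triangleleft> E) \<in> nats (id_ftor B) ((E' \<circ>\<^sub>F R) \<circ>\<^sub>F (L \<circ>\<^sub>F E))"
    by (simp add: 2 3)
  note s = functor_simps[OF H(1)] functor_simps[OF H(2)] functor_simps[OF L] functor_simps[OF a(1)]
    nat_simps[OF a(2) idC] nat_simps[OF a(3) comp_ftor_functors[OF a(1) L]]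
  show ?thesis
  proof (rule adjunctionI[OF LE E'R unit])
    show "\<epsilon> \<in> nats ((L \<circ>\<^sub>F E) \<circ>\<^sub>F (E' \<circ>\<^sub>F R)) (id_ftor D)" using a(3) 1 by simp
    show "Comp D (Cmp \<epsilon> (FObj (L \<circ>\<^sub>F E) x)) (FArr (L \<circ>\<^sub>F E) (Cmp (E' \<triangleright> (\<eta> \<triangleleft> E)) x)) =
      Id D (FObj (L \<circ>\<^sub>F E) x)" if x: "x \<in> Obj B" for x
      using x s a(4)[of "FObj E x"] H(5,6) by simp
    show "Comp B (FArr (E' \<circ>\<^sub>F R) (Cmp \<epsilon> y)) (Cmp (E' \<triangleright> (\<eta> \<triangleleft> E)) (FObj (E' \<circ>\<^sub>F R) y)) =
      Id B (FObj (E' \<circ>\<^sub>F R) y)" if y: "y \<in> Obj D" for y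
      using y s arg_cong[OF a(5)[OF y], of "FArr E'"] H(5,6) by simp
  qed
qed

section \<open>Mates\<close>

text \<open>
  For left adjoints \<open>U\<close> of \<open>R\<close> and \<open>P\<close> of \<open>Q\<close>, with unit \<open>\<eta>\<close> of the first and counit \<open>\<epsilon>\<close> of
  the second, the mate \<open>P S \<rightarrow> T U\<close> of \<open>\<alpha> : S R \<rightarrow> Q T\<close>. The maps of (Der4) are of this form.
\<close>

definition left_mate ::
  "('o, 'a, 'p, 'b) ftor \<Rightarrow> ('q, 'c, 'r, 'd) ftor \<Rightarrow> ('q, 'c, 'p, 'b) ntrans \<Rightarrow>
   ('o, 'a, 'q, 'c) ftor \<Rightarrow> ('o, 'a, 'o, 'a) ntrans \<Rightarrow>
   ('p, 'b, 'r, 'd) ftor \<Rightarrow> ('r, 'd, 'r, 'd) ntrans \<Rightarrow> ('o, 'a, 'r, 'd) ntrans" where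
  "left_mate S T \<alpha> U \<eta> P \<epsilon> =
     (\<epsilon> \<triangleleft> (T \<circ>\<^sub>F U)) \<bullet> (P \<triangleright> (\<alpha> \<triangleleft> U)) \<bullet> ((P \<circ>\<^sub>F S) \<triangleright> \<eta>)"

text \<open>
  In (Der4) the corners are \<open>D(J)\<close>, \<open>D(K)\<close>, \<open>D(J\<^bsub>/k\<^esub>)\<close> and \<open>D(e)\<close>, the functors with left
  adjoints are \<open>R = u\<^sup>*\<close> and \<open>Q = p\<^sup>*\<close>, and \<open>S = pr\<^sup>*\<close>, \<open>T = k\<^sup>*\<close>.
\<close>

locale mate_square =
  fixes A :: "('o, 'a) cat" and B :: "('q, 'c) cat" and A' :: "('p, 'b) cat" and B' :: "('r, 'd) cat"
    and U R \<eta> \<epsilon>\<^sub>U P Q \<eta>\<^sub>P \<epsilon> S T \<alpha>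
  assumes U: "U \<in> functors A B" and adj_U: "adjunction U R \<eta> \<epsilon>\<^sub>U"
    and P: "P \<in> functors A' B'" and adj_P: "adjunction P Q \<eta>\<^sub>P \<epsilon>"
    and S: "S \<in> functors A A'" and T: "T \<in> functors B B'"
    and \<alpha>: "\<alpha> \<in> nats (S \<circ>\<^sub>F R) (Q \<circ>\<^sub>F T)"
begin

lemmas adjU = adjunction_triangles[OF adj_U U]
lemmas adjP = adjunction_triangles[OF adj_P P]

lemma composites:
  "S \<circ>\<^sub>F R \<in> functors B A'" "Q \<circ>\<^sub>F T \<in> functors B A'" "P \<circ>\<^sub>F S \<in> functors A B'"
  "T \<circ>\<^sub>F U \<in> functors A B'" "P \<circ>\<^sub>F Q \<in> functors B' B'"
  using U P S T adjU(1) adjP(1) by (auto intro: comp_ftor_functors)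

lemmas idA = id_ftor_functors[OF functor_simps(3)[OF U]]
lemmas square_simps = functor_simps[OF U] functor_simps[OF P] functor_simps[OF S] functor_simps[OF T]
  functor_simps[OF adjU(1)] functor_simps[OF adjP(1)] nat_simps[OF adjU(2) idA]
  nat_simps[OF adjP(3) composites(5)] nat_simps[OF \<alpha> composites(1)]
  nat_simps[OF adjP(2) id_ftor_functors[OF functor_simps(3)[OF P]]]

lemmas square_cats = category_simps[OF functor_simps(3)[OF S]] category_simps[OF functor_simps(4)[OF S]]
  category_simps[OF functor_simps(3)[OF T]] category_simps[OF functor_simps(4)[OF T]]

abbreviation "mate \<equiv> left_mate S T \<alpha> U \<eta> P \<epsilon>"

lemma mate_factors:
  "(P \<circ>\<^sub>F S) \<triangleright> \<eta> \<in> nats (P \<circ>\<^sub>F S) ((P \<circ>\<^sub>F S) \<circ>\<^sub>F (R \<circ>\<^sub>F U))"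
  "P \<triangleright> (\<alpha> \<triangleleft> U) \<in> nats ((P \<circ>\<^sub>F S) \<circ>\<^sub>F (R \<circ>\<^sub>F U)) ((P \<circ>\<^sub>F Q) \<circ>\<^sub>F (T \<circ>\<^sub>F U))"
  "\<epsilon> \<triangleleft> (T \<circ>\<^sub>F U) \<in> nats ((P \<circ>\<^sub>F Q) \<circ>\<^sub>F (T \<circ>\<^sub>F U)) (T \<circ>\<^sub>F U)"
proof -
  show "(P \<circ>\<^sub>F S) \<triangleright> \<eta> \<in> nats (P \<circ>\<^sub>F S) ((P \<circ>\<^sub>F S) \<circ>\<^sub>F (R \<circ>\<^sub>F U))"
    using whisker_left_nats[OF adjU(2) idA composites(3)] comp_id_ftor[OF composites(3)] by simp
  have "\<alpha> \<triangleleft> U \<in> nats ((S \<circ>\<^sub>F R) \<circ>\<^sub>F U) ((Q \<circ>\<^sub>F T) \<circ>\<^sub>F U)"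
    by (rule whisker_right_nats[OF \<alpha> U composites(1)])
  from whisker_left_nats[OF this comp_ftor_functors[OF U composites(1)] P]
  have "P \<triangleright> (\<alpha> \<triangleleft> U) \<in> nats (P \<circ>\<^sub>F ((S \<circ>\<^sub>F R) \<circ>\<^sub>F U)) (P \<circ>\<^sub>F ((Q \<circ>\<^sub>F T) \<circ>\<^sub>F U))" .
  moreover have "P \<circ>\<^sub>F ((S \<circ>\<^sub>F R) \<circ>\<^sub>F U) = (P \<circ>\<^sub>F S) \<circ>\<^sub>F (R \<circ>\<^sub>F U)"
    using comp_ftor_assoc[OF U adjU(1) S] comp_ftor_assoc[OF comp_ftor_functors[OF U adjU(1)] S P]
        by simp
  moreover have "P \<circ>\<^sub>F ((Q \<circ>\<^sub>F T) \<circ>\<^sub>F U) = (P \<circ>\<^sub>F Q) \<circ>\<^sub>F (T \<circ>\<^sub>F U)"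
    using comp_ftor_assoc[OF U T adjP(1)] comp_ftor_assoc[OF composites(4) adjP(1) P] by simp
  ultimately show "P \<triangleright> (\<alpha> \<triangleleft> U) \<in> nats ((P \<circ>\<^sub>F S) \<circ>\<^sub>F (R \<circ>\<^sub>F U)) ((P \<circ>\<^sub>F Q) \<circ>\<^sub>F (T \<circ>\<^sub>F U))"
    by simp
  show "\<epsilon> \<triangleleft> (T \<circ>\<^sub>F U) \<in> nats ((P \<circ>\<^sub>F Q) \<circ>\<^sub>F (T \<circ>\<^sub>F U)) (T \<circ>\<^sub>F U)"
    using whisker_right_nats[OF adjP(3) composites(4) composites(5)] comp_id_ftor[OF composites(4)]
        by simp
qed

lemma mate_nats: "mate \<in> nats (P \<circ>\<^sub>F S) (T \<circ>\<^sub>F U)"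
  unfolding left_mate_def by (rule vcomp_nats[OF vcomp_nats[OF mate_factors(1,2)] mate_factors(3)])

lemma mate_Cmp:
  assumes X: "X \<in> Obj A"
  shows "Cmp mate X = Comp B' (Cmp \<epsilon> (FObj T (FObj U X)))
    (FArr P (Comp A' (Cmp \<alpha> (FObj U X)) (FArr S (Cmp \<eta> X))))"
  using X by (simp add: left_mate_def square_simps)

text \<open>
  Compatibility of mates with pasting, for the square \<open>\<alpha>\<^sub>2 : S\<^sub>2 Q \<rightarrow> Q\<^sub>2 T\<^sub>2\<close> next to \<open>\<alpha>\<close>. The
  right-hand side is the component at \<open>X\<close> of the mate of the pasted transformation
  \<open>\<alpha>\<^sub>2 T \<circ> S\<^sub>2 \<alpha>\<close>, written out so that no 2-cell for the pasted square has to be named.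
  Naturality moves the second mate past \<open>P\<close> applied to the transpose of the first, and the
  unit and counit of \<open>P\<close> and \<open>Q\<close> that then meet cancel by a triangle identity.
\<close>

lemma mate_paste:
  assumes "mate_square A' B' A'' B'' P Q \<eta>\<^sub>P \<epsilon> P\<^sub>2 Q\<^sub>2 \<eta>\<^sub>2 \<epsilon>\<^sub>2 S\<^sub>2 T\<^sub>2 \<alpha>\<^sub>2" and X: "X \<in> Obj A"
  shows "Comp B'' (FArr T\<^sub>2 (Cmp mate X)) (Cmp (left_mate S\<^sub>2 T\<^sub>2 \<alpha>\<^sub>2 P \<eta>\<^sub>P P\<^sub>2 \<epsilon>\<^sub>2) (FObj S X)) =
    Comp B'' (Cmp \<epsilon>\<^sub>2 (FObj T\<^sub>2 (FObj T (FObj U X))))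
      (FArr P\<^sub>2 (Comp A'' (Cmp \<alpha>\<^sub>2 (FObj T (FObj U X)))
        (Comp A'' (FArr S\<^sub>2 (Cmp \<alpha> (FObj U X))) (FArr S\<^sub>2 (FArr S (Cmp \<eta> X))))))"
proof -
  interpret sq2: mate_square A' B' A'' B'' P Q \<eta>\<^sub>P \<epsilon> P\<^sub>2 Q\<^sub>2 \<eta>\<^sub>2 \<epsilon>\<^sub>2 S\<^sub>2 T\<^sub>2 \<alpha>\<^sub>2 by fact
  note s = square_simps sq2.square_simps and c = square_cats sq2.square_cats
  define Z where "Z = FObj T (FObj U X)"
  have Z: "Z \<in> Obj B'" using X by (simp add: s Z_def)
  define \<phi> where "\<phi> = Comp A' (Cmp \<alpha> (FObj U X)) (FArr S (Cmp \<eta> X))"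
  have \<phi>: "\<phi> \<in> Arr A'" "Dom A' \<phi> = FObj S X" "Cod A' \<phi> = FObj Q Z"
    using X by (simp_all add: s c \<phi>_def Z_def)
  have m1: "Cmp mate X = Comp B' (Cmp \<epsilon> Z) (FArr P \<phi>)"
    using X by (simp add: mate_Cmp \<phi>_def Z_def)
  have nat: "Comp B'' (FArr T\<^sub>2 (FArr P \<phi>)) (Cmp sq2.mate (FObj S X)) =
      Comp B'' (Cmp sq2.mate (FObj Q Z)) (FArr P\<^sub>2 (FArr S\<^sub>2 \<phi>))"
    using naturality[OF sq2.mate_nats sq2.composites(3) \<phi>(1)] \<phi> by (simp add: s)
  have cancel: "Comp B'' (FArr T\<^sub>2 (Cmp \<epsilon> Z)) (Cmp sq2.mate (FObj Q Z)) =
      Comp B'' (Cmp \<epsilon>\<^sub>2 (FObj T\<^sub>2 Z)) (FArr P\<^sub>2 (Cmp \<alpha>\<^sub>2 Z))"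
  proof -
    define \<psi> where "\<psi> = Comp A'' (Cmp \<alpha>\<^sub>2 (FObj P (FObj Q Z))) (FArr S\<^sub>2 (Cmp \<eta>\<^sub>P (FObj Q Z)))"
    define \<epsilon>Z where "\<epsilon>Z = Cmp \<epsilon> Z"
    have \<epsilon>Z: "\<epsilon>Z \<in> Arr B'" "Dom B' \<epsilon>Z = FObj P (FObj Q Z)" "Cod B' \<epsilon>Z = Z"
      using Z by (simp_all add: s \<epsilon>Z_def)
    have \<psi>: "\<psi> \<in> Arr A''" "Cod A'' \<psi> = FObj Q\<^sub>2 (FObj T\<^sub>2 (FObj P (FObj Q Z)))"
      using Z by (simp_all add: s c \<psi>_def)
    have n\<epsilon>: "Comp B'' (FArr T\<^sub>2 \<epsilon>Z) (Cmp \<epsilon>\<^sub>2 (FObj T\<^sub>2 (FObj P (FObj Q Z)))) =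
        Comp B'' (Cmp \<epsilon>\<^sub>2 (FObj T\<^sub>2 Z)) (FArr P\<^sub>2 (FArr Q\<^sub>2 (FArr T\<^sub>2 \<epsilon>Z)))"
      using naturality[OF sq2.adjP(3) sq2.composites(5), of "FArr T\<^sub>2 \<epsilon>Z"] \<epsilon>Z by (simp add: s)
    have n\<alpha>: "Comp A'' (FArr Q\<^sub>2 (FArr T\<^sub>2 \<epsilon>Z)) (Cmp \<alpha>\<^sub>2 (FObj P (FObj Q Z))) =
        Comp A'' (Cmp \<alpha>\<^sub>2 Z) (FArr S\<^sub>2 (FArr Q \<epsilon>Z))"
      using naturality[OF sq2.\<alpha> sq2.composites(1) \<epsilon>Z(1)] \<epsilon>Z by (simp add: s)
    have tri: "Comp A'' (FArr S\<^sub>2 (FArr Q \<epsilon>Z)) (FArr S\<^sub>2 (Cmp \<eta>\<^sub>P (FObj Q Z))) =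
        Id A'' (FObj S\<^sub>2 (FObj Q Z))"
      using arg_cong[OF adjP(5)[OF Z], of "FArr S\<^sub>2"] \<epsilon>Z Z by (simp add: s \<epsilon>Z_def)
    have "Comp A'' (FArr Q\<^sub>2 (FArr T\<^sub>2 \<epsilon>Z)) \<psi> =
        Comp A'' (Comp A'' (FArr Q\<^sub>2 (FArr T\<^sub>2 \<epsilon>Z)) (Cmp \<alpha>\<^sub>2 (FObj P (FObj Q Z))))
          (FArr S\<^sub>2 (Cmp \<eta>\<^sub>P (FObj Q Z)))"
      using \<epsilon>Z Z by (simp add: s c \<psi>_def)
    also have "\<dots> = Comp A'' (Cmp \<alpha>\<^sub>2 Z)
        (Comp A'' (FArr S\<^sub>2 (FArr Q \<epsilon>Z)) (FArr S\<^sub>2 (Cmp \<eta>\<^sub>P (FObj Q Z))))"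
      unfolding n\<alpha> using \<epsilon>Z Z by (simp add: s c)
    also have "\<dots> = Cmp \<alpha>\<^sub>2 Z" unfolding tri using Z by (simp add: s c)
    finally have \<alpha>\<psi>: "Comp A'' (FArr Q\<^sub>2 (FArr T\<^sub>2 \<epsilon>Z)) \<psi> = Cmp \<alpha>\<^sub>2 Z" .
    have "Comp B'' (FArr T\<^sub>2 \<epsilon>Z) (Cmp sq2.mate (FObj Q Z)) =
        Comp B'' (Comp B'' (FArr T\<^sub>2 \<epsilon>Z) (Cmp \<epsilon>\<^sub>2 (FObj T\<^sub>2 (FObj P (FObj Q Z))))) (FArr P\<^sub>2 \<psi>)"
      using \<epsilon>Z \<psi> Z by (simp add: s c sq2.mate_Cmp flip: \<psi>_def)
    also have "\<dots> = Comp B'' (Cmp \<epsilon>\<^sub>2 (FObj T\<^sub>2 Z)) (FArr P\<^sub>2 (Comp A'' (FArr Q\<^sub>2 (FArr T\<^sub>2 \<epsilon>Z)) \<psi>))"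
      unfolding n\<epsilon> using \<epsilon>Z \<psi> Z by (simp add: s c)
    finally show ?thesis unfolding \<alpha>\<psi> by (simp add: \<epsilon>Z_def)
  qed
  have SX: "FObj S X \<in> Obj A'" "FObj Q Z \<in> Obj A'" using X Z by (simp_all add: s)
  note m2 = nat_simps[OF sq2.mate_nats sq2.composites(3)]
  have "Comp B'' (FArr T\<^sub>2 (Cmp mate X)) (Cmp sq2.mate (FObj S X)) =
      Comp B'' (FArr T\<^sub>2 (Cmp \<epsilon> Z)) (Comp B'' (FArr T\<^sub>2 (FArr P \<phi>)) (Cmp sq2.mate (FObj S X)))"
    unfolding m1 using SX Z \<phi> by (simp add: s c m2)
  also have "\<dots> = Comp B'' (Comp B'' (FArr T\<^sub>2 (Cmp \<epsilon> Z)) (Cmp sq2.mate (FObj Q Z))) (FArr P\<^sub>2 (FArr S\<^sub>2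
      \<phi>))"
    unfolding nat using SX Z \<phi> by (simp add: s c m2)
  also have "\<dots> = Comp B'' (Cmp \<epsilon>\<^sub>2 (FObj T\<^sub>2 Z)) (FArr P\<^sub>2 (Comp A'' (Cmp \<alpha>\<^sub>2 Z) (FArr S\<^sub>2 \<phi>)))"
    unfolding cancel using SX Z \<phi> by (simp add: s c)
  also have "FArr S\<^sub>2 \<phi> = Comp A'' (FArr S\<^sub>2 (Cmp \<alpha> (FObj U X))) (FArr S\<^sub>2 (FArr S (Cmp \<eta> X)))"
    unfolding \<phi>_def using X by (simp add: s)
  finally show ?thesis unfolding Z_def .
qed

end

section \<open>Sets and categories on a universe\<close>

lemma mk_cat_sel [simp]:
  "Obj (mk_cat Ob Ar d c i m) = Ob" "Arr (mk_cat Ob Ar d c i m) = Ar"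
  "f \<in> Ar \<Longrightarrow> Dom (mk_cat Ob Ar d c i m) f = d f" "f \<in> Ar \<Longrightarrow> Cod (mk_cat Ob Ar d c i m) f = c f"
  "x \<in> Ob \<Longrightarrow> Id (mk_cat Ob Ar d c i m) x = i x"
  "\<lbrakk>f \<in> Ar; g \<in> Ar; d g = c f\<rbrakk> \<Longrightarrow> Comp (mk_cat Ob Ar d c i m) g f = m g f"
  by (simp_all add: mk_cat_def)

lemma mk_cat_category:
  assumes "\<And>f. f \<in> Ar \<Longrightarrow> d f \<in> Ob \<and> c f \<in> Ob"
    and "\<And>x. x \<in> Ob \<Longrightarrow> i x \<in> Ar \<and> d (i x) = x \<and> c (i x) = x"
    and "\<And>f g. \<lbrakk>f \<in> Ar; g \<in> Ar; d g = c f\<rbrakk> \<Longrightarrow> m g f \<in> Ar \<and> d (m g f) = d f \<and> c (m g f) = c g"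
    and "\<And>f. f \<in> Ar \<Longrightarrow> m (i (c f)) f = f \<and> m f (i (d f)) = f"
    and "\<And>f g h. \<lbrakk>f \<in> Ar; g \<in> Ar; h \<in> Ar; d g = c f; d h = c g\<rbrakk> \<Longrightarrow> m h (m g f) = m (m h g) f"
  shows "category (mk_cat Ob Ar d c i m)"
  using assms by (intro categoryI) (auto simp: mk_cat_def)

lemma pair_inject [simp]: "pair a b = pair c d \<longleftrightarrow> a = c \<and> b = (d :: 'u::universe)"
  by (metis pfst_pair psnd_pair)

lemma tagR_neq_tagL [simp]: "tagR \<noteq> (tagL :: 'u::universe)"
  using tagL_neq_tagR by metis

lemma small_pairs:
  fixes A :: "'u::universe set"
  assumes "small A" "\<And>a. a \<in> A \<Longrightarrow> small (B a)"
  shows "small {pair a b | a b. a \<in> A \<and> b \<in> B a}"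
proof -
  have "{pair a b | a b. a \<in> A \<and> b \<in> B a} = (\<Union>a\<in>A. pair a ` B a)" by auto
  then show ?thesis using assms by (simp add: small_UN small_image)
qed

lemma small_Un:
  fixes A :: "'u::universe set"
  assumes "small A" "small B"
  shows "small (A \<union> B)"
proof -
  have "small (\<Union>t\<in>{tagL, tagR :: 'u}. if t = tagL then A else B)"
    using assms by (intro small_UN) (auto simp: small_finite)
  moreover have "(\<Union>t\<in>{tagL, tagR :: 'u}. if t = tagL then A else B) = A \<union> B" by auto
  ultimately show ?thesis by metis
qed

lemma one_cat_sel [simp]:
  "Obj one_cat = {tagL}" "Arr one_cat = {tagL}" "Dom one_cat tagL = tagL" "Cod one_cat tagL = tagL"
  "Id one_cat tagL = tagL" "Comp one_cat tagL tagL = tagL"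
  by (simp_all add: one_cat_def)

lemma one_category: "category one_cat"
  unfolding one_cat_def by (rule mk_cat_category) auto

lemma small_one_cat: "small_cat one_cat"
  by (simp add: small_cat_def small_finite one_category)

lemma to_one_functors: "category J \<Longrightarrow> to_one J \<in> functors J one_cat"
  unfolding to_one_def by (rule mk_ftor_functors) (auto simp: one_category)

lemma to_one_sel [simp]:
  "Src (to_one J) = J" "Tgt (to_one J) = one_cat"
  "x \<in> Obj J \<Longrightarrow> FObj (to_one J) x = tagL" "f \<in> Arr J \<Longrightarrow> FArr (to_one J) f = tagL"
  by (simp_all add: to_one_def)

lemma point_functors: "category K \<Longrightarrow> k \<in> Obj K \<Longrightarrow> point K k \<in> functors one_cat K"
  unfolding point_def by (rule mk_ftor_functors) (auto simp: one_category category_simps[of K])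

lemma point_sel [simp]:
  "Src (point K k) = one_cat" "Tgt (point K k) = K"
  "FObj (point K k) tagL = k" "FArr (point K k) tagL = Id K k"
  by (simp_all add: point_def)

lemma comp_point:
  assumes "u \<in> functors J K" "j \<in> Obj J"
  shows "u \<circ>\<^sub>F point J j = point K (FObj u j)"
  by (rule ftor_eqI[OF comp_ftor_functors[OF point_functors assms(1)] point_functors])
    (auto simp: functor_simps[OF assms(1)] assms(2))

lemma comp_to_one:
  assumes "u \<in> functors J K"
  shows "to_one K \<circ>\<^sub>F u = to_one J"
  by (rule ftor_eqI[OF comp_ftor_functors[OF assms to_one_functors] to_one_functors])
    (auto simp: functor_simps[OF assms])


section \<open>Products of small categories\<close>

lemma in_sprod_iff:
  shows "x \<in> Obj (sprod M K) \<longleftrightarrow> (\<exists>m k. x = pair m k \<and> m \<in> Obj M \<and> k \<in> Obj K)"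
    and "a \<in> Arr (sprod M K) \<longleftrightarrow> (\<exists>f g. a = pair f g \<and> f \<in> Arr M \<and> g \<in> Arr K)"
  by (auto simp: sprod_def)

lemma sprod_pair [simp]:
  shows "pair m k \<in> Obj (sprod M K) \<longleftrightarrow> m \<in> Obj M \<and> k \<in> Obj K"
    and "pair f g \<in> Arr (sprod M K) \<longleftrightarrow> f \<in> Arr M \<and> g \<in> Arr K"
    and "f \<in> Arr M \<Longrightarrow> g \<in> Arr K \<Longrightarrow> Dom (sprod M K) (pair f g) = pair (Dom M f) (Dom K g)"
    and "f \<in> Arr M \<Longrightarrow> g \<in> Arr K \<Longrightarrow> Cod (sprod M K) (pair f g) = pair (Cod M f) (Cod K g)"
    and "m \<in> Obj M \<Longrightarrow> k \<in> Obj K \<Longrightarrow> Id (sprod M K) (pair m k) = pair (Id M m) (Id K k)"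
    and "\<lbrakk>f \<in> Arr M; f' \<in> Arr M; g \<in> Arr K; g' \<in> Arr K; Dom M f' = Cod M f; Dom K g' = Cod K g\<rbrakk> \<Longrightarrow>
      Comp (sprod M K) (pair f' g') (pair f g) = pair (Comp M f' f) (Comp K g' g)"
  by (auto simp: sprod_def)

lemma sprod_category:
  assumes "category M" "category K"
  shows "category (sprod M K)"
  unfolding sprod_def
  by (rule mk_cat_category) (auto simp: category_simps[OF assms(1)] category_simps[OF assms(2)])

lemma sprod_small:
  assumes "small_cat M" "small_cat K"
  shows "small_cat (sprod M K)"
  using assms sprod_category[of M K] small_pairs[of "Obj M" "\<lambda>_. Obj K"]
    small_pairs[of "Arr M" "\<lambda>_. Arr K"]
  by (auto simp: small_cat_def sprod_def)

lemma sprod_empty: "sprod M empty_cat = empty_cat"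
  by (simp add: sprod_def empty_cat_def mk_cat_def restrict_def)

lemma sprod_ftor_sel [simp]:
  "Src (sprod_ftor M u) = sprod M (Src u)" "Tgt (sprod_ftor M u) = sprod M (Tgt u)"
  "m \<in> Obj M \<Longrightarrow> k \<in> Obj (Src u) \<Longrightarrow> FObj (sprod_ftor M u) (pair m k) = pair m (FObj u k)"
  "f \<in> Arr M \<Longrightarrow> g \<in> Arr (Src u) \<Longrightarrow> FArr (sprod_ftor M u) (pair f g) = pair f (FArr u g)"
  by (simp_all add: sprod_ftor_def)

lemma sprod_ftor_functors:
  assumes M: "category M" and u: "u \<in> functors J K"
  shows "sprod_ftor M u \<in> functors (sprod M J) (sprod M K)"
  using sprod_category[OF M functor_simps(3)[OF u]] sprod_category[OF M functor_simps(4)[OF u]]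
  unfolding sprod_ftor_def functor_simps(1,2)[OF u]
  by (intro mk_ftor_functors) (auto simp: in_sprod_iff functor_simps[OF u] category_simps[OF M]
    category_simps[OF functor_simps(3)[OF u]])

lemma sprod_ftor_id:
  assumes M: "category M" and J: "category J"
  shows "sprod_ftor M (id_ftor J) = id_ftor (sprod M J)"
  using sprod_ftor_functors[OF M id_ftor_functors[OF J]] id_ftor_functors[OF sprod_category[OF M J]]
  by (rule ftor_eqI) (auto simp: in_sprod_iff)

lemma sprod_ftor_comp:
  assumes M: "category M" and u: "u \<in> functors J K" and v: "v \<in> functors K L"
  shows "sprod_ftor M (v \<circ>\<^sub>F u) = sprod_ftor M v \<circ>\<^sub>F sprod_ftor M u"
  using sprod_ftor_functors[OF M comp_ftor_functors[OF u v]]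
    comp_ftor_functors[OF sprod_ftor_functors[OF M u] sprod_ftor_functors[OF M v]]
  by (rule ftor_eqI) (auto simp: in_sprod_iff functor_simps[OF u] functor_simps[OF v])

lemma sprod_nat_sel [simp]:
  "NSrc (sprod_nat M \<alpha>) = sprod_ftor M (NSrc \<alpha>)" "NTgt (sprod_nat M \<alpha>) = sprod_ftor M (NTgt \<alpha>)"
  "m \<in> Obj M \<Longrightarrow> k \<in> Obj (Src (NSrc \<alpha>)) \<Longrightarrow> Cmp (sprod_nat M \<alpha>) (pair m k) = pair (Id M m) (Cmp \<alpha> k)"
  by (simp_all add: sprod_nat_def)

lemma sprod_nat_nats:
  assumes M: "category M" and \<alpha>: "\<alpha> \<in> nats u v" and u: "u \<in> functors J K"
  shows "sprod_nat M \<alpha> \<in> nats (sprod_ftor M u) (sprod_ftor M v)"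
proof -
  note v = nat_simps(3)[OF \<alpha> u]
  show ?thesis
    using sprod_ftor_functors[OF M u] sprod_ftor_functors[OF M v]
    unfolding sprod_nat_def nat_simps(1,2)[OF \<alpha> u]
    by (rule mk_nat_nats) (auto simp: in_sprod_iff functor_simps[OF u] functor_simps[OF v]
      nat_simps[OF \<alpha> u] category_simps[OF M] category_simps[OF functor_simps(3)[OF u]]
      naturality[OF \<alpha> u])
qed

lemma sprod_nat_id:
  assumes M: "category M" and u: "u \<in> functors J K"
  shows "sprod_nat M (id_nat u) = id_nat (sprod_ftor M u)"
  using sprod_nat_nats[OF M id_nat_nats[OF u] u] id_nat_nats[OF sprod_ftor_functors[OF M u]]
  by (rule nat_eqI) (auto simp: in_sprod_iff functor_simps[OF u])

lemma sprod_nat_vcomp: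
  assumes M: "category M" and u: "u \<in> functors J K" and \<alpha>: "\<alpha> \<in> nats u v" and \<beta>: "\<beta> \<in> nats v w"
  shows "sprod_nat M (\<beta> \<bullet> \<alpha>) = sprod_nat M \<beta> \<bullet> sprod_nat M \<alpha>"
proof -
  note v = nat_simps(3)[OF \<alpha> u]
  show ?thesis
    using sprod_nat_nats[OF M vcomp_nats[OF \<alpha> \<beta>] u]
      vcomp_nats[OF sprod_nat_nats[OF M \<alpha> u] sprod_nat_nats[OF M \<beta> v]]
    by (rule nat_eqI) (auto simp: in_sprod_iff functor_simps[OF u] functor_simps[OF v] nat_simps[OF \<alpha> u]
      nat_simps[OF \<beta> v] category_simps[OF M])
qed

lemma sprod_nat_hcomp:
  assumes M: "category M" and u: "u \<in> functors J K" and v: "v \<in> functors K L"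
    and \<alpha>: "\<alpha> \<in> nats u u'" and \<beta>: "\<beta> \<in> nats v v'"
  shows "sprod_nat M (\<beta> \<star> \<alpha>) = sprod_nat M \<beta> \<star> sprod_nat M \<alpha>"
proof -
  note u' = nat_simps(3)[OF \<alpha> u] and v' = nat_simps(3)[OF \<beta> v]
  have "sprod_nat M (\<beta> \<star> \<alpha>) \<in> nats (sprod_ftor M (v \<circ>\<^sub>F u)) (sprod_ftor M (v' \<circ>\<^sub>F u'))"
    by (rule sprod_nat_nats[OF M hcomp_nats[OF \<alpha> u \<beta> v] comp_ftor_functors[OF u v]])
  moreover have "sprod_nat M \<beta> \<star> sprod_nat M \<alpha> \<in>
      nats (sprod_ftor M (v \<circ>\<^sub>F u)) (sprod_ftor M (v' \<circ>\<^sub>F u'))"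
    unfolding sprod_ftor_comp[OF M u v] sprod_ftor_comp[OF M u' v']
    by (rule hcomp_nats[OF sprod_nat_nats[OF M \<alpha> u] sprod_ftor_functors[OF M u]
          sprod_nat_nats[OF M \<beta> v] sprod_ftor_functors[OF M v]])
  ultimately show ?thesis
    by (rule nat_eqI) (auto simp: in_sprod_iff functor_simps[OF u] functor_simps[OF v]
      functor_simps[OF u'] functor_simps[OF v'] nat_simps[OF \<alpha> u]
      nat_simps[OF \<beta> v] category_simps[OF M])
qed

section \<open>Distributivity of products over sums\<close>

lemma in_sum_cat_iff:
  shows "x \<in> Obj (sum_cat J K) \<longleftrightarrow> (\<exists>j. x = pair tagL j \<and> j \<in> Obj J) \<or> (\<exists>k. x = pair tagR k \<and> k \<in> Obj K)"
    and "x \<in> Arr (sum_cat J K) \<longleftrightarrow> (\<exists>j. x = pair tagL j \<and> j \<in> Arr J) \<or> (\<exists>k. x = pair tagR k \<and> k \<in> Arr K)"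
  by (auto simp: sum_cat_def Let_def)

lemma sum_cat_pair [simp]:
  shows "pair t x \<in> Obj (sum_cat J K) \<longleftrightarrow> t = tagL \<and> x \<in> Obj J \<or> t = tagR \<and> x \<in> Obj K"
    and "pair t f \<in> Arr (sum_cat J K) \<longleftrightarrow> t = tagL \<and> f \<in> Arr J \<or> t = tagR \<and> f \<in> Arr K"
    and "f \<in> Arr J \<Longrightarrow> Dom (sum_cat J K) (pair tagL f) = pair tagL (Dom J f)"
    and "f \<in> Arr J \<Longrightarrow> Cod (sum_cat J K) (pair tagL f) = pair tagL (Cod J f)"
    and "x \<in> Obj J \<Longrightarrow> Id (sum_cat J K) (pair tagL x) = pair tagL (Id J x)"
    and "\<lbrakk>f \<in> Arr J; g \<in> Arr J; Dom J g = Cod J f\<rbrakk> \<Longrightarrow>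
      Comp (sum_cat J K) (pair tagL g) (pair tagL f) = pair tagL (Comp J g f)"
    and "f \<in> Arr K \<Longrightarrow> Dom (sum_cat J K) (pair tagR f) = pair tagR (Dom K f)"
    and "f \<in> Arr K \<Longrightarrow> Cod (sum_cat J K) (pair tagR f) = pair tagR (Cod K f)"
    and "x \<in> Obj K \<Longrightarrow> Id (sum_cat J K) (pair tagR x) = pair tagR (Id K x)"
    and "\<lbrakk>f \<in> Arr K; g \<in> Arr K; Dom K g = Cod K f\<rbrakk> \<Longrightarrow>
      Comp (sum_cat J K) (pair tagR g) (pair tagR f) = pair tagR (Comp K g f)"
  by (auto simp: sum_cat_def Let_def)

lemma sum_category:
  assumes "category J" "category K"
  shows "category (sum_cat J K)"
  unfolding sum_cat_def Let_def
  by (rule mk_cat_category) (auto simp: category_simps[OF assms(1)] category_simps[OF assms(2)])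

lemma sum_small:
  assumes "small_cat J" "small_cat K"
  shows "small_cat (sum_cat J K)"
  using assms sum_category[of J K] by (auto simp: small_cat_def sum_cat_def Let_def intro: small_Un
      small_image)

lemma in_left_functors: "category J \<Longrightarrow> category K \<Longrightarrow> in_left J K \<in> functors J (sum_cat J K)"
  unfolding in_left_def by (rule mk_ftor_functors) (auto simp: sum_category category_simps[of J])

lemma in_right_functors: "category J \<Longrightarrow> category K \<Longrightarrow> in_right J K \<in> functors K (sum_cat J K)"
  unfolding in_right_def by (rule mk_ftor_functors) (auto simp: sum_category category_simps[of K])

lemma inclusion_sel [simp]:
  "Src (in_left J K) = J" "Tgt (in_left J K) = sum_cat J K"
  "x \<in> Obj J \<Longrightarrow> FObj (in_left J K) x = pair tagL x" "f \<in> Arr J \<Longrightarrow> FArr (in_left J K) f = pair tagL f"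
  "Src (in_right J K) = K" "Tgt (in_right J K) = sum_cat J K"
  "y \<in> Obj K \<Longrightarrow> FObj (in_right J K) y = pair tagR y" "g \<in> Arr K \<Longrightarrow> FArr (in_right J K) g = pair tagR g"
  by (simp_all add: in_left_def in_right_def)

text \<open>
  The isomorphism from \<open>(M \<times> J) \<squnion> (M \<times> K)\<close> to \<open>M \<times> (J \<squnion> K)\<close>. Objects and arrows are coded
  alike, so one formula serves for both.
\<close>

definition sum_distrib :: "'u::universe scat \<Rightarrow> 'u scat \<Rightarrow> 'u scat \<Rightarrow> 'u sftor" where
  "sum_distrib M J K = (let sh = (\<lambda>x. pair (pfst (psnd x)) (pair (pfst x) (psnd (psnd x)))) in
     mk_ftor (sum_cat (sprod M J) (sprod M K)) (sprod M (sum_cat J K)) sh sh)"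

lemma sum_distrib_sel [simp]:
  "Src (sum_distrib M J K) = sum_cat (sprod M J) (sprod M K)" "Tgt (sum_distrib M J K) =
      sprod M (sum_cat J K)"
  "pair t (pair m x) \<in> Obj (sum_cat (sprod M J) (sprod M K)) \<Longrightarrow>
     FObj (sum_distrib M J K) (pair t (pair m x)) = pair m (pair t x)"
  "pair t (pair f g) \<in> Arr (sum_cat (sprod M J) (sprod M K)) \<Longrightarrow>
     FArr (sum_distrib M J K) (pair t (pair f g)) = pair f (pair t g)"
  unfolding sum_distrib_def Let_def by (simp_all del: sum_cat_pair)

lemma sum_distrib_functors:
  assumes "category M" "category J" "category K"
  shows "sum_distrib M J K \<in> functors (sum_cat (sprod M J) (sprod M K)) (sprod M (sum_cat J K))"
  using assms unfolding sum_distrib_def Let_def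
  by (intro mk_ftor_functors sum_category sprod_category)
    (auto simp: in_sum_cat_iff in_sprod_iff category_simps[of M] category_simps[of J]
        category_simps[of K])

lemma sum_distrib_inverse:
  assumes "category M" "category J" "category K"
  shows "\<exists>G. inverse_ftors (sum_cat (sprod M J) (sprod M K)) (sprod M (sum_cat J K)) (sum_distrib M
      J K) G"
proof (rule bij_functor_has_inverse[OF sum_distrib_functors[OF assms]])
  show "bij_betw (FObj (sum_distrib M J K)) (Obj (sum_cat (sprod M J) (sprod M K))) (Obj (sprod M
      (sum_cat J K)))"
    by (rule bij_betw_byWitness[where f' = "\<lambda>x. pair (pfst (psnd x)) (pair (pfst x) (psnd (psnd x)))"])
      (auto simp: in_sum_cat_iff in_sprod_iff)
  show "bij_betw (FArr (sum_distrib M J K)) (Arr (sum_cat (sprod M J) (sprod M K))) (Arr (sprod M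
      (sum_cat J K)))"
    by (rule bij_betw_byWitness[where f' = "\<lambda>x. pair (pfst (psnd x)) (pair (pfst x) (psnd (psnd x)))"])
      (auto simp: in_sum_cat_iff in_sprod_iff)
qed

lemma sum_distrib_in_left:
  assumes "category M" "category J" "category K"
  shows "sum_distrib M J K \<circ>\<^sub>F in_left (sprod M J) (sprod M K) = sprod_ftor M (in_left J K)"
  using comp_ftor_functors[OF in_left_functors[OF sprod_category[OF assms(1,2)] sprod_category[OF
      assms(1,3)]]
      sum_distrib_functors[OF assms]]
    sprod_ftor_functors[OF assms(1) in_left_functors[OF assms(2,3)]]
  by (rule ftor_eqI) (auto simp: in_sprod_iff)

lemma sum_distrib_in_right:
  assumes "category M" "category J" "category K"
  shows "sum_distrib M J K \<circ>\<^sub>F in_right (sprod M J) (sprod M K) = sprod_ftor M (in_right J K)"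
  using comp_ftor_functors[OF in_right_functors[OF sprod_category[OF assms(1,2)] sprod_category[OF
      assms(1,3)]]
      sum_distrib_functors[OF assms]]
    sprod_ftor_functors[OF assms(1) in_right_functors[OF assms(2,3)]]
  by (rule ftor_eqI) (auto simp: in_sprod_iff)

section \<open>Comma categories\<close>

lemma in_over_cat_iff:
  assumes u: "u \<in> functors J K"
  shows "x \<in> Obj (over_cat u k) \<longleftrightarrow> (\<exists>j f. x = pair j f \<and> j \<in> Obj J \<and> f \<in> Arr K \<and> Dom K f =
      FObj u j \<and> Cod K f = k)"
    and "a \<in> Arr (over_cat u k) \<longleftrightarrow> (\<exists>h f. a = pair h f \<and> h \<in> Arr J \<and> f \<in> Arr K \<and>
      Dom K f = FObj u (Cod J h) \<and> Cod K f = k)"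
  by (auto simp: over_cat_def Let_def functor_simps[OF u] hom_def)

lemma over_cat_pair:
  assumes u: "u \<in> functors J K"
  shows "pair j f \<in> Obj (over_cat u k) \<longleftrightarrow> j \<in> Obj J \<and> f \<in> Arr K \<and> Dom K f = FObj u j \<and> Cod K f = k"
    and "pair h f \<in> Arr (over_cat u k) \<longleftrightarrow> h \<in> Arr J \<and> f \<in> Arr K \<and> Dom K f =
        FObj u (Cod J h) \<and> Cod K f = k"
    and "pair h f \<in> Arr (over_cat u k) \<Longrightarrow> Dom (over_cat u k) (pair h f) =
        pair (Dom J h) (Comp K f (FArr u h))"
    and "pair h f \<in> Arr (over_cat u k) \<Longrightarrow> Cod (over_cat u k) (pair h f) = pair (Cod J h) f"
    and "pair j f \<in> Obj (over_cat u k) \<Longrightarrow> Id (over_cat u k) (pair j f) = pair (Id J j) f"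
    and "\<lbrakk>pair h f \<in> Arr (over_cat u k); pair h' f' \<in> Arr (over_cat u k);
        Dom J h' = Cod J h; f = Comp K f' (FArr u h')\<rbrakk> \<Longrightarrow>
      Comp (over_cat u k) (pair h' f') (pair h f) = pair (Comp J h' h) f'"
  by (auto simp: over_cat_def Let_def functor_simps[OF u] hom_def)

lemma over_category:
  assumes u: "u \<in> functors J K"
  shows "category (over_cat u k)"
  unfolding over_cat_def Let_def functor_simps(1,2)[OF u]
proof (rule mk_cat_category, goal_cases)
  case (3 a b)
  note s = functor_simps[OF u] category_simps[OF functor_simps(3)[OF u]]
      category_simps[OF functor_simps(4)[OF u]]
  obtain h f where a: "a = pair h f" "h \<in> Arr J" "f \<in> Arr K" "Dom K f = FObj u (Cod J h)" "Cod K f = k"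
    using 3(1) by (auto simp: hom_def)
  obtain h' f' where b: "b = pair h' f'" "h' \<in> Arr J" "f' \<in> Arr K" "Dom K f' =
      FObj u (Cod J h')" "Cod K f' = k"
    using 3(2) by (auto simp: hom_def)
  have e: "Dom J h' = Cod J h" "f = Comp K f' (FArr u h')" using 3(3) by (simp_all add: a(1) b(1))
  show ?case using a(2) b(2-) e(1) by (simp add: a(1) b(1) e(2) s hom_def)
next
  case (5 f g h)
  have "pfst f \<in> Arr J" "pfst g \<in> Arr J" "pfst h \<in> Arr J" using 5(1-3) by auto
  moreover have "Dom J (pfst g) = Cod J (pfst f)" "Dom J (pfst h) = Cod J (pfst g)"
    using 5(4,5) unfolding pair_inject by blast+
  ultimately show ?case by (simp add: category_simps[OF functor_simps(3)[OF u]])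
qed (auto simp: hom_def functor_simps[OF u] category_simps[OF functor_simps(3)[OF u]]
      category_simps[OF functor_simps(4)[OF u]])

lemma over_small:
  assumes "small_cat J" "small_cat K" and u: "u \<in> functors J K"
  shows "small_cat (over_cat u k)"
proof -
  have h: "small (hom K x y)" for x y
    using assms(2) by (auto simp: small_cat_def hom_def intro: small_subset)
  show ?thesis using over_category[OF u] assms
    unfolding small_cat_def over_cat_def Let_def
    by (auto simp: functor_simps[OF u] h intro!: small_pairs)
qed

lemma over_proj_functors:
  assumes u: "u \<in> functors J K"
  shows "over_proj u k \<in> functors (over_cat u k) J"
  unfolding over_proj_def functor_simps(1)[OF u]
  by (rule mk_ftor_functors) (auto simp: over_category[OF u] functor_simps[OF u] in_over_cat_iff[OF
      u] over_cat_pair[OF u]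
    category_simps[OF functor_simps(4)[OF u]])

lemma over_proj_sel [simp]:
  "Src (over_proj u k) = over_cat u k" "Tgt (over_proj u k) = Src u"
  "pair j f \<in> Obj (over_cat u k) \<Longrightarrow> FObj (over_proj u k) (pair j f) = j"
  "pair h g \<in> Arr (over_cat u k) \<Longrightarrow> FArr (over_proj u k) (pair h g) = h"
  by (simp_all add: over_proj_def)

lemma over_nat_nats:
  assumes u: "u \<in> functors J K" and k: "k \<in> Obj K"
  shows "over_nat u k \<in> nats (u \<circ>\<^sub>F over_proj u k) (point K k \<circ>\<^sub>F to_one (over_cat u k))"
  unfolding over_nat_def functor_simps(1,2)[OF u]
  by (rule mk_nat_nats[OF comp_ftor_functors[OF over_proj_functors[OF u] u]
      comp_ftor_functors[OF to_one_functors[OF over_category[OF u]] point_functors[OF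
          functor_simps(4)[OF u] k]]])
    (auto simp: functor_simps[OF u] in_over_cat_iff[OF u] over_cat_pair[OF u]
     category_simps[OF functor_simps(3)[OF u]] category_simps[OF functor_simps(4)[OF u]])

lemma over_nat_sel [simp]:
  "x \<in> Obj (over_cat u k) \<Longrightarrow> Cmp (over_nat u k) x = psnd x"
  "NSrc (over_nat u k) = u \<circ>\<^sub>F over_proj u k"
  "NTgt (over_nat u k) = point (Tgt u) k \<circ>\<^sub>F to_one (over_cat u k)"
  by (simp_all add: over_nat_def)

text \<open>
  On objects, \<open>((m', (j, g)), (a, *))\<close> goes to \<open>((m', j), (a, g))\<close>, where \<open>g : u(j) \<rightarrow> k\<close> and
  \<open>a : m' \<rightarrow> m\<close>. An arrow is coded by an arrow of the base and the structure map of its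
  codomain, so the same formula applies to it.
\<close>

definition over_shuffle :: "'u::universe scat \<Rightarrow> 'u sftor \<Rightarrow> 'u \<Rightarrow> 'u \<Rightarrow> 'u sftor" where
  "over_shuffle M u k m = (let
     sh = (\<lambda>x. pair (pair (pfst (pfst x)) (pfst (psnd (pfst x)))) (pair (pfst (psnd x)) (psnd (psnd
         (pfst x)))))
    in mk_ftor (over_cat (sprod_ftor M (to_one (over_cat u k))) (pair m tagL))
      (over_cat (sprod_ftor M u) (pair m k)) sh sh)"

lemma over_shuffle_functors:
  assumes M: "category M" and u: "u \<in> functors J K"
  shows "over_shuffle M u k m \<in>
    functors (over_cat (sprod_ftor M (to_one (over_cat u k))) (pair m tagL)) (over_cat (sprod_ftor M
        u) (pair m k))"
proof -
  note q = sprod_ftor_functors[OF M to_one_functors[OF over_category[OF u]]]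
  note Mu = sprod_ftor_functors[OF M u]
  show ?thesis unfolding over_shuffle_def Let_def
    by (intro mk_ftor_functors over_category[OF q] over_category[OF Mu])
     (auto simp: in_over_cat_iff[OF q] over_cat_pair[OF q] in_over_cat_iff[OF Mu] over_cat_pair[OF
         Mu] in_sprod_iff
      in_over_cat_iff[OF u] over_cat_pair[OF u] functor_simps[OF u]
      category_simps[OF M] category_simps[OF functor_simps(3)[OF u]] category_simps[OF
          functor_simps(4)[OF u]])
qed

lemma over_shuffle_inverse:
  assumes M: "category M" and u: "u \<in> functors J K"
  shows "\<exists>G. inverse_ftors (over_cat (sprod_ftor M (to_one (over_cat u k))) (pair m tagL))
    (over_cat (sprod_ftor M u) (pair m k)) (over_shuffle M u k m) G"
proof (rule bij_functor_has_inverse[OF over_shuffle_functors[OF assms]])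
  note q = sprod_ftor_functors[OF M to_one_functors[OF over_category[OF u]]]
  note Mu = sprod_ftor_functors[OF M u]
  show "bij_betw (FObj (over_shuffle M u k m))
      (Obj (over_cat (sprod_ftor M (to_one (over_cat u k))) (pair m tagL))) (Obj (over_cat
          (sprod_ftor M u) (pair m k)))"
    by (rule bij_betw_byWitness[where f' = "\<lambda>x. pair (pair (pfst (pfst x)) (pair (psnd (pfst x))
        (psnd (psnd x))))
      (pair (pfst (psnd x)) tagL)"])
      (auto simp: over_shuffle_def Let_def in_over_cat_iff[OF q] over_cat_pair[OF q]
          in_over_cat_iff[OF Mu] over_cat_pair[OF Mu] in_sprod_iff
      in_over_cat_iff[OF u] over_cat_pair[OF u] functor_simps[OF u])
  show "bij_betw (FArr (over_shuffle M u k m))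
      (Arr (over_cat (sprod_ftor M (to_one (over_cat u k))) (pair m tagL))) (Arr (over_cat
          (sprod_ftor M u) (pair m k)))"
    by (rule bij_betw_byWitness[where f' = "\<lambda>x. pair (pair (pfst (pfst x)) (pair (psnd (pfst x))
        (psnd (psnd x))))
      (pair (pfst (psnd x)) tagL)"])
      (auto simp: over_shuffle_def Let_def in_over_cat_iff[OF q] over_cat_pair[OF q]
          in_over_cat_iff[OF Mu] over_cat_pair[OF Mu] in_sprod_iff
      in_over_cat_iff[OF u] over_cat_pair[OF u] functor_simps[OF u] category_simps[OF M]
      category_simps[OF functor_simps(3)[OF u]])
qed

lemma over_shuffle_sel:
  fixes u :: "'u::universe sftor" and k m :: 'u
  assumes M: "category M" and u: "u \<in> functors J K"
  defines "V \<equiv> over_cat (sprod_ftor M (to_one (over_cat u k))) (pair m tagL)"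
  shows "Src (over_shuffle M u k m) = V" "Tgt (over_shuffle M u k m) =
      over_cat (sprod_ftor M u) (pair m k)"
    and "pair (pair m' (pair j g)) (pair a t) \<in> Obj V \<Longrightarrow>
      FObj (over_shuffle M u k m) (pair (pair m' (pair j g)) (pair a t)) = pair (pair m' j) (pair a g)"
    and "pair (pair b (pair h g)) (pair a t) \<in> Arr V \<Longrightarrow>
      FArr (over_shuffle M u k m) (pair (pair b (pair h g)) (pair a t)) = pair (pair b h) (pair a g)"
  by (simp_all add: over_shuffle_def Let_def V_def)

lemma over_proj_shuffle:
  fixes u :: "'u::universe sftor" and k m :: 'u
  assumes M: "category M" and u: "u \<in> functors J K"
  defines "q \<equiv> sprod_ftor M (to_one (over_cat u k))"
  shows "over_proj (sprod_ftor M u) (pair m k) \<circ>\<^sub>F over_shuffle M u k m =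
    sprod_ftor M (over_proj u k) \<circ>\<^sub>F over_proj q (pair m tagL)"
proof (rule ftor_eqI)
  note q = sprod_ftor_functors[OF M to_one_functors[OF over_category[OF u]], of k, folded q_def]
  note Mu = sprod_ftor_functors[OF M u]
  note \<theta> = over_shuffle_functors[OF M u, where k = k and m = m, folded q_def]
  show "over_proj (sprod_ftor M u) (pair m k) \<circ>\<^sub>F over_shuffle M u k m \<in>
      functors (over_cat q (pair m tagL)) (sprod M J)"
    by (rule comp_ftor_functors[OF \<theta> over_proj_functors[OF Mu]])
  show "sprod_ftor M (over_proj u k) \<circ>\<^sub>F over_proj q (pair m tagL) \<in> functors (over_cat q (pair m
      tagL)) (sprod M J)"
    by (rule comp_ftor_functors[OF over_proj_functors[OF q] sprod_ftor_functors[OF M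
        over_proj_functors[OF u]]])
  note s = over_shuffle_sel[OF M u, where k = k and m = m, folded q_def] functor_simps(5,6)[OF \<theta>]
  show "FObj (over_proj (sprod_ftor M u) (pair m k) \<circ>\<^sub>F over_shuffle M u k m) x =
      FObj (sprod_ftor M (over_proj u k) \<circ>\<^sub>F over_proj q (pair m tagL)) x"
          if x: "x \<in> Obj (over_cat q (pair m tagL))" for x
  proof -
    obtain m' j g a where xe: "x = pair (pair m' (pair j g)) (pair a tagL)"
        and *: "m' \<in> Obj M" "pair j g \<in> Obj (over_cat u k)"
      using x by (auto simp: in_over_cat_iff[OF q] in_sprod_iff in_over_cat_iff[OF u])
    show ?thesis using * x s(5)[of x] unfolding xe by (simp add: s(1-4))
  qed
  show "FArr (over_proj (sprod_ftor M u) (pair m k) \<circ>\<^sub>F over_shuffle M u k m) x =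
      FArr (sprod_ftor M (over_proj u k) \<circ>\<^sub>F over_proj q (pair m tagL)) x"
          if x: "x \<in> Arr (over_cat q (pair m tagL))" for x
  proof -
    obtain b h g a where xe: "x = pair (pair b (pair h g)) (pair a tagL)"
        and *: "b \<in> Arr M" "pair h g \<in> Arr (over_cat u k)"
      using x by (auto simp: in_over_cat_iff[OF q] in_sprod_iff in_over_cat_iff[OF u])
    show ?thesis using * x s(6)[of x] unfolding xe by (simp add: s(1-4))
  qed
qed

text \<open>
  Up to the isomorphism, the comma square of \<open>id\<^sub>M \<times> u\<close> and \<open>(m, k)\<close> is the comma square of \<open>q\<close>
  and \<open>(m, *)\<close> pasted to the product of \<open>M\<close> with the comma square of \<open>u\<close> and \<open>k\<close>: the
  components \<open>(a, id)\<close> and \<open>(id, g)\<close> compose to \<open>(a, g)\<close>.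
\<close>

lemma over_nat_shuffle:
  fixes u :: "'u::universe sftor" and k m :: 'u
  assumes M: "category M" and u: "u \<in> functors J K" and k: "k \<in> Obj K" and m: "m \<in> Obj M"
  defines "q \<equiv> sprod_ftor M (to_one (over_cat u k))"
  shows "over_nat (sprod_ftor M u) (pair m k) \<triangleleft> over_shuffle M u k m =
    (sprod_ftor M (point K k) \<triangleright> over_nat q (pair m tagL)) \<bullet>
    (sprod_nat M (over_nat u k) \<triangleleft> over_proj q (pair m tagL))"
proof -
  define W where "W = over_cat u k"
  define V where "V = over_cat q (pair m tagL)"
  define pr where "pr = sprod_ftor M (over_proj u k)"
  define pr\<^sub>2 where "pr\<^sub>2 = over_proj q (pair m tagL)"
  define \<kappa> where "\<kappa> = sprod_ftor M (point K k)"
  define \<theta> where "\<theta> = over_shuffle M u k m"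
  define V' where "V' = over_cat (sprod_ftor M u) (pair m k)"
  note J = functor_simps(3)[OF u] and K = functor_simps(4)[OF u]
  have W: "category W" unfolding W_def by (rule over_category[OF u])
  have q: "q \<in> functors (sprod M W) (sprod M one_cat)"
    unfolding q_def W_def by (rule sprod_ftor_functors[OF M to_one_functors[OF over_category[OF u]]])
  note Mu = sprod_ftor_functors[OF M u]
  note one = one_category
  have \<theta>: "\<theta> \<in> functors V V'"
    using over_shuffle_functors[OF M u, where k = k and m = m, folded q_def]
        by (simp add: \<theta>_def V_def V'_def)
  have pr: "pr \<in> functors (sprod M W) (sprod M J)"
    unfolding pr_def W_def by (rule sprod_ftor_functors[OF M over_proj_functors[OF u]])
  have pr\<^sub>2: "pr\<^sub>2 \<in> functors V (sprod M W)" unfolding pr\<^sub>2_def V_def by (rule over_proj_functors[OF q])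
  have \<kappa>: "\<kappa> \<in> functors (sprod M one_cat) (sprod M K)"
    unfolding \<kappa>_def by (rule sprod_ftor_functors[OF M point_functors[OF K k]])
  have pt: "point (sprod M one_cat) (pair m tagL) \<in> functors one_cat (sprod M one_cat)"
    by (rule point_functors[OF sprod_category[OF M one]]) (simp add: m)
  have V: "category V" unfolding V_def by (rule over_category[OF q])
  have \<alpha>: "sprod_nat M (over_nat u k) \<in> nats (sprod_ftor M u \<circ>\<^sub>F pr) (\<kappa> \<circ>\<^sub>F q)"
    using sprod_nat_nats[OF M over_nat_nats[OF u k] comp_ftor_functors[OF over_proj_functors[OF u] u]]
    unfolding sprod_ftor_comp[OF M over_proj_functors[OF u] u]
      sprod_ftor_comp[OF M to_one_functors[OF over_category[OF u]] point_functors[OF K k]]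
      pr_def \<kappa>_def q_def .
  have \<alpha>2: "over_nat q (pair m tagL) \<in> nats (q \<circ>\<^sub>F pr\<^sub>2) (point (sprod M one_cat) (pair m tagL) \<circ>\<^sub>F
      to_one V)"
    unfolding pr\<^sub>2_def V_def by (rule over_nat_nats[OF q]) (simp add: m)
  have "sprod_nat M (over_nat u k) \<triangleleft> pr\<^sub>2 \<in> nats ((sprod_ftor M u \<circ>\<^sub>F pr) \<circ>\<^sub>F pr\<^sub>2) ((\<kappa> \<circ>\<^sub>F q) \<circ>\<^sub>F pr\<^sub>2)"
    by (rule whisker_right_nats[OF \<alpha> pr\<^sub>2 comp_ftor_functors[OF pr Mu]])
  moreover have "\<kappa> \<triangleright> over_nat q (pair m tagL) \<in> nats ((\<kappa> \<circ>\<^sub>F q) \<circ>\<^sub>F pr\<^sub>2) (\<kappa> \<circ>\<^sub>F (point (sprod M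
      one_cat) (pair m tagL) \<circ>\<^sub>F to_one V))"
    using whisker_left_nats[OF \<alpha>2 comp_ftor_functors[OF pr\<^sub>2 q] \<kappa>]
        by (simp only: comp_ftor_assoc[OF pr\<^sub>2 q \<kappa>])
  ultimately have R: "(\<kappa> \<triangleright> over_nat q (pair m tagL)) \<bullet> (sprod_nat M (over_nat u k) \<triangleleft> pr\<^sub>2) \<in>
      nats ((sprod_ftor M u \<circ>\<^sub>F pr) \<circ>\<^sub>F pr\<^sub>2) (\<kappa> \<circ>\<^sub>F (point (sprod M one_cat) (pair m tagL) \<circ>\<^sub>F to_one V))"
    by (rule vcomp_nats)
  have mk: "pair m k \<in> Obj (sprod M K)" by (simp add: m k)
  note proj = over_proj_functors[OF Mu, of "pair m k", folded V'_def]
  have V': "category V'" unfolding V'_def by (rule over_category[OF Mu])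
  have L: "over_nat (sprod_ftor M u) (pair m k) \<triangleleft> \<theta> \<in>
      nats ((sprod_ftor M u \<circ>\<^sub>F over_proj (sprod_ftor M u) (pair m k)) \<circ>\<^sub>F \<theta>)
        ((point (sprod M K) (pair m k) \<circ>\<^sub>F to_one V') \<circ>\<^sub>F \<theta>)"
    using whisker_right_nats[OF over_nat_nats[OF Mu mk, folded V'_def] \<theta> comp_ftor_functors[OF proj
        Mu]] .
  have "(sprod_ftor M u \<circ>\<^sub>F over_proj (sprod_ftor M u) (pair m k)) \<circ>\<^sub>F \<theta> = (sprod_ftor M u \<circ>\<^sub>F pr) \<circ>\<^sub>F pr\<^sub>2"
    using comp_ftor_assoc[OF pr\<^sub>2 pr Mu] comp_ftor_assoc[OF \<theta> proj Mu] over_proj_shuffle[OF M u,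
        where k = k and m = m, folded q_def]
    by (simp add: pr_def pr\<^sub>2_def \<theta>_def)
  moreover have "(point (sprod M K) (pair m k) \<circ>\<^sub>F to_one V') \<circ>\<^sub>F \<theta> =
      \<kappa> \<circ>\<^sub>F (point (sprod M one_cat) (pair m tagL) \<circ>\<^sub>F to_one V)"
  proof -
    have "\<kappa> \<circ>\<^sub>F point (sprod M one_cat) (pair m tagL) = point (sprod M K) (pair m k)"
      using comp_point[OF \<kappa>, of "pair m tagL"] m by (simp add: \<kappa>_def)
    then show ?thesis
      using comp_ftor_assoc[OF \<theta> to_one_functors[OF V'] point_functors[OF sprod_category[OF M K] mk]]
        comp_ftor_assoc[OF to_one_functors[OF V] pt \<kappa>] comp_to_one[OF \<theta>] by simp
  qed
  ultimately have L: "over_nat (sprod_ftor M u) (pair m k) \<triangleleft> \<theta> \<in>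
      nats ((sprod_ftor M u \<circ>\<^sub>F pr) \<circ>\<^sub>F pr\<^sub>2) (\<kappa> \<circ>\<^sub>F (point (sprod M one_cat) (pair m tagL) \<circ>\<^sub>F to_one V))"
    using L by simp
  have "over_nat (sprod_ftor M u) (pair m k) \<triangleleft> \<theta> =
    (\<kappa> \<triangleright> over_nat q (pair m tagL)) \<bullet> (sprod_nat M (over_nat u k) \<triangleleft> pr\<^sub>2)"
  proof (rule nat_eqI[OF L R])
    fix x assume "x \<in> Obj (Src ((sprod_ftor M u \<circ>\<^sub>F pr) \<circ>\<^sub>F pr\<^sub>2))"
    then have x: "x \<in> Obj V" by (simp add: functor_simps(1)[OF pr\<^sub>2])
    then obtain y b where x_yb: "x = pair y b" "y \<in> Obj (sprod M W)" "b \<in> Arr (sprod M one_cat)"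
        "Dom (sprod M one_cat) b = FObj q y"
      by (auto simp: in_over_cat_iff[OF q] V_def)
    obtain m' j g where y: "y = pair m' (pair j g)" "m' \<in> Obj M" "pair j g \<in> Obj W" "j \<in> Obj J" "g \<in>
        Arr K"
        "Dom K g = FObj u j" "Cod K g = k"
      using x_yb(2) by (auto simp: in_sprod_iff W_def in_over_cat_iff[OF u])
    obtain a where a: "b = pair a tagL" "a \<in> Arr M" using x_yb(3) by (auto simp: in_sprod_iff)
    have "FObj q y = pair m' tagL" using y(2,3) by (simp add: y(1) q_def W_def)
    then have "Dom M a = m'" using x_yb(4) a by simp
    with x_yb(1) y a have xe: "x = pair (pair m' (pair j g)) (pair a tagL)"
      and *: "m' \<in> Obj M" "pair j g \<in> Obj W" "j \<in> Obj J" "g \<in> Arr K" "Dom K g = FObj u j" "Cod K g = k"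
        "a \<in> Arr M" "Dom M a = m'" by simp_all
    have \<theta>x: "FObj \<theta> x = pair (pair m' j) (pair a g)"
      using over_shuffle_sel(3)[OF M u, where k = k and m = m, folded q_def] x
          unfolding xe V_def \<theta>_def by blast
    have pr2x: "FObj pr\<^sub>2 x = pair m' (pair j g)" using x unfolding xe V_def pr\<^sub>2_def by simp
    have "Cmp (over_nat (sprod_ftor M u) (pair m k) \<triangleleft> \<theta>) x = pair a g"
      using x functor_simps(5)[OF \<theta> x] \<theta>x functor_simps(1)[OF \<theta>] by (simp add: V'_def)
    moreover have "Cmp (over_nat q (pair m tagL)) x = pair a tagL" using x by (simp add: xe V_def)
    moreover have "Cmp (sprod_nat M (over_nat u k)) (pair m' (pair j g)) = pair (Id M m') g"
      using * functor_simps(1)[OF over_proj_functors[OF u]] by (simp add: W_def)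
    ultimately show "Cmp (over_nat (sprod_ftor M u) (pair m k) \<triangleleft> \<theta>) x =
      Cmp ((\<kappa> \<triangleright> over_nat q (pair m tagL)) \<bullet> (sprod_nat M (over_nat u k) \<triangleleft> pr\<^sub>2)) x"
      using * x category_simps[OF M] category_simps[OF K]
      by (simp add: functor_simps(1,2)[OF pr\<^sub>2] functor_simps(1)[OF u]  functor_simps(2)[OF u]  pr2x)
          (simp add: \<kappa>_def k pr\<^sub>2_def V_def)
  qed
  then show ?thesis by (simp add: \<kappa>_def \<theta>_def pr\<^sub>2_def)
qed

section \<open>Prederivators and the shift by a category\<close>

context prederivator
begin

text \<open>
  As \<open>D\<close> is contravariant on functors, it turns a left whiskering into a right one, and
  conversely.
\<close>

lemma on_whisker_left:
  assumes small: "small_cat J" "small_cat K" "small_cat L"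
    and u: "u \<in> functors J K" and v: "v \<in> functors K L" and \<alpha>: "\<alpha> \<in> nats u u'"
  shows "on_nat D (v \<triangleright> \<alpha>) = on_nat D \<alpha> \<triangleleft> on_ftor D v"
proof -
  note u' = nat_simps(3)[OF \<alpha> u]
  have "on_nat D (v \<triangleright> \<alpha>) = on_nat D \<alpha> \<star> on_nat D (id_nat v)"
    unfolding whisker_left_eq_hcomp[OF \<alpha> u v, symmetric]
    by (rule on_hcomp[OF small u u' v v \<alpha> id_nat_nats[OF v]])
  also have "\<dots> = on_nat D \<alpha> \<triangleleft> on_ftor D v"
    unfolding on_id_nat[OF small(2,3) v]
    by (rule whisker_right_eq_hcomp[OF on_nat[OF small(1,2) u u' \<alpha>] on_ftor[OF small(2,3) v]
        on_ftor[OF small(1,2) u]])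
  finally show ?thesis .
qed

lemma on_whisker_right:
  assumes small: "small_cat J" "small_cat K" "small_cat L"
    and u: "u \<in> functors J K" and v: "v \<in> functors K L" and \<beta>: "\<beta> \<in> nats v v'"
  shows "on_nat D (\<beta> \<triangleleft> u) = on_ftor D u \<triangleright> on_nat D \<beta>"
proof -
  note v' = nat_simps(3)[OF \<beta> v]
  have "on_nat D (\<beta> \<triangleleft> u) = on_nat D (id_nat u) \<star> on_nat D \<beta>"
    unfolding whisker_right_eq_hcomp[OF \<beta> u v, symmetric]
    by (rule on_hcomp[OF small u u v v' id_nat_nats[OF u] \<beta>])
  also have "\<dots> = on_ftor D u \<triangleright> on_nat D \<beta>"
    unfolding on_id_nat[OF small(1,2) u]
    by (rule whisker_left_eq_hcomp[OF on_nat[OF small(2,3) v v' \<beta>] on_ftor[OF small(2,3) v]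
        on_ftor[OF small(1,2) u]])
  finally show ?thesis .
qed

lemma on_inverse_ftors:
  assumes small: "small_cat J" "small_cat K" and inv: "inverse_ftors J K F G"
  shows "inverse_ftors (on_cat D K) (on_cat D J) (on_ftor D F) (on_ftor D G)"
proof -
  note FG = inverse_ftors_simps[OF inv]
  show ?thesis unfolding inverse_ftors_def
    using on_ftor[OF small FG(1)] on_ftor[OF small(2,1) FG(2)]
      on_comp_ftor[OF small small(1) FG(1,2)] on_comp_ftor[OF small(2,1,2) FG(2,1)]
      on_id_ftor[OF small(1)] on_id_ftor[OF small(2)] FG(3,4) by simp
qed

text \<open>
  This exhibits the map of (Der4) for \<open>u\<close> and \<open>k\<close> as a mate, so that \<open>mate_paste\<close> applies to it.
\<close>

lemma kan_square:
  assumes small: "small_cat J" "small_cat K" and u: "u \<in> functors J K" and k: "k \<in> Obj K"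
    and U: "adjunction U (on_ftor D u) \<eta> \<epsilon>"
    and P: "adjunction P (on_ftor D (to_one (over_cat u k))) \<eta>' \<epsilon>'"
  shows "mate_square (on_cat D J) (on_cat D K) (on_cat D (over_cat u k)) (on_cat D one_cat)
    U (on_ftor D u) \<eta> \<epsilon> P (on_ftor D (to_one (over_cat u k))) \<eta>' \<epsilon>'
    (on_ftor D (over_proj u k)) (on_ftor D (point K k)) (on_nat D (over_nat u k))"
proof -
  have W: "small_cat (over_cat u k)" by (rule over_small[OF small u])
  have cats: "category J" "category K" "category (over_cat u k)"
    using small W by (simp_all add: small_cat_def)
  note 1 = over_proj_functors[OF u, of k] to_one_functors[OF cats(3)] point_functors[OF cats(2) k]
  note 2 = on_ftor[OF small u] on_ftor[OF W small(1) 1(1)] on_ftor[OF W small_one_cat 1(2)]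
    on_ftor[OF small_one_cat small(2) 1(3)]
  show ?thesis
  proof
    show "U \<in> functors (on_cat D J) (on_cat D K)"
      using U functor_simps(1,2)[OF 2(1)] by (auto simp: adjunction_def functors_def)
    show "P \<in> functors (on_cat D (over_cat u k)) (on_cat D one_cat)"
      using P functor_simps(1,2)[OF 2(3)] by (auto simp: adjunction_def functors_def)
    show "on_nat D (over_nat u k) \<in> nats (on_ftor D (over_proj u k) \<circ>\<^sub>F on_ftor D u)
        (on_ftor D (to_one (over_cat u k)) \<circ>\<^sub>F on_ftor D (point K k))"
      using on_nat[OF W small(2) comp_ftor_functors[OF 1(1) u] comp_ftor_functors[OF 1(2,3)]
          over_nat_nats[OF u k]]
        on_comp_ftor[OF W small 1(1) u] on_comp_ftor[OF W small_one_cat small(2) 1(2,3)] by simp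
  qed (use 2 U P in auto)
qed

end

lemma shift_sel [simp]:
  "on_cat (shift D M) K = on_cat D (sprod M K)" "on_ftor (shift D M) u = on_ftor D (sprod_ftor M u)"
  "on_nat (shift D M) \<alpha> = on_nat D (sprod_nat M \<alpha>)"
  by (simp_all add: shift_def)

lemma (in prederivator) prederivator_shift:
  assumes sM: "small_cat M"
  shows "prederivator (shift D M)"
proof -
  have M: "category M" using sM by (simp add: small_cat_def)
  note sp = sprod_small[OF sM]
  note F = sprod_ftor_functors[OF M]
  show ?thesis
  proof (rule prederivator.intro, goal_cases)
    case 1 then show ?case by (simp add: on_cat sp)
  next
    case 2 then show ?case by (simp add: on_ftor sp F)
  next
    case (3 J K u v \<alpha>) then show ?case
      using on_nat[OF sp[OF 3(1)] sp[OF 3(2)] F[OF 3(3)] F[OF 3(4)] sprod_nat_nats[OF M 3(5,3)]] by simp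
  next
    case (4 J) then show ?case using sprod_ftor_id[OF M, of J]
        by (simp add: on_id_ftor sp small_cat_def[of J])
  next
    case (5 J K L u v) then show ?case
      using on_comp_ftor[OF sp[OF 5(1)] sp[OF 5(2)] sp[OF 5(3)] F[OF 5(4)] F[OF 5(5)]]
        sprod_ftor_comp[OF M 5(4,5)] by simp
  next
    case (6 J K u) then show ?case
      using on_id_nat[OF sp[OF 6(1)] sp[OF 6(2)] F[OF 6(3)]] sprod_nat_id[OF M 6(3)] by simp
  next
    case (7 J K u v w \<alpha> \<beta>) then show ?case
      using on_vcomp[OF sp[OF 7(1)] sp[OF 7(2)] F[OF 7(3)] F[OF 7(4)] F[OF 7(5)]
          sprod_nat_nats[OF M 7(6,3)] sprod_nat_nats[OF M 7(7,4)]]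
        sprod_nat_vcomp[OF M 7(3,6,7)] by simp
  next
    case (8 J K L u u' v v' \<alpha> \<beta>) then show ?case
      using on_hcomp[OF sp[OF 8(1)] sp[OF 8(2)] sp[OF 8(3)] F[OF 8(4)] F[OF 8(5)] F[OF 8(6)] F[OF 8(7)]
          sprod_nat_nats[OF M 8(8,4)] sprod_nat_nats[OF M 8(9,6)]]
        sprod_nat_hcomp[OF M 8(4,6,8,9)] by simp
  qed
qed

section \<open>Pointwise left Kan extensions in the shift\<close>

text \<open>
  The axioms on which the pasting argument rests. Isolating them makes the argument apply to
  the opposite of a derivator, and thereby to right Kan extensions.
\<close>

locale left_derivator = prederivator +
  assumes iso_pointwise: "\<lbrakk>small_cat J; f \<in> Arr (on_cat D J)\<rbrakk> \<Longrightarrow>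
      iso (on_cat D J) f \<longleftrightarrow>
      (\<forall>j \<in> Obj J. iso (on_cat D one_cat) (FArr (on_ftor D (point J j)) f))"
    and left_kan_exists: "\<lbrakk>small_cat J; small_cat K; u \<in> functors J K\<rbrakk> \<Longrightarrow>
      \<exists>U \<eta> \<epsilon>. adjunction U (on_ftor D u) \<eta> \<epsilon>"
    and left_kan_pointwise:
      "\<lbrakk>small_cat J; small_cat K; u \<in> functors J K; k \<in> Obj K;
        adjunction U (on_ftor D u) \<eta> \<epsilon>;
        adjunction P (on_ftor D (to_one (over_cat u k))) \<eta>' \<epsilon>'\<rbrakk> \<Longrightarrow>
      nat_iso (left_kan_map D u k U \<eta> P \<epsilon>')"

lemma left_kan_map_eq_left_mate:
  "left_kan_map D u k U \<eta> P \<epsilon> = left_mate (on_ftor D (over_proj u k)) (on_ftor D (point (Tgt u) k))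
    (on_nat D (over_nat u k)) U \<eta> P \<epsilon>"
  by (simp add: left_kan_map_def left_mate_def)

text \<open>
  Left half of (Der4) for the shift, by the pasting argument: \<open>\<beta>\<close> at \<open>(m, *)\<close> is invertible
  because its composite with the invertible \<open>\<gamma>\<close> is the map of (Der4) for \<open>id\<^sub>M \<times> u\<close> and
  \<open>(m, k)\<close>.
\<close>

lemma (in left_derivator) left_kan_map_shift_iso:
  assumes sM: "small_cat M" and small: "small_cat J" "small_cat K" and u: "u \<in> functors J K"
      and k: "k \<in> Obj K"
    and adjU: "adjunction U (on_ftor (shift D M) u) \<eta> \<epsilon>"
    and adjP: "adjunction P (on_ftor (shift D M) (to_one (over_cat u k))) \<eta>' \<epsilon>'"
  shows "nat_iso (left_kan_map (shift D M) u k U \<eta> P \<epsilon>')"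
proof -
  have M: "category M" and K: "category K" using sM small by (simp_all add: small_cat_def)
  define W where "W = over_cat u k"
  have sW: "small_cat W" unfolding W_def by (rule over_small[OF small u])
  have W: "category W" using sW by (simp add: small_cat_def)
  note sp = sprod_small[OF sM]
  define q where "q = sprod_ftor M (to_one W)"
  define pr where "pr = sprod_ftor M (over_proj u k)"
  define \<kappa> where "\<kappa> = sprod_ftor M (point K k)"
  define \<alpha> where "\<alpha> = sprod_nat M (over_nat u k)"
  define S where "S = on_ftor D pr"
  define T where "T = on_ftor D \<kappa>"
  define \<beta> where "\<beta> = left_kan_map (shift D M) u k U \<eta> P \<epsilon>'"
  have \<beta>_mate: "\<beta> = left_mate S T (on_nat D \<alpha>) U \<eta> P \<epsilon>'"
    by (simp add: \<beta>_def left_kan_map_eq_left_mate S_def T_def pr_def \<kappa>_def \<alpha>_def functor_simps(2)[OF u])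
  interpret sh: prederivator "shift D M" by (rule prederivator_shift[OF sM])
  interpret sq: mate_square "on_cat D (sprod M J)" "on_cat D (sprod M K)" "on_cat D (sprod M W)"
    "on_cat D (sprod M one_cat)" U "on_ftor D (sprod_ftor M u)" \<eta> \<epsilon> P "on_ftor D q" \<eta>' \<epsilon>' S T
        "on_nat D \<alpha>"
    using sh.kan_square[OF small u k adjU adjP]
    by (simp add: q_def S_def T_def pr_def \<kappa>_def \<alpha>_def W_def)
  have Mu: "sprod_ftor M u \<in> functors (sprod M J) (sprod M K)" by (rule sprod_ftor_functors[OF M u])
  have q: "q \<in> functors (sprod M W) (sprod M one_cat)"
    unfolding q_def by (rule sprod_ftor_functors[OF M to_one_functors[OF W]])
  have pr: "pr \<in> functors (sprod M W) (sprod M J)"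
    unfolding pr_def W_def by (rule sprod_ftor_functors[OF M over_proj_functors[OF u]])
  have \<kappa>: "\<kappa> \<in> functors (sprod M one_cat) (sprod M K)"
    unfolding \<kappa>_def by (rule sprod_ftor_functors[OF M point_functors[OF K k]])
  have \<alpha>: "\<alpha> \<in> nats (sprod_ftor M u \<circ>\<^sub>F pr) (\<kappa> \<circ>\<^sub>F q)"
    using sprod_nat_nats[OF M over_nat_nats[OF u k] comp_ftor_functors[OF over_proj_functors[OF u] u]]
    unfolding sprod_ftor_comp[OF M over_proj_functors[OF u] u]
      sprod_ftor_comp[OF M to_one_functors[OF over_category[OF u]] point_functors[OF K k]]
      pr_def \<kappa>_def q_def W_def \<alpha>_def .
  note sMJ = sp[OF small(1)] and sMK = sp[OF small(2)] and sMW = sp[OF sW]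
      and sM1 = sp[OF small_one_cat]
  have "iso (on_cat D (sprod M one_cat)) (Cmp \<beta> X)" if X: "X \<in> Obj (on_cat D (sprod M J))" for X
  proof -
    have "iso (on_cat D one_cat) (FArr (on_ftor D (point (sprod M one_cat) (pair m tagL))) (Cmp \<beta> X))"
      if m: "m \<in> Obj M" for m
    proof -
      define V where "V = over_cat q (pair m tagL)"
      define S\<^sub>2 where "S\<^sub>2 = on_ftor D (over_proj q (pair m tagL))"
      define T\<^sub>2 where "T\<^sub>2 = on_ftor D (point (sprod M one_cat) (pair m tagL))"
      define \<alpha>\<^sub>2 where "\<alpha>\<^sub>2 = over_nat q (pair m tagL)"
      have m1: "pair m tagL \<in> Obj (sprod M one_cat)" using m by simp
      have sV: "small_cat V" unfolding V_def by (rule over_small[OF sMW sM1 q])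
      have V: "category V" using sV by (simp add: small_cat_def)
      obtain P\<^sub>2 \<eta>\<^sub>2 \<epsilon>\<^sub>2 where adjP2: "adjunction P\<^sub>2 (on_ftor D (to_one V)) \<eta>\<^sub>2 \<epsilon>\<^sub>2"
        using left_kan_exists[OF sV small_one_cat to_one_functors[OF V]] by blast
      define \<gamma> where "\<gamma> = left_kan_map D q (pair m tagL) P \<eta>' P\<^sub>2 \<epsilon>\<^sub>2"
      have \<gamma>_mate: "\<gamma> = left_mate S\<^sub>2 T\<^sub>2 (on_nat D \<alpha>\<^sub>2) P \<eta>' P\<^sub>2 \<epsilon>\<^sub>2"
        by (simp add: \<gamma>_def left_kan_map_eq_left_mate S\<^sub>2_def T\<^sub>2_def \<alpha>\<^sub>2_def functor_simps(2)[OF q])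
      have sq2: "mate_square (on_cat D (sprod M W)) (on_cat D (sprod M one_cat)) (on_cat D V)
          (on_cat D one_cat)
         P (on_ftor D q) \<eta>' \<epsilon>' P\<^sub>2 (on_ftor D (to_one V)) \<eta>\<^sub>2 \<epsilon>\<^sub>2 S\<^sub>2 T\<^sub>2 (on_nat D \<alpha>\<^sub>2)"
        using kan_square[OF sMW sM1 q m1 sq.adj_P adjP2[unfolded V_def]]
        by (simp add: V_def S\<^sub>2_def T\<^sub>2_def \<alpha>\<^sub>2_def)
      then interpret sq2: mate_square "on_cat D (sprod M W)" "on_cat D (sprod M one_cat)" "on_cat D
          V" "on_cat D one_cat"
         P "on_ftor D q" \<eta>' \<epsilon>' P\<^sub>2 "on_ftor D (to_one V)" \<eta>\<^sub>2 \<epsilon>\<^sub>2 S\<^sub>2 T\<^sub>2 "on_nat D \<alpha>\<^sub>2" .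
      have SX: "FObj S X \<in> Obj (on_cat D (sprod M W))" using X by (simp add: functor_simps(5)[OF sq.S])
      have "nat_iso \<gamma>" unfolding \<gamma>_def
        by (rule left_kan_pointwise[OF sMW sM1 q m1 sq.adj_P adjP2[unfolded V_def]])
      then have \<gamma>_iso: "iso (on_cat D one_cat) (Cmp \<gamma> (FObj S X))"
        using nat_isoD[OF _ sq2.mate_nats sq2.composites(3) SX] by (simp add: \<gamma>_mate)

      \<comment> \<open>The comma square of \<open>id\<^sub>M \<times> u\<close> and \<open>(m, k)\<close>, with the adjoint transported from \<open>V\<close> along \<open>\<theta>\<close>.\<close>
      define V' where "V' = over_cat (sprod_ftor M u) (pair m k)"
      have mk: "pair m k \<in> Obj (sprod M K)" using m k by simp
      have sV': "small_cat V'" unfolding V'_def by (rule over_small[OF sMJ sMK Mu])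
      define \<theta> where "\<theta> = over_shuffle M u k m"
      obtain \<theta>' where inv: "inverse_ftors V V' \<theta> \<theta>'"
        using over_shuffle_inverse[OF M u, where k = k and m = m]
            by (auto simp: V_def q_def W_def V'_def \<theta>_def)
      note \<theta> = inverse_ftors_simps(1)[OF inv] and \<theta>' = inverse_ftors_simps(2)[OF inv]
      have D\<theta>: "inverse_ftors (on_cat D V') (on_cat D V) (on_ftor D \<theta>) (on_ftor D \<theta>')"
        by (rule on_inverse_ftors[OF sV sV' inv])
      note s\<theta> = functor_simps[OF inverse_ftors_simps(1)[OF D\<theta>]]
      have "adjunction (P\<^sub>2 \<circ>\<^sub>F on_ftor D \<theta>) (on_ftor D \<theta>' \<circ>\<^sub>F on_ftor D (to_one V))
          (on_ftor D \<theta>' \<triangleright> (\<eta>\<^sub>2 \<triangleleft> on_ftor D \<theta>)) \<epsilon>\<^sub>2"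
        by (rule adjunction_comp_inverse_ftors[OF adjP2 sq2.P D\<theta>])
      then have adjP3: "adjunction (P\<^sub>2 \<circ>\<^sub>F on_ftor D \<theta>) (on_ftor D (to_one V'))
          (on_ftor D \<theta>' \<triangleright> (\<eta>\<^sub>2 \<triangleleft> on_ftor D \<theta>)) \<epsilon>\<^sub>2"
        using on_comp_ftor[OF sV' sV small_one_cat \<theta>' to_one_functors[OF V]] comp_to_one[OF \<theta>'] by simp
      interpret sq3: mate_square "on_cat D (sprod M J)" "on_cat D (sprod M K)" "on_cat D V'" "on_cat
          D one_cat"
        U "on_ftor D (sprod_ftor M u)" \<eta> \<epsilon> "P\<^sub>2 \<circ>\<^sub>F on_ftor D \<theta>" "on_ftor D (to_one V')"
        "on_ftor D \<theta>' \<triangleright> (\<eta>\<^sub>2 \<triangleleft> on_ftor D \<theta>)" \<epsilon>\<^sub>2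
        "on_ftor D (over_proj (sprod_ftor M u) (pair m k))" "on_ftor D (point (sprod M K) (pair m k))"
        "on_nat D (over_nat (sprod_ftor M u) (pair m k))"
        using kan_square[OF sMJ sMK Mu mk sq.adj_U adjP3[unfolded V'_def]] by (simp add: V'_def)
      have "nat_iso sq3.mate"
        using left_kan_pointwise[OF sMJ sMK Mu mk sq.adj_U adjP3[unfolded V'_def]]
        by (simp add: left_kan_map_eq_left_mate functor_simps(2)[OF u])
      then have iso3: "iso (on_cat D one_cat) (Cmp sq3.mate X)"
        by (rule nat_isoD[OF _ sq3.mate_nats sq3.composites(3) X])

      define Z where "Z = FObj U X"
      have Z: "Z \<in> Obj (on_cat D (sprod M K))" using X by (simp add: Z_def functor_simps(5)[OF sq.U])
      have \<eta>X: "Cmp \<eta> X \<in> Arr (on_cat D (sprod M J))" using X by (simp add: sq.square_simps)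
      \<comment> \<open>The next three facts identify the data of the third square, reindexed along \<open>\<theta>\<close>, with those
          of the pasted square.\<close>
      have point: "FObj (on_ftor D (point (sprod M K) (pair m k))) Z = FObj T\<^sub>2 (FObj T Z)"
      proof -
        have "\<kappa> \<circ>\<^sub>F point (sprod M one_cat) (pair m tagL) = point (sprod M K) (pair m k)"
          using comp_point[OF \<kappa>, of "pair m tagL"] m by (simp add: \<kappa>_def)
        then have "on_ftor D (point (sprod M K) (pair m k)) = T\<^sub>2 \<circ>\<^sub>F T"
          using on_comp_ftor[OF small_one_cat sM1 sMK point_functors[OF sprod_category[OF M
              one_category] m1] \<kappa>]
          by (simp add: T\<^sub>2_def T_def)
        then show ?thesis using Z by (simp add: functor_simps(1)[OF sq.T])
      qed
      have nat: "FArr (on_ftor D \<theta>) (Cmp (on_nat D (over_nat (sprod_ftor M u) (pair m k))) Z) =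
        Comp (on_cat D V) (Cmp (on_nat D \<alpha>\<^sub>2) (FObj T Z)) (FArr S\<^sub>2 (Cmp (on_nat D \<alpha>) Z))"
      proof -
        note proj = over_proj_functors[OF Mu, of "pair m k", folded V'_def]
        note pr2 = over_proj_functors[OF q, of "pair m tagL", folded V_def]
        note pt = point_functors[OF sprod_category[OF M] m1]
        note one = one_category
        note \<alpha>2 = over_nat_nats[OF q m1, folded V_def \<alpha>\<^sub>2_def]
        note \<tau> = whisker_right_nats[OF \<alpha> pr2 comp_ftor_functors[OF pr Mu]]
        note \<sigma> = whisker_left_nats[OF \<alpha>2 comp_ftor_functors[OF pr2 q] \<kappa>]
        have "on_ftor D \<theta> \<triangleright> on_nat D (over_nat (sprod_ftor M u) (pair m k)) =
            on_nat D (over_nat (sprod_ftor M u) (pair m k) \<triangleleft> \<theta>)"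
          by (rule on_whisker_right[OF sV sV' sMK \<theta> comp_ftor_functors[OF proj Mu]
                over_nat_nats[OF Mu mk, folded V'_def], symmetric])
        also have "\<dots> = on_nat D ((\<kappa> \<triangleright> \<alpha>\<^sub>2) \<bullet> (\<alpha> \<triangleleft> over_proj q (pair m tagL)))"
          using over_nat_shuffle[OF M u k m] by (simp add: \<theta>_def \<kappa>_def \<alpha>\<^sub>2_def \<alpha>_def q_def W_def)
        also have "\<dots> = on_nat D (\<kappa> \<triangleright> \<alpha>\<^sub>2) \<bullet> on_nat D (\<alpha> \<triangleleft> over_proj q (pair m tagL))"
          by (rule on_vcomp[OF sV sMK comp_ftor_functors[OF pr2 comp_ftor_functors[OF pr Mu]]
              comp_ftor_functors[OF pr2 comp_ftor_functors[OF q \<kappa>]]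
              comp_ftor_functors[OF comp_ftor_functors[OF to_one_functors[OF V] pt[OF one]] \<kappa>]
              \<tau> \<sigma>[folded comp_ftor_assoc[OF pr2 q \<kappa>]]])
        also have "on_nat D (\<kappa> \<triangleright> \<alpha>\<^sub>2) = on_nat D \<alpha>\<^sub>2 \<triangleleft> T"
          unfolding T_def by (rule on_whisker_left[OF sV sM1 sMK comp_ftor_functors[OF pr2 q] \<kappa> \<alpha>2])
        also have "on_nat D (\<alpha> \<triangleleft> over_proj q (pair m tagL)) = S\<^sub>2 \<triangleright> on_nat D \<alpha>"
          unfolding S\<^sub>2_def by (rule on_whisker_right[OF sV sMW sMK pr2 comp_ftor_functors[OF pr Mu] \<alpha>])
        finally have e: "on_ftor D \<theta> \<triangleright> on_nat D (over_nat (sprod_ftor M u) (pair m k)) =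
          (on_nat D \<alpha>\<^sub>2 \<triangleleft> T) \<bullet> (S\<^sub>2 \<triangleright> on_nat D \<alpha>)" .
        show ?thesis using arg_cong[OF e, of "\<lambda>\<tau>. Cmp \<tau> Z"] Z
          by (simp add: nat_simps(1,2)[OF sq3.\<alpha> sq3.composites(1)] nat_simps(1,2)[OF sq.\<alpha>
              sq.composites(1)]
            functor_simps(1,2)[OF sq.T] functor_simps(1,2)[OF sq2.S] sq.square_simps
                sq2.square_simps sq3.square_simps)
      qed
      have proj: "FArr (on_ftor D \<theta>) (FArr (on_ftor D (over_proj (sprod_ftor M u) (pair m k))) (Cmp
          \<eta> X)) =
        FArr S\<^sub>2 (FArr S (Cmp \<eta> X))"
      proof -
        have "on_ftor D \<theta> \<circ>\<^sub>F on_ftor D (over_proj (sprod_ftor M u) (pair m k)) = S\<^sub>2 \<circ>\<^sub>F S"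
          using over_proj_shuffle[OF M u, where k = k and m = m]
            on_comp_ftor[OF sV sV' sMJ \<theta> over_proj_functors[OF Mu, of "pair m k", folded V'_def]]
            on_comp_ftor[OF sV sMW sMJ over_proj_functors[OF q, of "pair m tagL", folded V_def] pr]
          by (simp add: S\<^sub>2_def S_def pr_def q_def W_def \<theta>_def)
        from arg_cong[OF this, of "\<lambda>F. FArr F (Cmp \<eta> X)"] show ?thesis
          using \<eta>X by (simp add: functor_simps(1)[OF sq.S] functor_simps(1)[OF sq3.S])
      qed
      have "Cmp sq3.mate X = Comp (on_cat D one_cat) (FArr T\<^sub>2 (Cmp \<beta> X)) (Cmp \<gamma> (FObj S X))"
      proof -
        note s3 = sq3.square_simps and c3 = sq3.square_cats
        define a where "a = Cmp (on_nat D (over_nat (sprod_ftor M u) (pair m k))) Z"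
        define b where "b = FArr (on_ftor D (over_proj (sprod_ftor M u) (pair m k))) (Cmp \<eta> X)"
        have ab: "a \<in> Arr (on_cat D V')" "b \<in> Arr (on_cat D V')" "Dom (on_cat D V') a =
            Cod (on_cat D V') b"
          using X by (simp_all add: a_def b_def Z_def s3)
        have "Cmp sq3.mate X = Comp (on_cat D one_cat) (Cmp \<epsilon>\<^sub>2 (FObj T\<^sub>2 (FObj T Z)))
          (FArr P\<^sub>2 (FArr (on_ftor D \<theta>) (Comp (on_cat D V') a b)))"
          using ab c3 s\<theta>(1) by (simp add: sq3.mate_Cmp[OF X] point flip: Z_def a_def b_def)
        also have "FArr (on_ftor D \<theta>) (Comp (on_cat D V') a b) =
            Comp (on_cat D V) (FArr (on_ftor D \<theta>) a) (FArr (on_ftor D \<theta>) b)"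
          using ab by (simp add: s\<theta>)
        also have "\<dots> = Comp (on_cat D V) (Comp (on_cat D V) (Cmp (on_nat D \<alpha>\<^sub>2) (FObj T Z)) (FArr S\<^sub>2
            (Cmp (on_nat D \<alpha>) Z)))
            (FArr S\<^sub>2 (FArr S (Cmp \<eta> X)))"
          unfolding a_def b_def nat proj ..
        also have "\<dots> = Comp (on_cat D V) (Cmp (on_nat D \<alpha>\<^sub>2) (FObj T Z)) (Comp (on_cat D V) (FArr S\<^sub>2
            (Cmp (on_nat D \<alpha>) Z))
            (FArr S\<^sub>2 (FArr S (Cmp \<eta> X))))"
          using X by (simp add: sq.square_simps sq2.square_simps Z_def sq2.square_cats)
        finally show ?thesis
          using sq.mate_paste[OF sq2 X] by (simp add: \<beta>_mate \<gamma>_mate Z_def)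
      qed
      with iso3 have comp_iso: "iso (on_cat D one_cat) (Comp (on_cat D one_cat) (FArr T\<^sub>2 (Cmp \<beta> X))
          (Cmp \<gamma> (FObj S X)))"
        by simp
      show "iso (on_cat D one_cat) (FArr T\<^sub>2 (Cmp \<beta> X))"
      proof (rule iso_cancel_right[OF on_cat[OF small_one_cat] _ _ \<gamma>_iso comp_iso])
        note nb = nat_simps[OF sq.mate_nats sq.composites(3), folded \<beta>_mate]
          and nc = nat_simps[OF sq2.mate_nats sq2.composites(3), folded \<gamma>_mate]
        show "FArr T\<^sub>2 (Cmp \<beta> X) \<in> Arr (on_cat D one_cat)"
          using X nb by (simp add: functor_simps[OF sq2.T])
        show "Dom (on_cat D one_cat) (FArr T\<^sub>2 (Cmp \<beta> X)) = Cod (on_cat D one_cat) (Cmp \<gamma> (FObj S X))"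
          using X SX nb nc by (simp add: functor_simps[OF sq2.T] sq.square_simps)
      qed
    qed
    moreover have "Cmp \<beta> X \<in> Arr (on_cat D (sprod M one_cat))"
      using X nat_simps[OF sq.mate_nats sq.composites(3), folded \<beta>_mate] by simp
    ultimately show ?thesis
      using iso_pointwise[OF sM1] by (auto simp: in_sprod_iff)
  qed
  then have "nat_iso \<beta>"
    using nat_isoI[OF sq.mate_nats sq.composites(3)] by (simp add: \<beta>_mate)
  then show ?thesis by (simp add: \<beta>_def)
qed

section \<open>Duality\<close>

text \<open>
  Functors and transformations keep their underlying maps under dualisation, so that taking
  the opposite twice is the identity on the nose.
\<close>

definition op_cat :: "('o, 'a) cat \<Rightarrow> ('o, 'a) cat" where
  "op_cat C = \<lparr>Obj = Obj C, Arr = Arr C, Dom = Cod C, Cod = Dom C, Id = Id C, Comp =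
      (\<lambda>g f. Comp C f g)\<rparr>"

definition op_ftor :: "('o, 'a, 'p, 'b) ftor \<Rightarrow> ('o, 'a, 'p, 'b) ftor" where
  "op_ftor F = \<lparr>Src = op_cat (Src F), Tgt = op_cat (Tgt F), FObj = FObj F, FArr = FArr F\<rparr>"

definition op_nat :: "('o, 'a, 'p, 'b) ntrans \<Rightarrow> ('o, 'a, 'p, 'b) ntrans" where
  "op_nat \<tau> = \<lparr>NSrc = op_ftor (NTgt \<tau>), NTgt = op_ftor (NSrc \<tau>), Cmp = Cmp \<tau>\<rparr>"

lemma op_sel [simp]:
  "Obj (op_cat C) = Obj C" "Arr (op_cat C) = Arr C" "Dom (op_cat C) = Cod C" "Cod (op_cat C) = Dom C"
  "Id (op_cat C) = Id C" "Comp (op_cat C) g f = Comp C f g"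
  "Src (op_ftor F) = op_cat (Src F)" "Tgt (op_ftor F) = op_cat (Tgt F)"
  "FObj (op_ftor F) = FObj F" "FArr (op_ftor F) = FArr F"
  "NSrc (op_nat \<tau>) = op_ftor (NTgt \<tau>)" "NTgt (op_nat \<tau>) = op_ftor (NSrc \<tau>)" "Cmp (op_nat \<tau>) = Cmp \<tau>"
  by (simp_all add: op_cat_def op_ftor_def op_nat_def)

lemma op_op [simp]: "op_cat (op_cat C) = C" "op_ftor (op_ftor F) = F" "op_nat (op_nat \<tau>) = \<tau>"
  by (simp_all add: op_cat_def op_ftor_def op_nat_def)

lemma op_cat_eq [simp]: "op_cat C = op_cat C' \<longleftrightarrow> C = C'"
  by (metis op_op(1))

lemma hom_op [simp]: "hom (op_cat C) x y = hom C y x"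
  by (auto simp: hom_def)

lemma category_op:
  assumes "category C" shows "category (op_cat C)"
proof -
  interpret category C by fact
  show ?thesis
    using Dom_closed Cod_closed Id_ext Comp_ext by (intro categoryI) (auto simp: PiE_iff)
qed

lemma category_op_iff [simp]: "category (op_cat C) \<longleftrightarrow> category C"
  using category_op[of C] category_op[of "op_cat C"] by auto

lemma op_functors_iff [simp]: "op_ftor F \<in> functors (op_cat C) (op_cat D) \<longleftrightarrow> F \<in> functors C D"
  by (auto simp: functors_def)

lemma op_mk_ftor: "op_ftor (mk_ftor C D fo fa) = mk_ftor (op_cat C) (op_cat D) fo fa"
  by (simp add: op_ftor_def mk_ftor_def)

lemma op_id_ftor: "op_ftor (id_ftor C) = id_ftor (op_cat C)"
  by (simp add: id_ftor_def op_mk_ftor)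

lemma op_comp_ftor: "op_ftor (G \<circ>\<^sub>F F) = op_ftor G \<circ>\<^sub>F op_ftor F"
  by (simp add: comp_ftor_def op_mk_ftor)

lemma op_mk_nat: "Src F = Src G \<Longrightarrow> op_nat (mk_nat F G c) = mk_nat (op_ftor G) (op_ftor F) c"
  by (simp add: op_nat_def mk_nat_def)

lemma op_nats:
  assumes "\<tau> \<in> nats F G" shows "op_nat \<tau> \<in> nats (op_ftor G) (op_ftor F)"
proof -
  note s = functor_simps(1,2)[OF nats_sel(3)[OF assms]] functor_simps(1,2)[OF nats_sel(4)[OF assms]]
  show ?thesis using assms s by (auto simp: nats_def)
qed

lemma op_nats_iff [simp]: "op_nat \<tau> \<in> nats (op_ftor G) (op_ftor F) \<longleftrightarrow> \<tau> \<in> nats F G"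
  using op_nats[of \<tau> F G] op_nats[of "op_nat \<tau>" "op_ftor G" "op_ftor F"] by auto

lemma op_id_nat: "op_nat (id_nat F) = id_nat (op_ftor F)"
  by (simp add: id_nat_def op_mk_nat)

lemma op_vcomp:
  assumes "\<sigma> \<in> nats F G" "\<tau> \<in> nats G H"
  shows "op_nat (\<tau> \<bullet> \<sigma>) = op_nat \<sigma> \<bullet> op_nat \<tau>"
proof -
  note s = functor_simps(1,2)[OF nats_sel(4)[OF assms(1)]] functor_simps(1,2)[OF nats_sel(4)[OF
      assms(2)]]
    nats_sel(1,2)[OF assms(1)] nats_sel(1,2)[OF assms(2)]
  show ?thesis using s by (simp add: vcomp_def op_mk_nat)
qed

lemma op_hcomp:
  assumes "\<sigma> \<in> nats F F'" "F \<in> functors C D" "\<tau> \<in> nats G G'" "G \<in> functors D E"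
  shows "op_nat (\<tau> \<star> \<sigma>) = op_nat \<tau> \<star> op_nat \<sigma>"
proof (rule nat_eqI)
  note F' = nat_simps(3)[OF assms(1,2)] and G' = nat_simps(3)[OF assms(3,4)]
  show "op_nat (\<tau> \<star> \<sigma>) \<in> nats (op_ftor (G' \<circ>\<^sub>F F')) (op_ftor (G \<circ>\<^sub>F F))"
    by (rule op_nats[OF hcomp_nats[OF assms]])
  show "op_nat \<tau> \<star> op_nat \<sigma> \<in> nats (op_ftor (G' \<circ>\<^sub>F F')) (op_ftor (G \<circ>\<^sub>F F))"
    unfolding op_comp_ftor
    by (rule hcomp_nats[of _ _ _ "op_cat C" "op_cat D" _ _ _ "op_cat E"]) (simp_all add: assms F' G')
  \<comment> \<open>The definition of horizontal composition prefers one of two composites; naturality of \<open>\<tau>\<close>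
      identifies them.\<close>
  show "Cmp (op_nat (\<tau> \<star> \<sigma>)) x = Cmp (op_nat \<tau> \<star> op_nat \<sigma>) x"
      if "x \<in> Obj (Src (op_ftor (G' \<circ>\<^sub>F F')))" for x
    using that naturality[OF assms(3,4), of "Cmp \<sigma> x"]
    by (simp add: functor_simps[OF F'] functor_simps[OF G'] functor_simps[OF assms(2)]
        functor_simps[OF assms(4)]
        nat_simps[OF assms(1,2)] nat_simps[OF assms(3,4)])
qed

lemma op_whisker_left:
  assumes "\<sigma> \<in> nats F F'"
  shows "op_nat (G \<triangleright> \<sigma>) = op_ftor G \<triangleright> op_nat \<sigma>"
  using functor_simps(1)[OF nats_sel(4)[OF assms]] nats_sel(1,2)[OF assms]
      by (simp add: whisker_left_def op_mk_nat op_comp_ftor)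

lemma op_whisker_right: "op_nat (\<tau> \<triangleleft> F) = op_nat \<tau> \<triangleleft> op_ftor F"
  by (simp add: whisker_right_def op_mk_nat op_comp_ftor)

lemma iso_op [simp]: "iso (op_cat C) f \<longleftrightarrow> iso C f"
  by (auto simp: iso_def)

lemma nat_iso_op:
  assumes "nat_iso \<tau>"
  shows "nat_iso (op_nat \<tau>)"
proof -
  note s = functor_simps(1,2)[OF nats_sel(4)[of \<tau> "NSrc \<tau>" "NTgt \<tau>"]]
  show ?thesis using assms s unfolding nat_iso_def by simp
qed

lemma op_adjunction:
  assumes "adjunction L R \<eta> \<epsilon>"
  shows "adjunction (op_ftor R) (op_ftor L) (op_nat \<epsilon>) (op_nat \<eta>)"
proof -
  define C D where "C = Src L" and "D = Tgt L"
  have L: "L \<in> functors C D" using assms by (simp add: adjunction_def C_def D_def)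
  note a = adjunction_triangles[OF assms L]
  show ?thesis
  proof (rule adjunctionI[of _ "op_cat D" "op_cat C"])
    show "op_nat \<epsilon> \<in> nats (id_ftor (op_cat D)) (op_ftor L \<circ>\<^sub>F op_ftor R)"
      using op_nats[OF a(3)] by (simp add: op_id_ftor op_comp_ftor)
    show "op_nat \<eta> \<in> nats (op_ftor R \<circ>\<^sub>F op_ftor L) (id_ftor (op_cat C))"
      using op_nats[OF a(2)] by (simp add: op_id_ftor op_comp_ftor)
  qed (use L a in auto)
qed

lemma op_mk_cat:
  "op_cat (mk_cat Ob Ar d c i m) = mk_cat Ob Ar c d i (\<lambda>g f. m f g)"
  by (auto simp: op_cat_def mk_cat_def fun_eq_iff)

lemma small_cat_op [simp]: "small_cat (op_cat C) \<longleftrightarrow> small_cat C"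
  by (simp add: small_cat_def)

lemma op_one_cat [simp]: "op_cat one_cat = one_cat"
  by (auto simp: one_cat_def op_mk_cat mk_cat_def fun_eq_iff)

lemma op_to_one: "op_ftor (to_one J) = to_one (op_cat J)"
  by (simp add: to_one_def op_mk_ftor)

lemma op_point: "op_ftor (point K k) = point (op_cat K) k"
  by (simp add: point_def op_mk_ftor)

lemma op_sprod: "op_cat (sprod M K) = sprod (op_cat M) (op_cat K)"
  by (simp add: sprod_def op_mk_cat)

lemma op_sprod_ftor: "op_ftor (sprod_ftor M u) = sprod_ftor (op_cat M) (op_ftor u)"
  by (simp add: sprod_ftor_def op_mk_ftor op_sprod)

lemma op_sprod_nat:
  assumes "Src (NSrc \<alpha>) = Src (NTgt \<alpha>)"
  shows "op_nat (sprod_nat M \<alpha>) = sprod_nat (op_cat M) (op_nat \<alpha>)"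
  using assms by (simp add: sprod_nat_def op_mk_nat op_sprod_ftor)

text \<open>
  An equality rather than an isomorphism: an arrow \<open>h\<close> of \<open>J\<^bsub>k/\<^esub>\<close> is coded with the structure
  map at its domain, which is the codomain of \<open>h\<close> in the opposite category.
\<close>

lemma op_under_cat: "op_cat (under_cat u k) = over_cat (op_ftor u) k"
  by (simp add: under_cat_def over_cat_def Let_def op_mk_cat)

lemma op_over_cat: "op_cat (over_cat u k) = under_cat (op_ftor u) k"
  using op_under_cat[of "op_ftor u" k] by (metis op_op)

lemma op_under_proj: "op_ftor (under_proj u k) = over_proj (op_ftor u) k"
  by (simp add: under_proj_def over_proj_def op_mk_ftor op_under_cat)

lemma op_over_proj: "op_ftor (over_proj u k) = under_proj (op_ftor u) k"
  using op_under_proj[of "op_ftor u" k] by (metis op_op(2))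

lemma under_proj_Src [simp]: "Src (under_proj u k) = under_cat u k"
  by (simp add: under_proj_def)

lemma op_under_nat: "op_nat (under_nat u k) = over_nat (op_ftor u) k"
  by (simp add: under_nat_def over_nat_def op_mk_nat op_comp_ftor op_under_proj op_point op_to_one
      op_under_cat)

lemma op_over_nat: "op_nat (over_nat u k) = under_nat (op_ftor u) k"
  using op_under_nat[of "op_ftor u" k] by (metis op_op(2,3))

definition op_diagram :: "('u::universe, 'o, 'a) diagram_functor \<Rightarrow> ('u, 'o, 'a) diagram_functor" where
  "op_diagram D = \<lparr>on_cat = (\<lambda>J. op_cat (on_cat D (op_cat J))),
     on_ftor = (\<lambda>u. op_ftor (on_ftor D (op_ftor u))),
     on_nat = (\<lambda>\<alpha>. op_nat (on_nat D (op_nat \<alpha>)))\<rparr>"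

lemma op_diagram_sel [simp]:
  "on_cat (op_diagram D) J = op_cat (on_cat D (op_cat J))"
  "on_ftor (op_diagram D) u = op_ftor (on_ftor D (op_ftor u))"
  "on_nat (op_diagram D) \<alpha> = op_nat (on_nat D (op_nat \<alpha>))"
  by (simp_all add: op_diagram_def)

lemma (in prederivator) prederivator_op: "prederivator (op_diagram D)"
proof (rule prederivator.intro, goal_cases)
  case 1 then show ?case by (simp add: on_cat)
next
  case 2 then show ?case by (simp add: on_ftor)
next
  case (3 J K u v \<alpha>)
  then show ?case using on_nat[of "op_cat J" "op_cat K" "op_ftor v" "op_ftor u" "op_nat \<alpha>"] by simp
next
  case 4 then show ?case by (simp add: op_id_ftor on_id_ftor)
next
  case (5 J K L u v)
  then show ?case using on_comp_ftor[of "op_cat J" "op_cat K" "op_cat L" "op_ftor u" "op_ftor v"]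
    by (simp add: op_comp_ftor)
next
  case (6 J K u)
  then show ?case using on_id_nat[of "op_cat J" "op_cat K" "op_ftor u"]
    by (simp add: op_id_nat)
next
  case (7 J K u v w \<alpha> \<beta>)
  have "on_nat D (op_nat \<alpha> \<bullet> op_nat \<beta>) = on_nat D (op_nat \<alpha>) \<bullet> on_nat D (op_nat \<beta>)"
    using 7 by (intro on_vcomp[of "op_cat J" "op_cat K" "op_ftor w" "op_ftor v" "op_ftor u"]) simp_all
  moreover have "on_nat D (op_nat \<beta>) \<in> nats (on_ftor D (op_ftor w)) (on_ftor D (op_ftor v))"
    "on_nat D (op_nat \<alpha>) \<in> nats (on_ftor D (op_ftor v)) (on_ftor D (op_ftor u))"
    using 7 by (auto intro!: on_nat[of "op_cat J" "op_cat K"])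
  ultimately show ?case using op_vcomp 7 by (simp add: op_vcomp[OF 7(6,7)])
next
  case (8 J K L u u' v v' \<alpha> \<beta>)
  have e: "on_nat D (op_nat \<beta> \<star> op_nat \<alpha>) = on_nat D (op_nat \<alpha>) \<star> on_nat D (op_nat \<beta>)"
    using 8 by (intro on_hcomp[of "op_cat J" "op_cat K" "op_cat L" "op_ftor u'" "op_ftor u" "op_ftor
        v'" "op_ftor v"]) simp_all
  have "op_nat (on_nat D (op_nat \<alpha>) \<star> on_nat D (op_nat \<beta>)) =
      op_nat (on_nat D (op_nat \<alpha>)) \<star> op_nat (on_nat D (op_nat \<beta>))"
    using 8 by (intro op_hcomp[of _ "on_ftor D (op_ftor v')" "on_ftor D (op_ftor v)" "on_cat D
        (op_cat L)"
          "on_cat D (op_cat K)" _ "on_ftor D (op_ftor u')" "on_ftor D (op_ftor u)" "on_cat D (op_cat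
              J)"]
          on_nat[of "op_cat J" "op_cat K"] on_nat[of "op_cat K" "op_cat L"] on_ftor) simp_all
  then show ?case by (simp add: op_hcomp[OF 8(8,4,9,6)] e)
qed

text \<open>
  Dualisation reverses the order of the three factors and exchanges units with counits; the
  bracketing is repaired by associativity, for which the factors have to be well-typed.
\<close>

lemma (in prederivator) right_kan_map_dual:
  assumes small: "small_cat J" "small_cat K" and u: "u \<in> functors J K" and k: "k \<in> Obj K"
    and U: "adjunction (on_ftor D u) U \<eta> \<epsilon>"
    and P: "adjunction (on_ftor D (to_one (under_cat u k))) P \<eta>' \<epsilon>'"
  shows "right_kan_map D u k U \<epsilon> P \<eta>' =
    op_nat (left_kan_map (op_diagram D) (op_ftor u) k (op_ftor U) (op_nat \<epsilon>) (op_ftor P) (op_nat \<eta>'))"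
proof -
  interpret op: prederivator "op_diagram D" by (rule prederivator_op)
  have U': "adjunction (op_ftor U) (on_ftor (op_diagram D) (op_ftor u)) (op_nat \<epsilon>) (op_nat \<eta>)"
    using op_adjunction[OF U] by simp
  have P': "adjunction (op_ftor P) (on_ftor (op_diagram D) (to_one (over_cat (op_ftor u) k)))
      (op_nat \<epsilon>') (op_nat \<eta>')"
    using op_adjunction[OF P] by (simp add: op_to_one op_over_cat)
  interpret mate_square "on_cat (op_diagram D) (op_cat J)" "on_cat (op_diagram D) (op_cat K)"
      "on_cat (op_diagram D) (over_cat (op_ftor u) k)" "on_cat (op_diagram D) one_cat"
      "op_ftor U" "on_ftor (op_diagram D) (op_ftor u)" "op_nat \<epsilon>" "op_nat \<eta>"
      "op_ftor P" "on_ftor (op_diagram D) (to_one (over_cat (op_ftor u) k))" "op_nat \<epsilon>'" "op_nat \<eta>'"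
      "on_ftor (op_diagram D) (over_proj (op_ftor u) k)" "on_ftor (op_diagram D) (point (op_cat K) k)"
      "on_nat (op_diagram D) (over_nat (op_ftor u) k)"
    by (rule op.kan_square[of "op_cat J" "op_cat K"]) (use small u k U' P' in simp_all)
  note f = mate_factors
  have "op_nat mate = (op_nat ((op_ftor P \<circ>\<^sub>F on_ftor (op_diagram D) (over_proj (op_ftor u) k)) \<triangleright>
      op_nat \<epsilon>) \<bullet>
     op_nat (op_ftor P \<triangleright> (on_nat (op_diagram D) (over_nat (op_ftor u) k) \<triangleleft> op_ftor U))) \<bullet>
     op_nat (op_nat \<eta>' \<triangleleft> (on_ftor (op_diagram D) (point (op_cat K) k) \<circ>\<^sub>F op_ftor U))"
    unfolding left_mate_def op_vcomp[OF vcomp_nats[OF f(1,2)] f(3)] op_vcomp[OF f(1,2)] ..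
  also have "\<dots> = op_nat ((op_ftor P \<circ>\<^sub>F on_ftor (op_diagram D) (over_proj (op_ftor u) k)) \<triangleright> op_nat \<epsilon>) \<bullet>
     op_nat (op_ftor P \<triangleright> (on_nat (op_diagram D) (over_nat (op_ftor u) k) \<triangleleft> op_ftor U)) \<bullet>
     op_nat (op_nat \<eta>' \<triangleleft> (on_ftor (op_diagram D) (point (op_cat K) k) \<circ>\<^sub>F op_ftor U))"
    by (rule vcomp_assoc[OF op_nats[OF f(3)] op_nats[OF f(2)] op_nats[OF f(1)]])
  also have "\<dots> = right_kan_map D u k U \<epsilon> P \<eta>'"
    unfolding op_whisker_left[OF adjU(2)] op_whisker_left[OF whisker_right_nats[OF \<alpha> U composites(1)]]
    by (simp add: right_kan_map_def op_whisker_right op_comp_ftor op_over_proj op_over_nat op_point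
        functor_simps(2)[OF u])
  finally show ?thesis by (simp add: left_kan_map_eq_left_mate functor_simps(2)[OF u])
qed

lemma left_derivator_of_derivator:
  assumes "derivator D" shows "left_derivator D"
proof -
  interpret derivator D by fact
  show ?thesis by unfold_locales (fact Der2 Der3_left Der4_left)+
qed

lemma left_derivator_op:
  assumes "derivator D" shows "left_derivator (op_diagram D)"
proof -
  interpret derivator D by fact
  show ?thesis
  proof (intro left_derivator.intro left_derivator_axioms.intro prederivator_op, goal_cases)
    case (1 J f) then show ?case using Der2[of "op_cat J" f] by (simp add: op_point)
  next
    case (2 J K u)
    then obtain U \<eta> \<epsilon> where "adjunction (on_ftor D (op_ftor u)) U \<eta> \<epsilon>"
      using Der3_right[of "op_cat J" "op_cat K" "op_ftor u"] by auto
    from op_adjunction[OF this] show ?case by auto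
  next
    case (3 J K u k U \<eta> \<epsilon> P \<eta>' \<epsilon>')
    have U: "adjunction (on_ftor D (op_ftor u)) (op_ftor U) (op_nat \<epsilon>) (op_nat \<eta>)"
      using op_adjunction[OF 3(5)] by simp
    have P: "adjunction (on_ftor D (to_one (under_cat (op_ftor u) k))) (op_ftor P) (op_nat \<epsilon>')
        (op_nat \<eta>')"
      using op_adjunction[OF 3(6)] by (simp add: op_to_one op_over_cat)
    have s: "small_cat (op_cat J)" "small_cat (op_cat K)" "op_ftor u \<in> functors (op_cat J) (op_cat
        K)" "k \<in> Obj (op_cat K)"
      using 3 by simp_all
    show ?case using nat_iso_op[OF Der4_right[OF s U P]] right_kan_map_dual[OF s U P] by simp
  qed
qed

text \<open>
  The two prederivators are the same on functors and on natural transformations, but not as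
  records, since they may differ on ill-formed transformations. Hence the comparison of their
  Kan extension maps.
\<close>

lemma left_kan_map_shift_op:
  assumes "u \<in> functors J K" "k \<in> Obj K"
  shows "left_kan_map (op_diagram (shift D M)) u k U \<eta> P \<epsilon> =
    left_kan_map (shift (op_diagram D) (op_cat M)) u k U \<eta> P \<epsilon>"
  by (simp add: left_kan_map_def op_sprod_ftor op_sprod_nat functor_simps[OF assms(1)])

section \<open>The shifted derivator\<close>

text \<open>
  The functor in question is the one of (Der1) for \<open>M \<times> J\<close> and \<open>M \<times> K\<close>, preceded by the
  isomorphism that \<open>D\<close> assigns to \<open>sum_distrib\<close>.
\<close>

lemma equivalence_shift_sum:
  assumes D: "derivator D" and sM: "small_cat M" and small: "small_cat J" "small_cat K"
  shows "equivalence (pair_ftor (on_ftor (shift D M) (in_left J K)) (on_ftor (shift D M) (in_right J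
      K)))"
proof -
  interpret derivator D by fact
  have cats: "category M" "category J" "category K" using sM small by (simp_all add: small_cat_def)
  define S where "S = sum_cat (sprod M J) (sprod M K)"
  note sJ = sprod_small[OF sM small(1)] and sK = sprod_small[OF sM small(2)]
  have sS: "small_cat S" unfolding S_def by (rule sum_small[OF sJ sK])
  have sT: "small_cat (sprod M (sum_cat J K))" by (rule sprod_small[OF sM sum_small[OF small]])
  have cs: "category (sprod M J)" "category (sprod M K)" using sJ sK by (simp_all add: small_cat_def)
  note l = in_left_functors[OF cs, folded S_def] and r = in_right_functors[OF cs, folded S_def]
  define \<phi> where "\<phi> = sum_distrib M J K"
  have \<phi>: "\<phi> \<in> functors S (sprod M (sum_cat J K))"
      unfolding \<phi>_def S_def by (rule sum_distrib_functors[OF cats])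
  obtain \<psi> where inv: "inverse_ftors S (sprod M (sum_cat J K)) \<phi> \<psi>"
    using sum_distrib_inverse[OF cats] by (auto simp: S_def \<phi>_def)
  let ?L = "on_ftor D (in_left (sprod M J) (sprod M K))"
      and ?R = "on_ftor D (in_right (sprod M J) (sprod M K))"
  have L: "?L \<in> functors (on_cat D S) (on_cat D (sprod M J))" by (rule on_ftor[OF sJ sS l])
  have R: "?R \<in> functors (on_cat D S) (on_cat D (sprod M K))" by (rule on_ftor[OF sK sS r])
  have F: "on_ftor D \<phi> \<in> functors (on_cat D (sprod M (sum_cat J K))) (on_cat D S)"
      by (rule on_ftor[OF sS sT \<phi>])
  have "on_ftor (shift D M) (in_left J K) = ?L \<circ>\<^sub>F on_ftor D \<phi>"
    using on_comp_ftor[OF sJ sS sT l \<phi>] sum_distrib_in_left[OF cats] by (simp add: \<phi>_def)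
  moreover have "on_ftor (shift D M) (in_right J K) = ?R \<circ>\<^sub>F on_ftor D \<phi>"
    using on_comp_ftor[OF sK sS sT r \<phi>] sum_distrib_in_right[OF cats] by (simp add: \<phi>_def)
  moreover have "pair_ftor (?L \<circ>\<^sub>F on_ftor D \<phi>) (?R \<circ>\<^sub>F on_ftor D \<phi>) = pair_ftor ?L ?R \<circ>\<^sub>F on_ftor D \<phi>"
    using functor_simps[OF L] functor_simps[OF R] functor_simps[OF F]
    by (auto simp: pair_ftor_def comp_ftor_def mk_ftor_def restrict_def fun_eq_iff)
  moreover have "equivalence (pair_ftor ?L ?R \<circ>\<^sub>F on_ftor D \<phi>)"
    by (rule equivalence_comp_inverse_ftors[OF Der1_sum[OF sJ sK] _ on_inverse_ftors[OF sS sT inv]])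
      (simp add: pair_ftor_def functor_simps[OF L])
  ultimately show ?thesis by simp
qed

theorem theorem1p31:
  fixes D :: "('u::universe, 'o, 'a) diagram_functor" and M :: "'u scat"
  assumes "derivator D" and "small_cat M"
  shows "derivator (shift D M)"
proof -
  interpret derivator D by fact
  interpret left: left_derivator D by (rule left_derivator_of_derivator[OF assms(1)])
  interpret op: left_derivator "op_diagram D" by (rule left_derivator_op[OF assms(1)])
  interpret sh: prederivator "shift D M" by (rule prederivator_shift[OF assms(2)])
  have M: "category M" using assms(2) by (simp add: small_cat_def)
  note sp = sprod_small[OF assms(2)] and F = sprod_ftor_functors[OF M]
  show ?thesis
  proof (intro derivator.intro derivator_axioms.intro sh.prederivator_axioms, goal_cases)
    case 1 then show ?case using equivalence_shift_sum assms by blast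
  next
    case 2 then show ?case using Der1_empty by (simp add: sprod_empty)
  next
    case (3 J f)
    have J: "category J" using 3 by (simp add: small_cat_def)
    have f: "f \<in> Arr (on_cat D (sprod M J))" using 3 by simp
    note F1 = F[OF point_functors[OF J]]
    have *: "FArr (on_ftor D (point (sprod M one_cat) (pair m tagL))) (FArr (on_ftor D (sprod_ftor M
        (point J j))) f) =
      FArr (on_ftor D (point (sprod M J) (pair m j))) f" if "m \<in> Obj M" "j \<in> Obj J" for m j
    proof -
      have p: "pair m tagL \<in> Obj (sprod M one_cat)" using that by simp
      have "sprod_ftor M (point J j) \<circ>\<^sub>F point (sprod M one_cat) (pair m tagL) =
          point (sprod M J) (pair m j)"
        using comp_point[OF F1[OF that(2)] p] that by simp
      with on_comp_ftor[OF small_one_cat sp[OF small_one_cat] sp[OF 3(1)]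
          point_functors[OF sprod_category[OF M one_category] p] F1[OF that(2)]]
      show ?thesis using f functor_simps(1)[OF on_ftor[OF sp[OF small_one_cat] sp[OF 3(1)] F1[OF
          that(2)]]] by simp
    qed
    have "iso (on_cat D (sprod M one_cat)) (FArr (on_ftor D (sprod_ftor M (point J j))) f) \<longleftrightarrow>
      (\<forall>m\<in>Obj M. iso (on_cat D one_cat) (FArr (on_ftor D (point (sprod M J) (pair m j))) f))"
          if j: "j \<in> Obj J" for j
    proof -
      have "FArr (on_ftor D (sprod_ftor M (point J j))) f \<in> Arr (on_cat D (sprod M one_cat))"
        using f functor_simps(6)[OF on_ftor[OF sp[OF small_one_cat] sp[OF 3(1)] F1[OF j]]] by simp
      note Der2[OF sp[OF small_one_cat] this]
      moreover have "(\<forall>x\<in>Obj (sprod M one_cat). Q x) \<longleftrightarrow> (\<forall>m\<in>Obj M. Q (pair m tagL))" for Q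
        by (auto simp: in_sprod_iff)
      ultimately show ?thesis using *[OF _ j] by simp
    qed
    then show ?case using Der2[OF sp[OF 3(1)] f] by (auto simp: in_sprod_iff)
  next
    case (4 J K u) then show ?case using Der3_left[OF sp sp F] by simp
  next
    case (5 J K u) then show ?case using Der3_right[OF sp sp F] by simp
  next
    case 6 then show ?case by (rule left.left_kan_map_shift_iso[OF assms(2)])
  next
    case (7 J K u k U \<eta> \<epsilon> P \<eta>' \<epsilon>')
    have U: "adjunction (op_ftor U) (on_ftor (shift (op_diagram D) (op_cat M)) (op_ftor u)) (op_nat
        \<epsilon>) (op_nat \<eta>)"
      using op_adjunction[OF 7(5)] by (simp add: op_sprod_ftor)
    have P: "adjunction (op_ftor P) (on_ftor (shift (op_diagram D) (op_cat M)) (to_one (over_cat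
        (op_ftor u) k))) (op_nat \<epsilon>') (op_nat \<eta>')"
      using op_adjunction[OF 7(6)] by (simp add: op_sprod_ftor op_to_one op_over_cat)
    have s: "small_cat (op_cat J)" "small_cat (op_cat K)" "op_ftor u \<in> functors (op_cat J) (op_cat
        K)" "k \<in> Obj (op_cat K)"
      using 7 by simp_all
    have "nat_iso (left_kan_map (op_diagram (shift D M)) (op_ftor u) k (op_ftor U) (op_nat \<epsilon>)
        (op_ftor P) (op_nat \<eta>'))"
      unfolding left_kan_map_shift_op[OF s(3,4)]
      by (rule op.left_kan_map_shift_iso[OF _ s U P]) (simp add: assms)
    then show ?case using nat_iso_op sh.right_kan_map_dual[OF 7] by simp
  qed
qed

end
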